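(* ${}^1\mathsf{OG\mapsto\alpha0}\equiv_{\mathsf{W}}\mathsf{Min}$, where ${}^1\mathsf{OG\mapsto\alpha0}$ is the first-order part of the problem $\mathsf{OG\mapsto\alpha0}$ which, given a countable ordered group $(G,\leq)$ whose order type is $\mathbb{Z}^{\alpha}$ for some ordinal $\alpha$, outputs a copy of $\alpha$; and $\mathsf{Min}:\mathbb{N}^{\mathbb{N}}\to\mathbb{N}$ is the problem $\mathsf{Min}(p)=\min\{p(n):n\in\mathbb{N}\}$.
   Context: Weihrauch reducibility: a represented space is a set $X$ with a partial surjection $\delta_X:\subseteq\mathbb{N}^{\mathbb{N}}\to X$; if $\delta_X(p)=x$, $p$ is a name of $x$. A problem is a partial multi-valued function between represented spaces. $f\leq_{\mathsf{W}}g$ iff there are computable partial functions $\Phi,\Psi$ on Baire space such that whenever $p$ is a name of some $x\in\mathrm{dom}(f)$, $\Phi(p)$ is a name of some $z\in\mathrm{dom}(g)$, and for every name $q$ of an element of $g(z)$, $\Psi(p,q)$ is a name of an element of $f(x)$. $f\equiv_{\mathsf{W}}g$ means $f\leq_{\mathsf{W}}g$ and $g\leq_{\mathsf{W}}f$. First-order part: a problem $\mathsf{Q}$ is first-order if its outputs are natural numbers. The first-order part ${}^1\mathsf{P}$ of a problem $\mathsf{P}$ is (up to $\equiv_{\mathsf{W}}$) $\max_{\leq_{\mathsf{W}}}\{\mathsf{Q}\text{ first-order}:\mathsf{Q}\leq_{\mathsf{W}}\mathsf{P}\}$. It exists and is realized by the problem whose instances are triples $\langle f,\Phi,\Psi\rangle$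 with $f\in\mathbb{N}^{\mathbb{N}}$ and $\Phi,\Psi$ Turing functionals such that $\Phi(f)\in\mathrm{dom}(\mathsf{P})$ and $\Psi^{f\oplus g}(0)\downarrow$ for all $g\in\mathsf{P}(\Phi(f))$, and whose solutions are all $y$ with $\Psi^{f\oplus g}(0)\downarrow=y$ for some $g\in\mathsf{P}(\Phi(f))$. Ordered groups: an ordered group is a group $G$ with a linear order $\leq$ such that $a\leq b$ implies $ag\leq bg$ and $ga\leq gb$ for all $g$. Countable ordered groups are presented on subsets of $\mathbb{N}$, a name coding the universe, operation and order. The order type of $G$ is a linear order $X$ such that there is an order-preserving bijection $G\to X$. $\mathbb{Z}^X$ is the set of finitely supported functions $X\to\mathbb{Z}$, where for $f\neq g$, $f<g$ iff $f(x)<g(x)$ at the maximum $x$ where they differ. A copy of an ordinal $\alpha$ is a pair $(A,<_A)$ with $A\subseteq\mathbb{N}$, $<_A\subseteq A\times A$ a well-order of $A$ isomorphic to $\alpha$, coded in Baire space. *)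

theory Defs
  imports "HOL-Library.Nat_Bijection" "HOL-Algebra.Group"
begin

section \<open>Computability on Baire space\<close>

type_synonym baire = "nat \<Rightarrow> nat"

text \<open>
  Oracle computations are Kleene's partial recursive functions relative to a function
  \<open>p\<close>. A program serves all arities: \<open>p_eval p e xs y\<close> says that the program
  \<open>e\<close> with oracle \<open>p\<close> halts on the argument list \<open>xs\<close> with output \<open>y\<close>. A program
  applied to a list of the wrong length diverges. In \<open>PrimRec\<close> the recursion variable is the
  first argument, and the step function gets the counter, then the previous value, then the
  parameters.
\<close>

datatype prog =
    Zero
  | Succ
  | Oracle
  | Proj nat
  | Comp prog "prog list"
  | PrimRec prog prog
  | Minim prog

inductive p_eval :: "baire \<Rightarrow> prog \<Rightarrow> nat list \<Rightarrow> nat \<Rightarrow> bool" for p :: baire where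
  Zero: "p_eval p Zero xs 0"
| Succ: "p_eval p Succ [x] (Suc x)"
| Oracle: "p_eval p Oracle [x] (p x)"
| Proj: "i < length xs \<Longrightarrow> p_eval p (Proj i) xs (xs ! i)"
| Comp: "list_all2 (\<lambda>g y. p_eval p g xs y) gs ys \<Longrightarrow> p_eval p f ys z
    \<Longrightarrow> p_eval p (Comp f gs) xs z"
| PrimRec_0: "p_eval p f xs y \<Longrightarrow> p_eval p (PrimRec f g) (0 # xs) y"
| PrimRec_Suc: "p_eval p (PrimRec f g) (n # xs) y \<Longrightarrow> p_eval p g (n # y # xs) z
    \<Longrightarrow> p_eval p (PrimRec f g) (Suc n # xs) z"
| Minim: "p_eval p f (n # xs) 0 \<Longrightarrow> (\<forall>k<n. \<exists>y>0. p_eval p f (k # xs) y)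
    \<Longrightarrow> p_eval p (Minim f) xs n"

inductive_cases p_eval_ZeroE: "p_eval p Zero xs y"
inductive_cases p_eval_SuccE: "p_eval p Succ xs y"
inductive_cases p_eval_OracleE: "p_eval p Oracle xs y"
inductive_cases p_eval_ProjE: "p_eval p (Proj i) xs y"
inductive_cases p_eval_CompE: "p_eval p (Comp f gs) xs y"
inductive_cases p_eval_PrimRec_0E: "p_eval p (PrimRec f g) (0 # xs) y"
inductive_cases p_eval_PrimRec_SucE: "p_eval p (PrimRec f g) (Suc n # xs) y"
inductive_cases p_eval_MinimE: "p_eval p (Minim f) xs y"

lemma p_eval_deterministic:
  "p_eval p e xs y \<Longrightarrow> p_eval p e xs z \<Longrightarrow> y = z"
proof (induction arbitrary: z rule: p_eval.induct)
  case (Zero xs)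
  then show ?case by (blast elim: p_eval_ZeroE)
next
  case (Succ x)
  then show ?case by (auto elim: p_eval_SuccE)
next
  case (Oracle x)
  then show ?case by (auto elim: p_eval_OracleE)
next
  case (Proj i xs)
  then show ?case by (auto elim: p_eval_ProjE)
next
  case (Comp xs gs ys f w)
  from Comp.prems obtain ys' where
    ys': "list_all2 (\<lambda>g y. p_eval p g xs y) gs ys'" "p_eval p f ys' z"
    by (rule p_eval_CompE)
  have "ys = ys'"
    using Comp.IH(1) ys'(1) by (auto simp: list_all2_conv_all_nth intro!: nth_equalityI)
  with Comp.IH(2) ys'(2) show ?case by blast
next
  case (PrimRec_0 f xs y g)
  from PrimRec_0.prems have "p_eval p f xs z" by (rule p_eval_PrimRec_0E)
  then show ?case by (rule PrimRec_0.IH)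
next
  case (PrimRec_Suc f g n xs y w)
  from PrimRec_Suc.prems obtain y' where
    y': "p_eval p (PrimRec f g) (n # xs) y'" "p_eval p g (n # y' # xs) z"
    by (rule p_eval_PrimRec_SucE)
  have "y = y'" using y'(1) by (rule PrimRec_Suc.IH(1))
  with y'(2) show ?case using PrimRec_Suc.IH(2) by blast
next
  case (Minim f n xs)
  from Minim.prems have z: "p_eval p f (z # xs) 0" "\<forall>k<z. \<exists>y>0. p_eval p f (k # xs) y"
    by (auto elim: p_eval_MinimE)
  have "\<not> z < n" using Minim.IH(2) z(1) by (metis less_irrefl)
  moreover have "\<not> n < z" using Minim.IH(1) z(2) by (metis less_irrefl)
  ultimately show ?case by simp
qed

text \<open>The partial function on Baire space computed by a program, with its natural domain: the
  computation of the output at every argument has to halt.\<close>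

definition functional :: "prog \<Rightarrow> baire \<rightharpoonup> baire" where
  "functional e p =
     (if \<forall>n. \<exists>y. p_eval p e [n] y then Some (\<lambda>n. THE y. p_eval p e [n] y) else None)"

definition computable :: "(baire \<rightharpoonup> baire) \<Rightarrow> bool" where
  "computable F \<longleftrightarrow> (\<exists>e. F = functional e)"

definition join :: "baire \<Rightarrow> baire \<Rightarrow> baire" (infixr "\<oplus>\<^sub>B" 65) where
  "p \<oplus>\<^sub>B q = (\<lambda>n. if even n then p (n div 2) else q (n div 2))"

definition left_part :: "baire \<Rightarrow> baire" where
  "left_part p = (\<lambda>n. p (2 * n))"

definition right_part :: "baire \<Rightarrow> baire" where
  "right_part p = (\<lambda>n. p (2 * n + 1))"

text \<open>An effective Goedel numbering of programs.\<close>

fun index :: "prog \<Rightarrow> nat" where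
  "index Zero = prod_encode (0, 0)"
| "index Succ = prod_encode (1, 0)"
| "index Oracle = prod_encode (2, 0)"
| "index (Proj i) = prod_encode (3, i)"
| "index (Comp f gs) = prod_encode (4, prod_encode (index f, list_encode (map index gs)))"
| "index (PrimRec f g) = prod_encode (5, prod_encode (index f, index g))"
| "index (Minim f) = prod_encode (6, index f)"

lemma index_eq_iff: "index a = index b \<longleftrightarrow> a = b"
proof
  show "index a = index b \<Longrightarrow> a = b"
  proof (induction a arbitrary: b)
    case (Comp f gs)
    then obtain f' gs' where b: "b = Comp f' gs'" "index f = index f'"
      "map index gs = map index gs'"
      by (cases b) (auto simp: list_encode_eq)
    have "gs = gs'"
      by (rule list.inj_map_strong[OF _ b(3)]) (use Comp.IH(2) in blast)
    with b Comp.IH(1) show ?case by blast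
  next
    case (PrimRec f g)
    then show ?case by (cases b) auto
  next
    case (Minim f)
    then show ?case by (cases b) auto
  qed (case_tac b; simp)+
qed simp

lemma inj_index: "inj index"
  by (simp add: inj_def index_eq_iff)


section \<open>Represented spaces, problems, Weihrauch reducibility\<close>

text \<open>A represented space is given by its representation; the underlying set is the range
  of the representation.\<close>

type_synonym 'a representation = "baire \<rightharpoonup> 'a"

record ('a, 'b) problem =
  inputs :: "'a representation"
  outputs :: "'b representation"
  solutions :: "'a \<Rightarrow> 'b set"

definition problem :: "('a, 'b) problem \<Rightarrow> bool" where
  "problem P \<longleftrightarrow> (\<forall>x. solutions P x \<noteq> {} \<longrightarrow> x \<in> ran (inputs P))
     \<and> (\<forall>x. solutions P x \<subseteq> ran (outputs P))"

definition instances :: "('a, 'b) problem \<Rightarrow> 'a set" where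
  "instances P = {x \<in> ran (inputs P). solutions P x \<noteq> {}}"

definition weihrauch_le :: "('a, 'b) problem \<Rightarrow> ('c, 'd) problem \<Rightarrow> bool"
    (infix "\<le>\<^sub>W" 50) where
  "P \<le>\<^sub>W Q \<longleftrightarrow>
     (\<exists>\<Phi> \<Psi>. computable \<Phi> \<and> computable \<Psi> \<and>
       (\<forall>p x. inputs P p = Some x \<and> x \<in> instances P \<longrightarrow>
         (\<exists>r z. \<Phi> p = Some r \<and> inputs Q r = Some z \<and> z \<in> instances Q \<and>
           (\<forall>q y. outputs Q q = Some y \<and> y \<in> solutions Q z \<longrightarrow>
             (\<exists>s w. \<Psi> (p \<oplus>\<^sub>B q) = Some s \<and> outputs P s = Some w \<and> w \<in> solutions P x)))))"

definition weihrauch_equiv :: "('a, 'b) problem \<Rightarrow> ('c, 'd) problem \<Rightarrow> bool"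
    (infix "\<equiv>\<^sub>W" 50) where
  "P \<equiv>\<^sub>W Q \<longleftrightarrow> P \<le>\<^sub>W Q \<and> Q \<le>\<^sub>W P"


section \<open>First-order part\<close>

definition nat_rep :: "nat representation" where
  "nat_rep p = Some (p 0)"

definition first_order :: "('a, nat) problem \<Rightarrow> bool" where
  "first_order Q \<longleftrightarrow> problem Q \<and> outputs Q = nat_rep"

text \<open>\<open>R\<close> is a \<open>\<le>\<^sub>W\<close>-greatest first-order problem below \<open>P\<close>. A HOL formula
  cannot quantify over types, so the type \<open>'a\<close> over which the input spaces of the competitors
  range is a parameter; it is universally quantified in a theorem where it occurs free.\<close>

definition is_first_order_part ::
    "'a itself \<Rightarrow> ('r, nat) problem \<Rightarrow> ('b, 'c) problem \<Rightarrow> bool" where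
  "is_first_order_part (_ :: 'a itself) R P \<longleftrightarrow>
     first_order R \<and> R \<le>\<^sub>W P \<and>
     (\<forall>Q :: ('a, nat) problem. first_order Q \<and> Q \<le>\<^sub>W P \<longrightarrow> Q \<le>\<^sub>W R)"

text \<open>A name of a triple \<open>(f, \<Phi>, \<Psi>)\<close> lists the indices of \<open>\<Phi>\<close> and \<open>\<Psi>\<close>, followed by the
  values of \<open>f\<close>.\<close>

definition triple_rep :: "(baire \<times> prog \<times> prog) representation" where
  "triple_rep r =
     (if r 0 \<in> range index \<and> r 1 \<in> range index
      then Some (\<lambda>n. r (n + 2), the_inv index (r 0), the_inv index (r 1)) else None)"

definition names_of_solutions :: "('a, 'b) problem \<Rightarrow> baire \<Rightarrow> baire set" where
  "names_of_solutions P r =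
     {g. \<exists>z y. inputs P r = Some z \<and> outputs P g = Some y \<and> y \<in> solutions P z}"

definition first_order_instance :: "('a, 'b) problem \<Rightarrow> baire \<times> prog \<times> prog \<Rightarrow> bool" where
  "first_order_instance P = (\<lambda>(f, \<Phi>, \<Psi>).
     \<exists>r z. functional \<Phi> f = Some r \<and> inputs P r = Some z \<and> z \<in> instances P \<and>
       (\<forall>g \<in> names_of_solutions P r. \<exists>y. p_eval (f \<oplus>\<^sub>B g) \<Psi> [0] y))"

definition first_order_part :: "('a, 'b) problem \<Rightarrow> (baire \<times> prog \<times> prog, nat) problem" where
  "first_order_part P =
     \<lparr> inputs = triple_rep,
       outputs = nat_rep,
       solutions = (\<lambda>(f, \<Phi>, \<Psi>).
         {y. first_order_instance P (f, \<Phi>, \<Psi>) \<and>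
             (\<exists>r. functional \<Phi> f = Some r \<and>
               (\<exists>g \<in> names_of_solutions P r. p_eval (f \<oplus>\<^sub>B g) \<Psi> [0] y))}) \<rparr>"


section \<open>Ordered groups and their order types\<close>

record 'a ogroup = "'a monoid" +
  le_rel :: "'a rel"

definition ordered_group :: "('a, 'm) ogroup_scheme \<Rightarrow> bool" where
  "ordered_group G \<longleftrightarrow>
     group G \<and> linear_order_on (carrier G) (le_rel G) \<and>
     (\<forall>a \<in> carrier G. \<forall>b \<in> carrier G. \<forall>g \<in> carrier G. (a, b) \<in> le_rel G \<longrightarrow>
       (a \<otimes>\<^bsub>G\<^esub> g, b \<otimes>\<^bsub>G\<^esub> g) \<in> le_rel G \<and> (g \<otimes>\<^bsub>G\<^esub> a, g \<otimes>\<^bsub>G\<^esub> b) \<in> le_rel G)"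

text \<open>For a reflexive linear order \<open>X\<close> on \<open>Field X\<close>, the linear order \<open>\<int>\<^sup>X\<close>. The functions are
  total on the type and vanish outside \<open>Field X\<close>.\<close>

definition Zpow_carrier :: "'a rel \<Rightarrow> ('a \<Rightarrow> int) set" where
  "Zpow_carrier X = {f. finite {x. f x \<noteq> 0} \<and> {x. f x \<noteq> 0} \<subseteq> Field X}"

definition Zpow :: "'a rel \<Rightarrow> ('a \<Rightarrow> int) rel" where
  "Zpow X = {(f, g). f \<in> Zpow_carrier X \<and> g \<in> Zpow_carrier X \<and>
     (f = g \<or> (\<exists>x. f x < g x \<and> (\<forall>y. f y \<noteq> g y \<longrightarrow> (y, x) \<in> X)))}"

definition has_order_type :: "('a, 'm) ogroup_scheme \<Rightarrow> 'b rel \<Rightarrow> bool" where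
  "has_order_type G L \<longleftrightarrow>
     (\<exists>h. bij_betw h (carrier G) (Field L) \<and>
       (\<forall>a \<in> carrier G. \<forall>b \<in> carrier G. (a, b) \<in> le_rel G \<longleftrightarrow> (h a, h b) \<in> L))"

lemma Field_Zpow: "Field (Zpow X) = Zpow_carrier X"
  by (auto simp: Field_def Zpow_def)


section \<open>The problems\<close>

definition set_rep :: "nat set representation" where
  "set_rep p = (if range p \<subseteq> {0, 1} then Some {n. p n = 1} else None)"

definition rel_rep :: "nat rel representation" where
  "rel_rep p = (if range p \<subseteq> {0, 1} then Some {(x, y). p (prod_encode (x, y)) = 1} else None)"

text \<open>The structure on \<open>A \<subseteq> \<nat>\<close> with the operation coded by \<open>u\<close>. The values of \<open>u\<close> outside
  \<open>A \<times> A\<close> are discarded, and the neutral element is determined by the operation.\<close>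

definition coded_ogroup :: "nat set \<Rightarrow> baire \<Rightarrow> nat rel \<Rightarrow> nat ogroup" where
  "coded_ogroup A u R =
     \<lparr> carrier = A,
       mult = (\<lambda>x y. if x \<in> A \<and> y \<in> A then u (prod_encode (x, y)) else 0),
       one = (THE e. e \<in> A \<and> (\<forall>x \<in> A. u (prod_encode (e, x)) = x \<and> u (prod_encode (x, e)) = x)),
       le_rel = R \<rparr>"

text \<open>A name of a countable ordered group is \<open>a \<oplus>\<^sub>B u \<oplus>\<^sub>B r\<close>, where \<open>a\<close> and \<open>r\<close> are the
  characteristic functions of the universe and of the order, and \<open>u\<close> is the operation.\<close>

definition ogroup_rep :: "nat ogroup representation" where
  "ogroup_rep p =
     (case (set_rep (left_part p), rel_rep (right_part (right_part p))) of
        (Some A, Some R) \<Rightarrow>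
          (let G = coded_ogroup A (left_part (right_part p)) R
           in if ordered_group G then Some G else None)
      | _ \<Rightarrow> None)"

text \<open>Copies of ordinals are well-ordered subsets of \<open>\<nat>\<close> with a strict order, whereas well-orders
  in the HOL library are reflexive.\<close>

definition refl_order :: "nat set \<times> nat rel \<Rightarrow> nat rel" where
  "refl_order = (\<lambda>(A, R). R \<union> Id_on A)"

definition strict_well_order :: "nat set \<times> nat rel \<Rightarrow> bool" where
  "strict_well_order = (\<lambda>(A, R). R \<subseteq> A \<times> A \<and> irrefl R \<and> well_order_on A (refl_order (A, R)))"

definition copy_of :: "nat set \<times> nat rel \<Rightarrow> 'a rel \<Rightarrow> bool" where
  "copy_of C \<alpha> \<longleftrightarrow> strict_well_order C \<and> (refl_order C, \<alpha>) \<in> ordIso"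

definition copy_rep :: "(nat set \<times> nat rel) representation" where
  "copy_rep p =
     (case (set_rep (left_part p), rel_rep (right_part p)) of
        (Some A, Some R) \<Rightarrow> if strict_well_order (A, R) then Some (A, R) else None
      | _ \<Rightarrow> None)"

text \<open>An ordinal is given by a well-order \<open>\<alpha>\<close> (in the sense of the library, on \<open>Field \<alpha>\<close>) on a
  set of natural numbers. These exhaust the ordinals that matter: \<open>\<int>\<^sup>\<alpha>\<close> is in bijection with a
  countable group, so \<open>\<alpha>\<close> is countable.\<close>

definition OG_alpha0 :: "(nat ogroup, nat set \<times> nat rel) problem" where
  "OG_alpha0 =
     \<lparr> inputs = ogroup_rep,
       outputs = copy_rep,
       solutions = (\<lambda>G. {C. G \<in> ran ogroup_rep \<and>
         (\<exists>\<alpha> :: nat rel. Well_order \<alpha> \<and> has_order_type G (Zpow \<alpha>) \<and> copy_of C \<alpha>)}) \<rparr>"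

definition Min_problem :: "(baire, nat) problem" where
  "Min_problem =
     \<lparr> inputs = Some,
       outputs = nat_rep,
       solutions = (\<lambda>p. {LEAST m. m \<in> range p}) \<rparr>"

lemma join_parts [simp]: "left_part (p \<oplus>\<^sub>B q) = p" "right_part (p \<oplus>\<^sub>B q) = q"
  by (auto simp: left_part_def right_part_def join_def)

lemma ran_nat_rep: "ran nat_rep = UNIV"
proof -
  have "nat_rep (\<lambda>_. n) = Some n" for n
    by (simp add: nat_rep_def)
  then show ?thesis by (auto intro: ranI)
qed

lemma ran_copy_rep: "ran copy_rep = {C. strict_well_order C}"
proof (intro equalityI subsetI)
  fix C assume "C \<in> {C. strict_well_order C}"
  moreover obtain A R where C: "C = (A, R)" by (cases C)
  moreover define a where "a = (\<lambda>n. if n \<in> A then 1 else 0 :: nat)"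
  moreover define b where "b = (\<lambda>n. if prod_decode n \<in> R then 1 else 0 :: nat)"
  ultimately have "copy_rep (a \<oplus>\<^sub>B b) = Some C"
    by (auto simp: copy_rep_def set_rep_def rel_rep_def)
  then show "C \<in> ran copy_rep" by (auto simp: ran_def)
qed (auto simp: ran_def copy_rep_def split: option.splits if_splits)

lemma problem_Min: "problem Min_problem"
  by (simp add: problem_def Min_problem_def ran_nat_rep) (auto simp: ran_def)

lemma problem_OG_alpha0: "problem OG_alpha0"
  by (auto simp: problem_def OG_alpha0_def ran_copy_rep copy_of_def)

end

theory Submission
  imports Defs
begin

text \<open>
  Upper bound. A computation reads only finitely many values of the copy of \<open>\<alpha>\<close> it is given,
  and a finite linear order extends to a copy of \<open>\<alpha>\<close>, with all new elements beyond the part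
  that was read, as soon as it has at most \<open>\<bar>\<alpha>\<bar>\<close> elements. So it suffices to find a finite
  linear order of minimal size on which \<open>\<Psi>\<close> halts, and \<open>Min\<close> provides the minimal size: it is
  at most \<open>\<bar>\<alpha>\<bar>\<close> because \<open>\<Psi>\<close> halts on a finite part of a true copy. The group is not
  used at all.

  Lower bound. Put \<open>m = min p\<close>. From \<open>p\<close> one computes an ordered group of order type \<open>\<int>\<^sup>m\<^sup>+\<^sup>1\<close>:
  its elements are the digit sequences \<open>c\<^sub>0, \<dots>, c\<^sub>N\<close> with \<open>N = p 0\<close> such that
  \<open>\<bar>c\<^sub>j\<bar> \<le> t\<^sub>j\<close> for \<open>j < N\<close>, where \<open>t\<^sub>j\<close> is the least \<open>t\<close> with \<open>p t \<le> j\<close> and there is no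
  condition if no such \<open>t\<close> exists. Deciding the condition takes only the values \<open>p t\<close> for
  \<open>t < \<bar>c\<^sub>j\<bar>\<close>. The digits below \<open>m\<close> are unrestricted; those from \<open>m\<close> on are the digits of a
  single integer in the balanced mixed radix system with the odd bases \<open>2 t\<^sub>j + 1\<close>, and in a
  balanced system the order of the values is the lexicographic order of the digits. Given a
  copy of \<open>m + 1\<close>, one waits for \<open>p n + 1\<close> of its elements to appear, for some \<open>n\<close>; then
  \<open>p n = m\<close>.
\<close>

section \<open>Total computable functions\<close>

text \<open>An instance of the first-order part contains programs, so a reduction from it has to run
  a program given by its index. The universal machine needed for this is a search for finite
  derivations, each of which a bounded check verifies.

  In the lower bound no finite part of \<open>p\<close> shows that a position lies below the
  minimum, since a smaller value may still come. Any position may therefore receive a bound after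
  elements with a nonzero digit there have entered the group. For the same reason addition cannot
  decide whether to carry. It searches for the sum together with its carries and the thresholds that
  justify them: a threshold that exists can be verified from \<open>p\<close>, and a position
  without one needs no carry.

  The problem asks for a copy of some \<alpha> that fits the group, so the size of a solution has to
  be recovered from the order type. Only finite exponents matter there, and an embedding argument
  settles these.\<close>

abbreviation pi1 :: "nat \<Rightarrow> nat" where "pi1 n \<equiv> fst (prod_decode n)"
abbreviation pi2 :: "nat \<Rightarrow> nat" where "pi2 n \<equiv> snd (prod_decode n)"

text \<open>
  Functions have a single numeric argument, which codes a whole environment by pairing. A bound
  variable is paired in front of the environment: \<open>pi1 z\<close> is the new variable and \<open>pi2 z\<close> the
  old environment in the premises of the rules for recursion and bounded quantifiers. All
  rules below have higher-order patterns as conclusions, so that \<open>intro\<close> decomposes a term.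
\<close>

definition computable_fun :: "(baire \<Rightarrow> nat \<Rightarrow> nat) \<Rightarrow> bool" where
  "computable_fun F \<longleftrightarrow> (\<exists>e. \<forall>p x. p_eval p e [x] (F p x))"

text \<open>Pairing has itself to be shown computable, so the functions needed for it are built with
  two genuine arguments. They do not depend on the oracle.\<close>

definition computable_fun2 :: "(nat \<Rightarrow> nat \<Rightarrow> nat) \<Rightarrow> bool" where
  "computable_fun2 f \<longleftrightarrow> (\<exists>e. \<forall>p x y. p_eval p e [x, y] (f x y))"

definition decidable :: "(baire \<Rightarrow> nat \<Rightarrow> bool) \<Rightarrow> bool" where
  "decidable P \<longleftrightarrow> computable_fun (\<lambda>p x. if P p x then 1 else 0)"

lemma p_eval_Comp1:
  "p_eval p g xs y \<Longrightarrow> p_eval p f [y] z \<Longrightarrow> p_eval p (Comp f [g]) xs z"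
  by (rule p_eval.Comp[where ys = "[y]"]) auto

lemma p_eval_Comp2:
  "p_eval p g xs y \<Longrightarrow> p_eval p g' xs y' \<Longrightarrow> p_eval p f [y, y'] z \<Longrightarrow> p_eval p (Comp f [g, g']) xs z"
  by (rule p_eval.Comp[where ys = "[y, y']"]) auto

lemma p_eval_Proj': "i < length xs \<Longrightarrow> xs ! i = y \<Longrightarrow> p_eval p (Proj i) xs y"
  using p_eval.Proj[of i xs p] by simp

lemma computable_id: "computable_fun (\<lambda>p x. x)"
  unfolding computable_fun_def by (rule exI[of _ "Proj 0"]) (auto intro: p_eval_Proj')

lemma computable_funI: "(\<And>p x. p_eval p e [x] (F p x)) \<Longrightarrow> computable_fun F"
  unfolding computable_fun_def by (rule exI[of _ e]) simp

lemma computable_funE: "computable_fun F \<Longrightarrow> \<exists>e. \<forall>p x. p_eval p e [x] (F p x)"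
  by (simp add: computable_fun_def)

lemma computable_fun2I: "(\<And>p x y. p_eval p e [x, y] (f x y)) \<Longrightarrow> computable_fun2 f"
  unfolding computable_fun2_def by (rule exI[of _ e]) simp

lemma computable_fun2E: "computable_fun2 f \<Longrightarrow> \<exists>e. \<forall>p x y. p_eval p e [x, y] (f x y)"
  by (simp add: computable_fun2_def)

lemma computable_compose:
  assumes "computable_fun G" "computable_fun A" shows "computable_fun (\<lambda>p x. G p (A p x))"
proof -
  obtain g where g: "p_eval p g [x] (G p x)" for p x using computable_funE[OF assms(1)] by metis
  obtain a where a: "p_eval p a [x] (A p x)" for p x using computable_funE[OF assms(2)] by metis
  show ?thesis by (rule computable_funI, rule p_eval_Comp1[OF a g])
qed

lemma computable_Suc: "computable_fun A \<Longrightarrow> computable_fun (\<lambda>p x. Suc (A p x))"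
  by (rule computable_compose[of "\<lambda>p. Suc"]) (rule computable_funI, rule p_eval.Succ)

lemma computable_oracle: "computable_fun A \<Longrightarrow> computable_fun (\<lambda>p x. p (A p x))"
  by (rule computable_compose[of "\<lambda>p. p"]) (rule computable_funI, rule p_eval.Oracle)

lemma computable_const: "computable_fun (\<lambda>p x. c)"
proof (induction c)
  case 0
  show ?case by (rule computable_funI, rule p_eval.Zero)
qed (rule computable_Suc)

lemma computable_compose2:
  assumes "computable_fun2 f" "computable_fun A" "computable_fun B" shows "computable_fun (\<lambda>p x. f (A p x) (B p x))"
proof -
  obtain g where g: "p_eval p g [x, y] (f x y)" for p x y using computable_fun2E[OF assms(1)] by metis
  obtain a where a: "p_eval p a [x] (A p x)" for p x using computable_funE[OF assms(2)] by metis
  obtain b where b: "p_eval p b [x] (B p x)" for p x using computable_funE[OF assms(3)] by metis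
  show ?thesis by (rule computable_funI, rule p_eval_Comp2[OF a b g])
qed

lemma computable2_compose2:
  assumes "computable_fun2 f" "computable_fun2 g" "computable_fun2 h" shows "computable_fun2 (\<lambda>x y. f (g x y) (h x y))"
proof -
  obtain f' where f: "p_eval p f' [x, y] (f x y)" for p x y using computable_fun2E[OF assms(1)] by metis
  obtain a where a: "p_eval p a [x, y] (g x y)" for p x y using computable_fun2E[OF assms(2)] by metis
  obtain b where b: "p_eval p b [x, y] (h x y)" for p x y using computable_fun2E[OF assms(3)] by metis
  show ?thesis by (rule computable_fun2I, rule p_eval_Comp2[OF a b f])
qed

lemma computable2_proj: "computable_fun2 (\<lambda>x y. x)" "computable_fun2 (\<lambda>x y. y)"
  by (rule computable_fun2I[of "Proj 0"], simp add: p_eval_Proj') (rule computable_fun2I[of "Proj 1"], simp add: p_eval_Proj')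

lemma computable2_compose1:
  assumes "computable_fun (\<lambda>p. f)" "computable_fun2 g" shows "computable_fun2 (\<lambda>x y. f (g x y))"
proof -
  obtain f' where f: "p_eval p f' [x] (f x)" for p x using computable_funE[OF assms(1)] by metis
  obtain a where a: "p_eval p a [x, y] (g x y)" for p x y using computable_fun2E[OF assms(2)] by metis
  show ?thesis by (rule computable_fun2I, rule p_eval_Comp1[OF a f])
qed

section \<open>Arithmetic and the Cantor pairing function\<close>

lemma computable2_add: "computable_fun2 (+)"
proof -
  have "p_eval p (PrimRec (Proj 0) (Comp Succ [Proj 1])) [x, y] (x + y)" for p x y
  proof (induction x)
    case 0
    show ?case by (rule p_eval.PrimRec_0) (auto intro: p_eval_Proj')
  next
    case (Suc x)
    show ?case unfolding add_Suc
      by (rule p_eval.PrimRec_Suc[OF Suc], rule p_eval_Comp1[OF _ p_eval.Succ])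
        (auto intro: p_eval_Proj')
  qed
  then show ?thesis by (rule computable_fun2I)
qed

lemma computable_pred0: "computable_fun (\<lambda>p x. x - 1)"
proof -
  have "p_eval p (PrimRec Zero (Proj 0)) [x] (x - 1)" for p x
  proof (induction x)
    case 0
    show ?case by (simp add: p_eval.PrimRec_0 p_eval.Zero)
  next
    case (Suc x)
    show ?case
      by (rule p_eval.PrimRec_Suc[OF Suc]) (auto intro: p_eval_Proj')
  qed
  then show ?thesis by (rule computable_funI)
qed

lemma computable2_diff: "computable_fun2 (-)"
proof -
  obtain e where e: "p_eval p e [x] (x - 1)" for p x using computable_funE[OF computable_pred0] by metis
  have "p_eval p (PrimRec (Proj 0) (Comp e [Proj 1])) [x, y] (y - x)" for p x y
  proof (induction x)
    case 0
    show ?case by (rule p_eval.PrimRec_0) (auto intro: p_eval_Proj')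
  next
    case (Suc x)
    have "y - Suc x = (y - x) - 1" by simp
    then show ?case
      by (simp only:) (rule p_eval.PrimRec_Suc[OF Suc], rule p_eval_Comp1[OF _ e],
        auto intro: p_eval_Proj')
  qed
  then have "computable_fun2 (\<lambda>x y. y - x)" by (rule computable_fun2I)
  from computable2_compose2[OF this computable2_proj(2,1)] show ?thesis by simp
qed

lemma computable_triangle0: "computable_fun (\<lambda>p. triangle)"
proof -
  obtain e where e: "p_eval p e [x, y] (x + y)" for p x y using computable_fun2E[OF computable2_add] by metis
  have "p_eval p (PrimRec Zero (Comp e [Proj 1, Comp Succ [Proj 0]])) [x] (triangle x)" for p x
  proof (induction x)
    case 0
    show ?case by (simp add: p_eval.PrimRec_0 p_eval.Zero)
  next
    case (Suc x)
    show ?case unfolding triangle_Suc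
      by (rule p_eval.PrimRec_Suc[OF Suc], rule p_eval_Comp2[OF _ p_eval_Comp1[OF _ p_eval.Succ] e])
        (auto intro: p_eval_Proj')
  qed
  then show ?thesis by (rule computable_funI)
qed

lemma computable2_prod_encode: "computable_fun2 (\<lambda>x y. prod_encode (x, y))"
  unfolding prod_encode_def prod.case
  by (intro computable2_compose2[OF computable2_add] computable2_compose1[OF computable_triangle0] computable2_proj)

lemmas computable_prod_encode = computable_compose2[OF computable2_prod_encode]
  and computable_add = computable_compose2[OF computable2_add]
  and computable_diff = computable_compose2[OF computable2_diff]
  and computable_triangle = computable_compose[OF computable_triangle0]

text \<open>Cantor pairing numbers the diagonals one after the other: a pair with sum
  \<open>s\<close> has a code from \<open>triangle s\<close> to \<open>triangle s + s\<close>.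
  Decoding thus reduces to one minimisation, for the diagonal.\<close>

lemma Least_triangle: "(LEAST s. x < triangle (Suc s)) = pi1 x + pi2 x"
proof -
  obtain a b where ab: "prod_decode x = (a, b)" by force
  then have x: "x = triangle (a + b) + a"
    using prod_decode_inverse[of x] by (simp add: prod_encode_def)
  show ?thesis
  proof (rule Least_equality)
    show "x < triangle (Suc (pi1 x + pi2 x))" by (simp add: ab) (simp add: x)
    fix s assume s: "x < triangle (Suc s)"
    show "pi1 x + pi2 x \<le> s"
    proof (rule ccontr)
      assume "\<not> ?thesis"
      then have "Suc s \<le> a + b" by (simp add: ab)
      then have "triangle (Suc s) \<le> triangle (a + b)"
        by (rule lift_Suc_mono_le[of triangle, rotated]) simp
      with s x show False by simp
    qed
  qed
qed

lemma p_eval_Minim_Least: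
  assumes "\<And>k. p_eval p f (k # xs) (F k)" "\<exists>k. F k = 0"
  shows "p_eval p (Minim f) xs (LEAST k. F k = 0)"
proof (rule p_eval.Minim)
  have "F (LEAST k. F k = 0) = 0" using assms(2) by (rule LeastI_ex)
  then show "p_eval p f ((LEAST k. F k = 0) # xs) 0"
    using assms(1)[of "LEAST k. F k = 0"] by simp
  show "\<forall>k<LEAST k. F k = 0. \<exists>y>0. p_eval p f (k # xs) y"
  proof (intro allI impI)
    fix k assume "k < (LEAST k. F k = 0)"
    then have "F k \<noteq> 0" by (rule not_less_Least)
    then show "\<exists>y>0. p_eval p f (k # xs) y" using assms(1)[of k] by (intro exI[of _ "F k"]) simp
  qed
qed

lemma computable_pi_sum: "computable_fun (\<lambda>p x. pi1 x + pi2 x)"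
proof -
  have "computable_fun2 (\<lambda>s x. x - triangle (Suc s))"
    by (rule computable2_compose2[OF computable2_diff computable2_proj(2)])
      (rule computable2_compose1[OF computable_triangle0], rule computable2_compose1[OF computable_Suc[OF computable_id]], rule computable2_proj)
  \<comment> \<open>This difference vanishes exactly if \<open>x < triangle (Suc s)\<close>, so
    \<open>Minim\<close> finds the diagonal of \<open>Least_triangle\<close>.\<close>
  then have "computable_fun2 (\<lambda>s x. Suc x - triangle (Suc s))"
    by - (rule computable2_compose2[OF computable2_diff], rule computable2_compose1[OF computable_Suc[OF computable_id]], rule computable2_proj,
      rule computable2_compose1[OF computable_triangle0], rule computable2_compose1[OF computable_Suc[OF computable_id]], rule computable2_proj)
  from computable_fun2E[OF this] obtain e where e: "p_eval p e [s, x] (Suc x - triangle (Suc s))" for p s x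
    by metis
  have "p_eval p (Minim e) [x] (pi1 x + pi2 x)" for p x
  proof -
    have "p_eval p (Minim e) [x] (LEAST s. Suc x - triangle (Suc s) = 0)"
      by (rule p_eval_Minim_Least[OF e]) (rule exI[of _ x], simp)
    then show ?thesis using Least_triangle[of x] by (simp only: diff_is_0_eq Suc_le_eq)
  qed
  then show ?thesis by (rule computable_funI)
qed

lemma pi1_eq: "pi1 x = x - triangle (pi1 x + pi2 x)"
  using prod_decode_inverse[of x] by (cases "prod_decode x") (simp add: prod_encode_def)

lemma computable_pi1: "computable_fun A \<Longrightarrow> computable_fun (\<lambda>p x. pi1 (A p x))"
proof -
  have "computable_fun (\<lambda>p x. x - triangle (pi1 x + pi2 x))"
    by (intro computable_diff computable_id computable_triangle computable_pi_sum)
  then have "computable_fun (\<lambda>p x. pi1 x)" by (simp only: pi1_eq[symmetric])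
  then show "computable_fun A \<Longrightarrow> computable_fun (\<lambda>p x. pi1 (A p x))" by (rule computable_compose)
qed

lemma computable_pi2: "computable_fun A \<Longrightarrow> computable_fun (\<lambda>p x. pi2 (A p x))"
proof -
  have "computable_fun (\<lambda>p x. (pi1 x + pi2 x) - pi1 x)" by (intro computable_diff computable_id computable_pi_sum computable_pi1)
  then have "computable_fun (\<lambda>p x. pi2 x)" by simp
  then show "computable_fun A \<Longrightarrow> computable_fun (\<lambda>p x. pi2 (A p x))" by (rule computable_compose)
qed

section \<open>Primitive recursion and decidable relations\<close>

lemma computable_rec_nat:
  assumes N: "computable_fun N" and B: "computable_fun B"
    and S: "computable_fun (\<lambda>p z. S p (pi1 z) (pi1 (pi2 z)) (pi2 (pi2 z)))"
  shows "computable_fun (\<lambda>p x. rec_nat (B p x) (\<lambda>k y. S p k y x) (N p x))"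
proof -
  obtain n where n: "p_eval p n [x] (N p x)" for p x using computable_funE[OF N] by metis
  obtain b where b: "p_eval p b [x] (B p x)" for p x using computable_funE[OF B] by metis
  obtain s where s: "p_eval p s [z] (S p (pi1 z) (pi1 (pi2 z)) (pi2 (pi2 z)))" for p z using computable_funE[OF S] by metis
  obtain c where c: "p_eval p c [x, y] (prod_encode (x, y))" for p x y using computable_fun2E[OF computable2_prod_encode] by metis
  \<comment> \<open>Packs the arguments \<open>[k, y, x]\<close> of the step program into one nested
    pair, the form in which \<open>S\<close> is assumed computable.\<close>
  let ?g = "Comp s [Comp c [Proj 0, Comp c [Proj 1, Proj 2]]]"
  have g: "p_eval p ?g [k, y, x] (S p k y x)" for p k y x
  proof (rule p_eval_Comp1)
    show "p_eval p (Comp c [Proj 0, Comp c [Proj 1, Proj 2]]) [k, y, x]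
      (prod_encode (k, prod_encode (y, x)))"
      by (intro p_eval_Comp2[OF _ _ c]) (auto intro: p_eval_Proj')
    show "p_eval p s [prod_encode (k, prod_encode (y, x))] (S p k y x)"
      using s[of p "prod_encode (k, prod_encode (y, x))"] by simp
  qed
  have "p_eval p (PrimRec b ?g) [k, x] (rec_nat (B p x) (\<lambda>k y. S p k y x) k)" for p k x
  proof (induction k)
    case (Suc k)
    show ?case using p_eval.PrimRec_Suc[OF Suc g] by simp
  qed (simp add: p_eval.PrimRec_0 b)
  then have "p_eval p (Comp (PrimRec b ?g) [n, Proj 0]) [x]
    (rec_nat (B p x) (\<lambda>k y. S p k y x) (N p x))" for p x
    by (rule p_eval_Comp2[OF n p_eval_Proj', rotated 2]) auto
  then show ?thesis by (rule computable_funI)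
qed

lemma computable_mult: "computable_fun A \<Longrightarrow> computable_fun B \<Longrightarrow> computable_fun (\<lambda>p x. A p x * B p x)"
proof -
  have "computable_fun (\<lambda>p x. rec_nat 0 (\<lambda>k y. y + pi2 x) (pi1 x))"
    by (intro computable_rec_nat computable_const computable_id computable_pi1 computable_pi2 computable_add)
  moreover have "rec_nat 0 (\<lambda>k y. y + b) a = a * b" for a b :: nat
    by (induction a) auto
  ultimately have *: "computable_fun (\<lambda>p x. pi1 x * pi2 x)" by simp
  assume "computable_fun A" "computable_fun B"
  from computable_compose[OF * computable_prod_encode[OF this]] show ?thesis by simp
qed

lemma computable_If: "decidable P \<Longrightarrow> computable_fun A \<Longrightarrow> computable_fun B \<Longrightarrow> computable_fun (\<lambda>p x. if P p x then A p x else B p x)"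
proof -
  assume a: "decidable P" "computable_fun A" "computable_fun B"
  have "computable_fun (\<lambda>p x. (if P p x then 1 else 0) * A p x + (1 - (if P p x then 1 else 0)) * B p x)"
    using a unfolding decidable_def by (intro computable_add computable_mult computable_diff computable_const)
  moreover have "(\<lambda>p x. (if P p x then 1 else 0) * A p x + (1 - (if P p x then 1 else 0)) * B p x)
    = (\<lambda>p x. if P p x then A p x else B p x)" by (intro ext) simp
  ultimately show ?thesis by simp
qed

lemma decidable_le: "computable_fun A \<Longrightarrow> computable_fun B \<Longrightarrow> decidable (\<lambda>p x. A p x \<le> B p x)"
proof -
  assume "computable_fun A" "computable_fun B"
  then have "computable_fun (\<lambda>p x. 1 - (A p x - B p x))" by (intro computable_diff computable_const)
  moreover have "(\<lambda>p x. 1 - (A p x - B p x)) = (\<lambda>p x. if A p x \<le> B p x then 1 else 0)"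
    by (intro ext) simp
  ultimately show ?thesis by (simp add: decidable_def)
qed

lemma decidable_not: "decidable P \<Longrightarrow> decidable (\<lambda>p x. \<not> P p x)"
proof -
  assume "decidable P"
  from computable_If[OF this computable_const[of 0] computable_const[of 1]]
  have "computable_fun (\<lambda>p x. if P p x then 0 else 1)" .
  also have "(\<lambda>p x. if P p x then 0 else 1) = (\<lambda>p x. if \<not> P p x then 1 else 0 :: nat)"
    by (intro ext) simp
  finally show ?thesis by (simp only: decidable_def)
qed

lemma decidable_conj: "decidable P \<Longrightarrow> decidable Q \<Longrightarrow> decidable (\<lambda>p x. P p x \<and> Q p x)"
proof -
  assume P: "decidable P" and "decidable Q"
  then have "computable_fun (\<lambda>p x. if Q p x then 1 else 0)" by (simp add: decidable_def)
  from computable_If[OF P this computable_const[of 0]]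
  have "computable_fun (\<lambda>p x. if P p x then if Q p x then 1 else 0 else 0)" .
  also have "(\<lambda>p x. if P p x then if Q p x then 1 else 0 else 0)
    = (\<lambda>p x. if P p x \<and> Q p x then 1 else 0 :: nat)" by (intro ext) simp
  finally show ?thesis by (simp only: decidable_def)
qed

lemma decidable_cong:
  assumes "decidable P" "\<And>p x. P p x = Q p x" shows "decidable Q"
proof -
  have "P = Q" using assms(2) by (intro ext)
  with assms(1) show ?thesis by simp
qed

lemma decidable_disj: "decidable P \<Longrightarrow> decidable Q \<Longrightarrow> decidable (\<lambda>p x. P p x \<or> Q p x)"
  by (rule decidable_cong[OF decidable_not[OF decidable_conj[OF decidable_not decidable_not]]]) auto

lemma decidable_imp: "decidable P \<Longrightarrow> decidable Q \<Longrightarrow> decidable (\<lambda>p x. P p x \<longrightarrow> Q p x)"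
  by (rule decidable_cong[OF decidable_disj[OF decidable_not]]) auto

lemma decidable_less: "computable_fun A \<Longrightarrow> computable_fun B \<Longrightarrow> decidable (\<lambda>p x. A p x < B p x)"
  using decidable_not[OF decidable_le[of B A]] by (simp add: not_le)

lemma decidable_eq: "computable_fun A \<Longrightarrow> computable_fun B \<Longrightarrow> decidable (\<lambda>p x. A p x = B p x)"
  using decidable_conj[OF decidable_le[of A B] decidable_le[of B A]] by (simp add: order_eq_iff)

lemma decidable_compose: "decidable P \<Longrightarrow> computable_fun A \<Longrightarrow> decidable (\<lambda>p x. P p (A p x))"
  unfolding decidable_def by (rule computable_compose)

lemma decidable_ex:
  assumes "computable_fun B" "decidable (\<lambda>p z. Q p (pi1 z) (pi2 z))"
  shows "decidable (\<lambda>p x. \<exists>k<B p x. Q p k x)"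
proof -
  \<comment> \<open>Inside the recursion the environment is \<open>pi2 (pi2 z)\<close>, because the
    accumulated truth value is paired in between.\<close>
  have "decidable (\<lambda>p z. Q p (pi1 z) (pi2 (pi2 z)))"
    using decidable_compose[OF assms(2) computable_prod_encode[OF computable_pi1[OF computable_id] computable_pi2[OF computable_pi2[OF computable_id]]]]
    by simp
  then have "computable_fun (\<lambda>p z. if Q p (pi1 z) (pi2 (pi2 z)) then 1 else pi1 (pi2 z))"
    by (intro computable_If computable_const computable_pi1 computable_pi2 computable_id)
  from computable_rec_nat[OF assms(1) computable_const[of 0], of "\<lambda>p k y x. if Q p k x then 1 else y", OF this]
  have "computable_fun (\<lambda>p x. rec_nat 0 (\<lambda>k y. if Q p k x then 1 else y) (B p x))" .
  moreover have "rec_nat 0 (\<lambda>k y. if Q p k x then 1 else y) b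
    = (if \<exists>k<b. Q p k x then 1 else 0 :: nat)" for p x b
    by (induction b) (auto simp: less_Suc_eq)
  ultimately show ?thesis by (simp add: decidable_def)
qed

lemma decidable_all:
  assumes "computable_fun B" "decidable (\<lambda>p z. Q p (pi1 z) (pi2 z))"
  shows "decidable (\<lambda>p x. \<forall>k<B p x. Q p k x)"
  by (rule decidable_cong[OF decidable_not[OF decidable_ex[OF assms(1) decidable_not[OF assms(2)]]]]) auto

lemma computable_div2: "computable_fun A \<Longrightarrow> computable_fun (\<lambda>p x. A p x div 2)"
proof -
  \<comment> \<open>The half \<open>y\<close> grows exactly when the counter reaches the next even
    number, \<open>2 * (y + 1)\<close>.\<close>
  have "computable_fun (\<lambda>p x. rec_nat 0 (\<lambda>k y. if Suc k = y + y + 2 then Suc y else y) x)"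
    by (intro computable_rec_nat computable_If decidable_eq computable_add computable_Suc computable_const computable_pi1 computable_pi2 computable_id)
  moreover have "rec_nat 0 (\<lambda>k y. if Suc k = y + y + 2 then Suc y else y) n = n div 2" for n :: nat
  proof (induction n)
    case (Suc n)
    have "(if Suc n = n div 2 + n div 2 + 2 then Suc (n div 2) else n div 2) = Suc n div 2"
      by (cases "even n") (auto elim!: evenE oddE)
    with Suc show ?case by simp
  qed simp
  ultimately have "computable_fun (\<lambda>p x. x div 2)" by simp
  then show "computable_fun A \<Longrightarrow> computable_fun (\<lambda>p x. A p x div 2)" by (rule computable_compose)
qed

lemma decidable_even: "computable_fun A \<Longrightarrow> decidable (\<lambda>p x. even (A p x))"
proof (rule decidable_cong)
  assume "computable_fun A"
  then show "decidable (\<lambda>p x. A p x div 2 + A p x div 2 = A p x)"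
    by (intro decidable_eq computable_add computable_div2)
  have "(n div 2 + n div 2 = n) = even n" for n :: nat by presburger
  then show "(A p x div 2 + A p x div 2 = A p x) = even (A p x)" for p x .
qed

section \<open>Finite lists coded as numbers\<close>

definition llen :: "nat \<Rightarrow> nat" where
  "llen w = length (list_decode w)"

text \<open>The value 0 beyond the end is what iterated tails of the code 0 yield, since
  \<open>prod_decode 0 = (0, 0)\<close>. This lets \<open>lnth_rec\<close> hold for every
  index.\<close>

definition lnth :: "nat \<Rightarrow> nat \<Rightarrow> nat" where
  "lnth w i = (if i < llen w then list_decode w ! i else 0)"

lemma llen_encode [simp]: "llen (list_encode xs) = length xs"
  by (simp add: llen_def)

lemma lnth_encode [simp]: "i < length xs \<Longrightarrow> lnth (list_encode xs) i = xs ! i"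
  by (simp add: lnth_def)

abbreviation lcons :: "nat \<Rightarrow> nat \<Rightarrow> nat" where
  "lcons x w \<equiv> Suc (prod_encode (x, w))"

lemma prod_decode_0: "prod_decode 0 = (0, 0)"
  using prod_encode_inverse[of "(0, 0)"] by (simp add: prod_encode_def)

lemma tail_encode: "pi2 (list_encode xs - 1) = list_encode (tl xs)"
  by (cases xs) (simp_all add: prod_decode_0)

lemma drop_encode:
  "rec_nat (list_encode xs) (\<lambda>k y. pi2 (y - 1)) i = list_encode (drop i xs)"
  by (induction i) (simp_all add: tail_encode drop_Suc tl_drop del: One_nat_def)

lemma list_encode_eq_0: "list_encode xs = 0 \<longleftrightarrow> xs = []"
  by (cases xs) auto

lemma length_le_list_encode: "length xs \<le> list_encode xs"
proof (induction xs)
  case (Cons x xs)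
  then show ?case using le_prod_encode_2[of "list_encode xs" x] by simp
qed simp

lemma lnth_rec: "lnth w i = pi1 (rec_nat w (\<lambda>k y. pi2 (y - 1)) i - 1)"
proof -
  obtain xs where w: "w = list_encode xs" by (metis list_decode_inverse)
  show ?thesis unfolding w drop_encode
  proof (cases "i < length xs")
    case True
    then show "lnth (list_encode xs) i = pi1 (list_encode (drop i xs) - 1)"
      by (simp flip: Cons_nth_drop_Suc)
  qed (simp add: lnth_def prod_decode_0)
qed

lemma computable_lnth: "computable_fun W \<Longrightarrow> computable_fun I \<Longrightarrow> computable_fun (\<lambda>p x. lnth (W p x) (I p x))"
  unfolding lnth_rec
  by (intro computable_rec_nat computable_pi1 computable_pi2 computable_diff computable_const computable_id)

text \<open>The length is the number of nonempty tails, and a list is never longer than its code, so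
  \<open>w\<close> itself bounds the count.\<close>

lemma llen_rec:
  "llen w = rec_nat 0 (\<lambda>k y. if rec_nat w (\<lambda>k y. pi2 (y - 1)) k = 0 then y else Suc y) w"
proof -
  obtain xs where w: "w = list_encode xs" by (metis list_decode_inverse)
  have "rec_nat 0 (\<lambda>k y. if rec_nat w (\<lambda>k y. pi2 (y - 1)) k = 0 then y else Suc y) n
    = min n (length xs)" for n
    unfolding w drop_encode by (induction n) (auto simp: list_encode_eq_0)
  then show ?thesis using length_le_list_encode[of xs] by (simp add: w)
qed

lemma computable_llen: "computable_fun W \<Longrightarrow> computable_fun (\<lambda>p x. llen (W p x))"
proof -
  have "computable_fun (\<lambda>p x. rec_nat 0 (\<lambda>k y. if rec_nat x (\<lambda>k y. pi2 (y - 1)) k = 0 then y else Suc y) x)"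
    by (intro computable_rec_nat computable_If decidable_eq computable_pi1 computable_pi2 computable_diff computable_const computable_id computable_Suc)
  then have "computable_fun (\<lambda>p x. llen x)" by (simp only: llen_rec)
  then show "computable_fun W \<Longrightarrow> computable_fun (\<lambda>p x. llen (W p x))" by (rule computable_compose)
qed

lemmas computable_intros = computable_id computable_const computable_Suc computable_oracle computable_prod_encode computable_add computable_diff
  computable_mult computable_pi1 computable_pi2 computable_If computable_div2 computable_lnth computable_llen
  decidable_le decidable_less decidable_eq decidable_even decidable_not decidable_conj decidable_disj decidable_imp decidable_ex decidable_all

section \<open>Functionals computed by total functions and by search\<close>

lemma functional_eqI:
  assumes "\<And>x. p_eval p e [x] (h x)" shows "functional e p = Some h"
proof -
  have "(THE y. p_eval p e [x] y) = h x" for x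
    by (rule the_equality, rule assms) (rule p_eval_deterministic[OF _ assms])
  then show ?thesis using assms by (auto simp: functional_def)
qed

lemma functionalD:
  assumes "functional e p = Some h" shows "p_eval p e [x] (h x)"
proof -
  have ex: "\<forall>n. \<exists>y. p_eval p e [n] y" and h: "h = (\<lambda>n. THE y. p_eval p e [n] y)"
    using assms by (simp_all add: functional_def split: if_splits)
  from ex obtain y where y: "p_eval p e [x] y" by auto
  have "h x = y" unfolding h
    by (rule the_equality, rule y) (rule p_eval_deterministic[OF _ y])
  with y show ?thesis by simp
qed

text \<open>
  Every reduction in this development is one unbounded search followed by a total function.
\<close>

lemma functional_search:
  assumes Q: "decidable (\<lambda>p z. Q p (pi1 z) (pi2 z))" and G: "computable_fun (\<lambda>p z. G p (pi1 z) (pi2 z))"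
  shows "\<exists>e. \<forall>p. (\<forall>x. \<exists>n. Q p n x) \<longrightarrow> functional e p = Some (\<lambda>x. G p (LEAST n. Q p n x) x)"
proof -
  have "computable_fun (\<lambda>p z. if Q p (pi1 z) (pi2 z) then 0 else 1)"
    by (intro computable_If Q computable_const)
  from computable_funE[OF this]
  obtain q where q: "p_eval p q [z] (if Q p (pi1 z) (pi2 z) then 0 else 1)" for p z by metis
  from computable_funE[OF G] obtain g where g: "p_eval p g [z] (G p (pi1 z) (pi2 z))" for p z by metis
  obtain c where c: "p_eval p c [x, y] (prod_encode (x, y))" for p x y
    using computable_fun2E[OF computable2_prod_encode] by metis
  let ?q = "Comp q [Comp c [Proj 0, Proj 1]]"
  let ?e = "Comp g [Comp c [Minim ?q, Proj 0]]"
  have "functional ?e p = Some (\<lambda>x. G p (LEAST n. Q p n x) x)" if ex: "\<forall>x. \<exists>n. Q p n x" for p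
  proof (rule functional_eqI)
    fix x
    have qq: "p_eval p ?q [n, x] (if Q p n x then 0 else 1)" for n
    proof (rule p_eval_Comp1)
      show "p_eval p (Comp c [Proj 0, Proj 1]) [n, x] (prod_encode (n, x))"
        by (rule p_eval_Comp2[OF _ _ c]) (auto intro: p_eval_Proj')
      show "p_eval p q [prod_encode (n, x)] (if Q p n x then 0 else 1)"
        using q[of p "prod_encode (n, x)"] by simp
    qed
    have "p_eval p (Minim ?q) [x] (LEAST n. (if Q p n x then 0 else 1 :: nat) = 0)"
      using ex by (intro p_eval_Minim_Least[OF qq]) auto
    also have "(LEAST n. (if Q p n x then 0 else 1 :: nat) = 0) = (LEAST n. Q p n x)"
      by (rule arg_cong[of _ _ Least]) auto
    finally have M: "p_eval p (Minim ?q) [x] (LEAST n. Q p n x)" .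
    show "p_eval p ?e [x] (G p (LEAST n. Q p n x) x)"
    proof (rule p_eval_Comp1)
      show "p_eval p (Comp c [Minim ?q, Proj 0]) [x] (prod_encode (LEAST n. Q p n x, x))"
        by (rule p_eval_Comp2[OF M _ c]) (auto intro: p_eval_Proj')
      show "p_eval p g [prod_encode (LEAST n. Q p n x, x)] (G p (LEAST n. Q p n x) x)"
        using g[of p "prod_encode (LEAST n. Q p n x, x)"] by simp
    qed
  qed
  then show ?thesis by blast
qed

lemma functional_computable_fun: "computable_fun G \<Longrightarrow> \<exists>e. \<forall>p. functional e p = Some (G p)"
  using computable_funE functional_eqI by metis


section \<open>Universal computation\<close>

abbreviation jdg :: "nat \<Rightarrow> nat \<Rightarrow> nat \<Rightarrow> nat" where
  "jdg e xs y \<equiv> prod_encode (e, prod_encode (xs, y))"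

text \<open>
  The judgement that \<open>e\<close> outputs \<open>y\<close> on \<open>xs\<close> follows from the judgements in \<open>S\<close> by one rule
  of \<open>p_eval\<close>. The intermediate values in the rules for composition, recursion and minimisation
  are read off from judgements in \<open>S\<close>, so that all quantifiers are bounded.
\<close>

definition justified :: "baire \<Rightarrow> nat set \<Rightarrow> nat \<Rightarrow> nat \<Rightarrow> nat \<Rightarrow> bool" where
  "justified f S e xs y \<longleftrightarrow>
     pi1 e = 0 \<and> pi2 e = 0 \<and> y = 0
   \<or> pi1 e = 1 \<and> pi2 e = 0 \<and> llen xs = 1 \<and> y = Suc (lnth xs 0)
   \<or> pi1 e = 2 \<and> pi2 e = 0 \<and> llen xs = 1 \<and> y = f (lnth xs 0)
   \<or> pi1 e = 3 \<and> pi2 e < llen xs \<and> y = lnth xs (pi2 e)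
   \<or> pi1 e = 4 \<and> (\<exists>K\<in>S. pi1 K = pi1 (pi2 e) \<and> pi2 (pi2 K) = y
        \<and> llen (pi1 (pi2 K)) = llen (pi2 (pi2 e))
        \<and> (\<forall>i<llen (pi2 (pi2 e)). \<exists>M\<in>S. M = jdg (lnth (pi2 (pi2 e)) i) xs (lnth (pi1 (pi2 K)) i)))
   \<or> pi1 e = 5 \<and> xs \<noteq> 0 \<and> lnth xs 0 = 0 \<and> (\<exists>K\<in>S. K = jdg (pi1 (pi2 e)) (pi2 (xs - 1)) y)
   \<or> pi1 e = 5 \<and> xs \<noteq> 0 \<and> lnth xs 0 \<noteq> 0
        \<and> (\<exists>K\<in>S. pi1 K = e \<and> pi1 (pi2 K) = lcons (lnth xs 0 - 1) (pi2 (xs - 1))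
          \<and> (\<exists>M\<in>S. M = jdg (pi2 (pi2 e))
                (lcons (lnth xs 0 - 1) (lcons (pi2 (pi2 K)) (pi2 (xs - 1)))) y))
   \<or> pi1 e = 6 \<and> (\<exists>K\<in>S. K = jdg (pi2 e) (lcons y xs) 0)
        \<and> (\<forall>m<y. \<exists>K\<in>S. pi1 K = pi2 e \<and> pi1 (pi2 K) = lcons m xs \<and> pi2 (pi2 K) \<noteq> 0)"

text \<open>Only earlier entries may serve as premises, which excludes circular support and keeps
  every quantifier bounded.\<close>

definition derivation :: "baire \<Rightarrow> nat \<Rightarrow> bool" where
  "derivation f w \<longleftrightarrow> (\<forall>i<llen w. justified f (lnth w ` {..<i})
     (pi1 (lnth w i)) (pi1 (pi2 (lnth w i))) (pi2 (pi2 (lnth w i))))"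

text \<open>The witness \<open>n\<close> carries the output besides the derivation, so that a search
  for \<open>n\<close> also returns the value.\<close>

definition halts_with :: "baire \<Rightarrow> nat \<Rightarrow> nat \<Rightarrow> nat \<Rightarrow> bool" where
  "halts_with f e xs n \<longleftrightarrow> derivation f (pi1 n) \<and>
     (\<exists>i<llen (pi1 n). lnth (pi1 n) i = jdg e xs (pi2 n))"

lemma lnth_lcons_0 [simp]: "lnth (lcons x w) 0 = x"
  by (simp add: lnth_rec)

lemma bex_image_lessThan: "(\<exists>K\<in>h ` {..<i}. Q K) \<longleftrightarrow> (\<exists>k<i. Q (h k))" for i :: nat
  by auto

lemma computable_compose_pair:
  assumes "computable_fun (\<lambda>p z. F p (pi1 z) (pi2 z))" "computable_fun A" "computable_fun B"
  shows "computable_fun (\<lambda>p x. F p (A p x) (B p x))"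
  using computable_compose[OF assms(1) computable_prod_encode[OF assms(2,3)]] by simp

lemma decidable_compose_pair:
  assumes "decidable (\<lambda>p z. F p (pi1 z) (pi2 z))" "computable_fun A" "computable_fun B"
  shows "decidable (\<lambda>p x. F p (A p x) (B p x))"
  using decidable_compose[OF assms(1) computable_prod_encode[OF assms(2,3)]] by simp

text \<open>The oracle of the simulated program may be computed from \<open>p\<close> and the
  environment: in later uses it is a part of \<open>p\<close>, or it depends on a list under
  test.\<close>

lemma decidable_derivation:
  assumes "computable_fun (\<lambda>p z. Or p (pi1 z) (pi2 z))" and W: "computable_fun W"
  shows "decidable (\<lambda>p x. derivation (\<lambda>n. Or p n x) (W p x))"
  unfolding derivation_def justified_def bex_image_lessThan
  by (intro computable_intros computable_compose_pair[OF assms(1)] computable_compose[OF W])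

lemma decidable_halts_with:
  assumes "computable_fun (\<lambda>p z. Or p (pi1 z) (pi2 z))" "computable_fun E" "computable_fun X" "computable_fun N"
  shows "decidable (\<lambda>p x. halts_with (\<lambda>n. Or p n x) (E p x) (X p x) (N p x))"
  unfolding halts_with_def
  by (intro computable_intros decidable_derivation assms assms(2-)[THEN computable_compose])

section \<open>Soundness of derivations\<close>

lemma pi_jdg: "jdg e xs y = K \<longleftrightarrow> e = pi1 K \<and> xs = pi1 (pi2 K) \<and> y = pi2 (pi2 K)"
  by (metis fst_conv prod.collapse prod_decode_inverse prod_encode_inverse snd_conv)

text \<open>The first component of \<open>index e\<close> names the constructor, so the case split
  on \<open>e\<close> leaves only the disjuncts that mirror the \<open>p_eval\<close> rules of that
  constructor. Every numeric argument list is the code of an actual list, which recovers the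
  intermediate values.\<close>

lemma justified_sound:
  assumes S: "\<And>e xs y. jdg (index e) (list_encode xs) y \<in> S \<Longrightarrow> p_eval f e xs y"
    and J: "justified f S (index e) (list_encode xs) y"
  shows "p_eval f e xs y"
proof (cases e)
  case Zero
  with J have "y = 0" by (simp add: justified_def)
  with Zero show ?thesis by (simp add: p_eval.Zero)
next
  case Succ
  with J have "length xs = 1" "y = Suc (lnth (list_encode xs) 0)" by (simp_all add: justified_def)
  with Succ show ?thesis by (cases xs) (simp_all add: p_eval.Succ)
next
  case Oracle
  with J have "length xs = 1" "y = f (lnth (list_encode xs) 0)" by (simp_all add: justified_def)
  with Oracle show ?thesis by (cases xs) (simp_all add: p_eval.Oracle)
next
  case (Proj i)
  with J have "i < length xs" "y = lnth (list_encode xs) i" by (simp_all add: justified_def)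
  with Proj show ?thesis by (simp add: p_eval.Proj)
next
  case (Comp g gs)
  with J obtain K where K: "K \<in> S" "pi1 K = index g" "pi2 (pi2 K) = y"
      "llen (pi1 (pi2 K)) = length gs"
      "\<forall>i<length gs. jdg (lnth (list_encode (map index gs)) i) (list_encode xs)
         (lnth (pi1 (pi2 K)) i) \<in> S"
    by (auto simp add: justified_def)
  obtain ys where ys: "pi1 (pi2 K) = list_encode ys" by (metis list_decode_inverse)
  have len: "length ys = length gs" using K(4) by (simp add: ys)
  have "jdg (index g) (list_encode ys) y \<in> S" using K(1-3) pi_jdg ys by metis
  moreover have "\<forall>i<length gs. p_eval f (gs ! i) xs (ys ! i)"
    using K(5) by (auto simp: ys len intro!: S)
  ultimately show ?thesis
    unfolding Comp by (intro p_eval.Comp[of f xs gs ys] S) (simp_all add: list_all2_conv_all_nth len)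
next
  case (PrimRec g h)
  with J have "xs \<noteq> []" by (auto simp add: justified_def)
  then obtain n xs' where xs: "xs = n # xs'" by (cases xs) auto
  have hd: "lnth (list_encode xs) 0 = n" and tl: "pi2 (list_encode xs - 1) = list_encode xs'"
    by (simp_all add: xs)
  show ?thesis
  proof (cases n)
    case 0
    with J have "jdg (index g) (list_encode xs') y \<in> S"
      by (simp add: justified_def PrimRec hd tl del: One_nat_def list_encode.simps)
    with 0 show ?thesis unfolding PrimRec xs by (simp add: p_eval.PrimRec_0 S)
  next
    case (Suc m)
    with J obtain K where K: "K \<in> S" "pi1 K = index e" "pi1 (pi2 K) = lcons m (list_encode xs')"
        "jdg (index h) (lcons m (lcons (pi2 (pi2 K)) (list_encode xs'))) y \<in> S"
      by (auto simp add: justified_def PrimRec hd tl simp del: One_nat_def list_encode.simps)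
    define z where "z = pi2 (pi2 K)"
    have "jdg (index e) (list_encode (m # xs')) z \<in> S" using K(1-3) pi_jdg z_def
      unfolding list_encode.simps by metis
    moreover have "jdg (index h) (list_encode (m # z # xs')) y \<in> S"
      using K(4) by (simp add: z_def)
    ultimately show ?thesis
      using S unfolding PrimRec xs Suc by (intro p_eval.PrimRec_Suc[of f g h m xs' z])
  qed
next
  case (Minim g)
  with J have "jdg (index g) (list_encode (y # xs)) 0 \<in> S"
    and K: "\<forall>m<y. \<exists>K\<in>S. pi1 K = index g \<and> pi1 (pi2 K) = list_encode (m # xs) \<and> pi2 (pi2 K) \<noteq> 0"
    by (simp_all add: justified_def)
  moreover have "\<exists>z>0. p_eval f g (m # xs) z" if "m < y" for m
    using K[rule_format, OF that] S pi_jdg by (metis neq0_conv)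
  ultimately show ?thesis unfolding Minim by (intro p_eval.Minim S) auto
qed

lemma derivation_sound:
  assumes "derivation f w" "i < llen w" "lnth w i = jdg (index e) (list_encode xs) y"
  shows "p_eval f e xs y"
  using assms(2,3)
proof (induction i arbitrary: e xs y rule: less_induct)
  case (less i)
  show ?case
  proof (rule justified_sound)
    show "justified f (lnth w ` {..<i}) (index e) (list_encode xs) y"
      using assms(1) less.prems unfolding derivation_def by force
    show "p_eval f e' xs' y'" if "jdg (index e') (list_encode xs') y' \<in> lnth w ` {..<i}" for e' xs' y'
      using that less.IH less.prems(1) by force
  qed
qed

text \<open>\<open>S\<close> occurs only positively. Hence a derivation stays valid when another one
  is put in front of it.\<close>

lemma justified_mono: "justified f S e xs y \<Longrightarrow> S \<subseteq> T \<Longrightarrow> justified f T e xs y"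
  unfolding justified_def by (elim disjE) (simp_all, (meson subsetD)+)

section \<open>Completeness of derivations\<close>

definition derivation_list :: "baire \<Rightarrow> nat list \<Rightarrow> bool" where
  "derivation_list f D \<longleftrightarrow> (\<forall>i<length D. justified f (set (take i D))
     (pi1 (D ! i)) (pi1 (pi2 (D ! i))) (pi2 (pi2 (D ! i))))"

lemma derivation_encode: "derivation_list f D \<Longrightarrow> derivation f (list_encode D)"
  unfolding derivation_def derivation_list_def
proof (intro allI impI)
  fix i assume D: "\<forall>i<length D. justified f (set (take i D))
     (pi1 (D ! i)) (pi1 (pi2 (D ! i))) (pi2 (pi2 (D ! i)))" and i: "i < llen (list_encode D)"
  have "lnth (list_encode D) ` {..<i} = (!) D ` {..<i}"
    using i by (intro image_cong) auto
  also have "\<dots> = set (take i D)" using i by (simp add: nth_image atLeast0LessThan flip: nth_image)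
  finally show "justified f (lnth (list_encode D) ` {..<i}) (pi1 (lnth (list_encode D) i))
    (pi1 (pi2 (lnth (list_encode D) i))) (pi2 (pi2 (lnth (list_encode D) i)))"
    using D i by simp
qed

lemma derivation_append:
  assumes "derivation_list f D" "derivation_list f D'" shows "derivation_list f (D @ D')"
  unfolding derivation_list_def
proof (intro allI impI)
  fix i assume i: "i < length (D @ D')"
  let ?J = "(D @ D') ! i"
  show "justified f (set (take i (D @ D'))) (pi1 ?J) (pi1 (pi2 ?J)) (pi2 (pi2 ?J))"
  proof (cases "i < length D")
    case True
    then show ?thesis using assms(1) by (simp add: derivation_list_def nth_append)
  next
    case False
    then have "justified f (set (take (i - length D) D')) (pi1 ?J) (pi1 (pi2 ?J)) (pi2 (pi2 ?J))"
      using assms(2) i by (simp add: derivation_list_def nth_append)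
    then show ?thesis by (rule justified_mono) simp
  qed
qed

definition derivable :: "baire \<Rightarrow> nat \<Rightarrow> bool" where
  "derivable f J \<longleftrightarrow> (\<exists>D. derivation_list f D \<and> J \<in> set D)"

lemma derivable_finite_set:
  "finite S \<Longrightarrow> \<forall>J\<in>S. derivable f J \<Longrightarrow> \<exists>D. derivation_list f D \<and> S \<subseteq> set D"
proof (induction rule: finite_induct)
  case empty
  then show ?case by (intro exI[of _ "[]"]) (simp add: derivation_list_def)
next
  case (insert J S)
  then obtain D D' where "derivation_list f D" "S \<subseteq> set D" "derivation_list f D'" "J \<in> set D'"
    by (auto simp: derivable_def)
  then show ?case by (intro exI[of _ "D @ D'"]) (auto intro: derivation_append)
qed

text \<open>Derivations of the premises are concatenated and the conclusion is appended. Finite sets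
  of premises are needed because composition and minimisation have arbitrarily many.\<close>

lemma derivable_step:
  assumes "finite S" "\<forall>J\<in>S. derivable f J" "justified f S e xs y"
  shows "derivable f (jdg e xs y)"
proof -
  obtain D where D: "derivation_list f D" "S \<subseteq> set D"
    using derivable_finite_set[OF assms(1,2)] by auto
  have "derivation_list f (D @ [jdg e xs y])"
    using D justified_mono[OF assms(3) D(2)]
    by (auto simp: derivation_list_def nth_append less_Suc_eq)
  then show ?thesis unfolding derivable_def by (intro exI[of _ "D @ [jdg e xs y]"]) simp
qed

lemma derivable_complete: "p_eval f e xs y \<Longrightarrow> derivable f (jdg (index e) (list_encode xs) y)"
proof (induction rule: p_eval.induct)
  case (Zero xs)
  show ?case by (rule derivable_step[of "{}"]) (simp_all add: justified_def)
next
  case (Succ x)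
  show ?case by (rule derivable_step[of "{}"]) (simp_all add: justified_def del: list_encode.simps)
next
  case (Oracle x)
  show ?case by (rule derivable_step[of "{}"]) (simp_all add: justified_def del: list_encode.simps)
next
  case (Proj i xs)
  then show ?case by (intro derivable_step[of "{}"]) (simp_all add: justified_def)
next
  case (Comp xs gs ys g z)
  let ?K = "jdg (index g) (list_encode ys) z"
  let ?S = "insert ?K ((\<lambda>i. jdg (index (gs ! i)) (list_encode xs) (ys ! i)) ` {..<length gs})"
  have len: "length ys = length gs" using Comp.IH(1) by (simp add: list_all2_lengthD)
  show ?case
  proof (rule derivable_step)
    show "finite ?S" by simp
    show "\<forall>J\<in>?S. derivable f J"
      using Comp.IH by (auto simp: list_all2_conv_all_nth)
    show "justified f ?S (index (prog.Comp g gs)) (list_encode xs) z"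
      unfolding justified_def by (simp add: len)
  qed
next
  case (PrimRec_0 g xs y h)
  show ?case
  proof (rule derivable_step)
    show "justified f {jdg (index g) (list_encode xs) y} (index (PrimRec g h)) (list_encode (0 # xs)) y"
      using lnth_encode[of 0 "0 # xs"] by (simp add: justified_def)
  qed (use PrimRec_0 in simp_all)
next
  case (PrimRec_Suc g h n xs y z)
  show ?case
  proof (rule derivable_step)
    show "justified f {jdg (index (PrimRec g h)) (list_encode (n # xs)) y,
        jdg (index h) (list_encode (n # y # xs)) z} (index (PrimRec g h)) (list_encode (Suc n # xs)) z"
      using lnth_encode[of 0 "Suc n # xs"] by (simp add: justified_def)
  qed (use PrimRec_Suc in simp_all)
next
  case (Minim g n xs)
  then obtain Y where Y: "Y k > 0 \<and> derivable f (jdg (index g) (list_encode (k # xs)) (Y k))"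
    if "k < n" for k by metis
  let ?S = "insert (jdg (index g) (list_encode (n # xs)) 0)
    ((\<lambda>k. jdg (index g) (list_encode (k # xs)) (Y k)) ` {..<n})"
  show ?case
  proof (rule derivable_step)
    show "justified f ?S (index (prog.Minim g)) (list_encode xs) n"
      using Y by (auto simp: justified_def)
  qed (use Minim Y in auto)
qed

text \<open>A version of Kleene's normal form theorem. The relation is uniform in the index, so
  searching for \<open>n\<close> is a universal machine.\<close>

theorem halts_with_iff:
  "(\<exists>n. halts_with f (index e) (list_encode xs) n \<and> pi2 n = y) \<longleftrightarrow> p_eval f e xs y"
proof
  assume "\<exists>n. halts_with f (index e) (list_encode xs) n \<and> pi2 n = y"
  then show "p_eval f e xs y" by (auto simp: halts_with_def intro: derivation_sound)
next
  assume "p_eval f e xs y"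
  then obtain D where D: "derivation_list f D" "jdg (index e) (list_encode xs) y \<in> set D"
    using derivable_complete unfolding derivable_def by blast
  then obtain i where "i < length D" "D ! i = jdg (index e) (list_encode xs) y"
    by (auto simp: in_set_conv_nth)
  then show "\<exists>n. halts_with f (index e) (list_encode xs) n \<and> pi2 n = y"
    using derivation_encode[OF D(1)]
    by (intro exI[of _ "prod_encode (list_encode D, y)"]) (auto simp: halts_with_def)
qed


section \<open>The first-order part of an arbitrary problem\<close>

lemma halts_with_search:
  assumes "p_eval f e xs y"
  shows "\<exists>n. halts_with f (index e) (list_encode xs) n"
    and "pi2 (LEAST n. halts_with f (index e) (list_encode xs) n) = y"
proof -
  show ex: "\<exists>n. halts_with f (index e) (list_encode xs) n"
    using assms halts_with_iff by blast
  let ?n = "LEAST n. halts_with f (index e) (list_encode xs) n"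
  have "halts_with f (index e) (list_encode xs) ?n" using ex by (rule LeastI_ex)
  then have "p_eval f e xs (pi2 ?n)" using halts_with_iff by blast
  with assms show "pi2 ?n = y" using p_eval_deterministic by blast
qed

lemma weihrauch_leI:
  assumes "\<And>p x. inputs P p = Some x \<Longrightarrow> x \<in> instances P \<Longrightarrow>
    \<exists>r z. functional a p = Some r \<and> inputs Q r = Some z \<and> z \<in> instances Q \<and>
      (\<forall>q y. outputs Q q = Some y \<and> y \<in> solutions Q z \<longrightarrow>
         (\<exists>s w. functional b (p \<oplus>\<^sub>B q) = Some s \<and> outputs P s = Some w \<and> w \<in> solutions P x))"
  shows "P \<le>\<^sub>W Q"
  unfolding weihrauch_le_def computable_def
  using assms by (intro exI[of _ "functional a"] exI[of _ "functional b"]) auto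

lemma triple_rep_eq_Some:
  "triple_rep r = Some (f, \<Phi>, \<Psi>) \<longleftrightarrow> r 0 = index \<Phi> \<and> r 1 = index \<Psi> \<and> f = (\<lambda>n. r (n + 2))"
  using the_inv_f_f[OF inj_index] by (auto simp: triple_rep_def index_eq_iff)

definition triple_name :: "prog \<Rightarrow> prog \<Rightarrow> baire \<Rightarrow> baire" where
  "triple_name \<Phi> \<Psi> f n = (if n = 0 then index \<Phi> else if n = 1 then index \<Psi> else f (n - 2))"

lemma triple_rep_name: "triple_rep (triple_name \<Phi> \<Psi> f) = Some (f, \<Phi>, \<Psi>)"
  by (simp add: triple_rep_eq_Some triple_name_def)

lemma first_order_first_order_part: "first_order (first_order_part P)"
proof -
  have "x \<in> ran triple_rep" for x
    using triple_rep_name by (cases x) (auto intro: ranI)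
  then show ?thesis
    by (simp add: first_order_def problem_def first_order_part_def ran_nat_rep)
qed

lemma first_order_instanceI:
  assumes "x \<in> instances (first_order_part P)" shows "first_order_instance P x"
  using assms by (cases x) (auto simp: instances_def first_order_part_def)

lemma first_order_part_le: "first_order_part P \<le>\<^sub>W P"
proof -
  have "\<exists>a. \<forall>p. (\<forall>x. \<exists>n. halts_with (\<lambda>k. p (k + 2)) (p 0) (lcons x 0) n) \<longrightarrow>
    functional a p = Some (\<lambda>x. pi2 (LEAST n. halts_with (\<lambda>k. p (k + 2)) (p 0) (lcons x 0) n))"
    by (rule functional_search[where G = "\<lambda>p n x. pi2 n"]) (intro computable_intros decidable_halts_with)+
  then obtain a where a: "\<And>p. (\<forall>x. \<exists>n. halts_with (\<lambda>k. p (k + 2)) (p 0) (lcons x 0) n) \<Longrightarrow>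
    functional a p = Some (\<lambda>x. pi2 (LEAST n. halts_with (\<lambda>k. p (k + 2)) (p 0) (lcons x 0) n))"
    by auto
  \<comment> \<open>Extracts the join of \<open>f\<close> and \<open>q\<close> from the join of the
    triple name \<open>p\<close> and \<open>q\<close>: \<open>f (k div 2)\<close> is entry
    \<open>k div 2 + 2\<close> of \<open>p\<close>, hence at twice that position. Likewise the index
    of \<Psi>, entry 1 of \<open>p\<close>, is at position 2.\<close>
  define orc where "orc = (\<lambda>p k :: nat. if even k then p (k div 2 + 2 + (k div 2 + 2)) else p (Suc (k div 2 + k div 2)) :: nat)"
  have "\<exists>b. \<forall>p. (\<forall>x :: nat. \<exists>n. halts_with (orc p) (p 2) (lcons 0 0) n) \<longrightarrow>
    functional b p = Some (\<lambda>x. pi2 (LEAST n. halts_with (orc p) (p 2) (lcons 0 0) n))"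
    unfolding orc_def by (rule functional_search[where G = "\<lambda>p n x. pi2 n"]) (intro computable_intros decidable_halts_with)+
  then obtain b where b: "\<And>p. \<exists>n. halts_with (orc p) (p 2) (lcons 0 0) n \<Longrightarrow>
    functional b p = Some (\<lambda>x. pi2 (LEAST n. halts_with (orc p) (p 2) (lcons 0 0) n))"
    by auto
  show ?thesis
  proof (rule weihrauch_leI)
    fix p x assume "inputs (first_order_part P) p = Some x" and x: "x \<in> instances (first_order_part P)"
    then obtain f \<Phi> \<Psi> where x_def: "x = (f, \<Phi>, \<Psi>)" and p: "p 0 = index \<Phi>" "p 1 = index \<Psi>"
      and f: "f = (\<lambda>n. p (n + 2))"
      by (cases x) (auto simp: first_order_part_def triple_rep_eq_Some)
    from first_order_instanceI[OF x] obtain r z where r: "functional \<Phi> f = Some r"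
      "inputs P r = Some z" "z \<in> instances P"
      and halts: "\<And>g. g \<in> names_of_solutions P r \<Longrightarrow> \<exists>y. p_eval (f \<oplus>\<^sub>B g) \<Psi> [0] y"
      by (auto simp: x_def first_order_instance_def)
    have "functional a p = Some r"
    proof -
      have "p_eval f \<Phi> [x] (r x)" for x using r(1) by (rule functionalD)
      from halts_with_search[OF this] show ?thesis
        using a[of p] by (simp add: p f)
    qed
    moreover have "\<exists>s w. functional b (p \<oplus>\<^sub>B q) = Some s \<and> outputs (first_order_part P) s = Some w
        \<and> w \<in> solutions (first_order_part P) x"
      if q: "outputs P q = Some y" "y \<in> solutions P z" for q y
    proof -
      have g: "q \<in> names_of_solutions P r"
        using q r(2) by (auto simp: names_of_solutions_def)
      then obtain y where y: "p_eval (f \<oplus>\<^sub>B q) \<Psi> [0] y" using halts by blast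
      have orc: "orc (p \<oplus>\<^sub>B q) = f \<oplus>\<^sub>B q"
        by (rule ext) (simp add: orc_def f join_def)
      have p2: "(p \<oplus>\<^sub>B q) 2 = index \<Psi>" using p by (simp add: join_def)
      have "functional b (p \<oplus>\<^sub>B q) = Some (\<lambda>x. y)"
        using b[of "p \<oplus>\<^sub>B q"] halts_with_search[OF y] by (simp add: orc p2)
      moreover have "y \<in> solutions (first_order_part P) x"
        using first_order_instanceI[OF x] r(1) g y by (auto simp: first_order_part_def x_def)
      ultimately show ?thesis by (simp add: first_order_part_def nat_rep_def)
    qed
    ultimately show "\<exists>r z. functional a p = Some r \<and> inputs P r = Some z \<and> z \<in> instances P \<and>
      (\<forall>q y. outputs P q = Some y \<and> y \<in> solutions P z \<longrightarrow>
         (\<exists>s w. functional b (p \<oplus>\<^sub>B q) = Some s \<and> outputs (first_order_part P) s = Some w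
            \<and> w \<in> solutions (first_order_part P) x))"
      using r by blast
  qed
qed

text \<open>A reduction is itself an instance: the name \<open>p\<close> and the programs of the two
  functionals form a triple. Running \<Psi> at 0 gives the whole answer, because a number is
  represented by the value of its name at 0.\<close>

lemma le_first_order_part:
  assumes P: "problem P" and Q: "first_order Q" "Q \<le>\<^sub>W P"
  shows "Q \<le>\<^sub>W first_order_part P"
proof -
  from Q(2) obtain F G where "computable F" "computable G" and FG: "\<forall>p x. inputs Q p = Some x \<and> x \<in> instances Q \<longrightarrow>
         (\<exists>r z. F p = Some r \<and> inputs P r = Some z \<and> z \<in> instances P \<and>
           (\<forall>q y. outputs P q = Some y \<and> y \<in> solutions P z \<longrightarrow>
             (\<exists>s w. G (p \<oplus>\<^sub>B q) = Some s \<and> outputs Q s = Some w \<and> w \<in> solutions Q x)))"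
    unfolding weihrauch_le_def by (elim exE conjE) (rule that)
  then obtain \<Phi> \<Psi> where "F = functional \<Phi>" "G = functional \<Psi>" by (auto simp: computable_def)
  note W = FG[rule_format, unfolded this, OF conjI]
  have "computable_fun (\<lambda>p n. triple_name \<Phi> \<Psi> p n)"
    unfolding triple_name_def by (intro computable_intros)
  from functional_computable_fun[OF this] obtain a where a: "\<And>p. functional a p = Some (triple_name \<Phi> \<Psi> p)" by auto
  \<comment> \<open>Position 1 of the join of \<open>p\<close> and \<open>q\<close> is
    \<open>q 0\<close>, the answer.\<close>
  have "computable_fun (\<lambda>p n. p 1)" by (intro computable_intros)
  from functional_computable_fun[OF this] obtain b where b: "\<And>p. functional b p = Some (\<lambda>n. p 1)" by auto
  show ?thesis
  proof (rule weihrauch_leI)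
    fix p x assume x: "inputs Q p = Some x" "x \<in> instances Q"
    from W[OF this] obtain r z where r: "functional \<Phi> p = Some r" "inputs P r = Some z" "z \<in> instances P"
      and W': "\<And>q y. outputs P q = Some y \<Longrightarrow> y \<in> solutions P z \<Longrightarrow>
             (\<exists>s w. functional \<Psi> (p \<oplus>\<^sub>B q) = Some s \<and> outputs Q s = Some w \<and> w \<in> solutions Q x)"
      by auto
    have sol: "\<exists>w. p_eval (p \<oplus>\<^sub>B g) \<Psi> [0] w \<and> w \<in> solutions Q x" if "g \<in> names_of_solutions P r" for g
    proof -
      from that obtain y where "outputs P g = Some y" "y \<in> solutions P z"
        using r(2) by (auto simp: names_of_solutions_def)
      from W'[OF this] obtain s where s: "functional \<Psi> (p \<oplus>\<^sub>B g) = Some s" "s 0 \<in> solutions Q x"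
        using Q(1) by (auto simp: first_order_def nat_rep_def)
      from functionalD[OF s(1), of 0] s(2) show ?thesis by blast
    qed
    have inst: "first_order_instance P (p, \<Phi>, \<Psi>)"
      using r sol by (fastforce simp: first_order_instance_def)
    \<comment> \<open>By \<open>problem P\<close> a solution has a name; this gives the triple at
      least one solution.\<close>
    obtain y g where "y \<in> solutions P z" "outputs P g = Some y"
      using r(3) P unfolding instances_def problem_def ran_def by fast
    then have g: "g \<in> names_of_solutions P r" using r(2) by (auto simp: names_of_solutions_def)
    then obtain w where "p_eval (p \<oplus>\<^sub>B g) \<Psi> [0] w" using sol by blast
    then have "w \<in> solutions (first_order_part P) (p, \<Phi>, \<Psi>)"
      using inst r(1) g by (auto simp: first_order_part_def)
    then have "(p, \<Phi>, \<Psi>) \<in> instances (first_order_part P)"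
      using triple_rep_name[of \<Phi> \<Psi> p] by (auto simp: instances_def first_order_part_def intro: ranI)
    moreover have "inputs (first_order_part P) (triple_name \<Phi> \<Psi> p) = Some (p, \<Phi>, \<Psi>)"
      by (simp add: first_order_part_def triple_rep_name)
    moreover have "\<exists>s w. functional b (p \<oplus>\<^sub>B q) = Some s \<and> outputs Q s = Some w \<and> w \<in> solutions Q x"
      if q: "outputs (first_order_part P) q = Some y" "y \<in> solutions (first_order_part P) (p, \<Phi>, \<Psi>)" for q y
    proof -
      from q have "y = q 0" by (simp add: first_order_part_def nat_rep_def)
      moreover obtain g where "g \<in> names_of_solutions P r" "p_eval (p \<oplus>\<^sub>B g) \<Psi> [0] y"
        using q(2) r(1) by (auto simp: first_order_part_def)
      ultimately have "q 0 \<in> solutions Q x" using sol p_eval_deterministic by blast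
      then show ?thesis using Q(1) by (simp add: b first_order_def nat_rep_def join_def)
    qed
    ultimately show "\<exists>r z. functional a p = Some r \<and> inputs (first_order_part P) r = Some z
        \<and> z \<in> instances (first_order_part P) \<and>
      (\<forall>q y. outputs (first_order_part P) q = Some y \<and> y \<in> solutions (first_order_part P) z \<longrightarrow>
         (\<exists>s w. functional b (p \<oplus>\<^sub>B q) = Some s \<and> outputs Q s = Some w \<and> w \<in> solutions Q x))"
      using a by blast
  qed
qed

lemma is_first_order_part_first_order_part:
  "problem P \<Longrightarrow> is_first_order_part TYPE('a) (first_order_part P) P"
  by (simp add: is_first_order_part_def first_order_first_order_part first_order_part_le
      le_first_order_part)


section \<open>Approximating copies of an ordinal by finite lists\<close>

text \<open>The use principle. The bounds of the finitely many subcomputations are added, the sum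
  being a convenient common bound.\<close>

lemma p_eval_use:
  "p_eval p e xs y \<Longrightarrow> \<exists>N. \<forall>q. (\<forall>n<N. q n = p n) \<longrightarrow> p_eval q e xs y"
proof (induction rule: p_eval.induct)
  case (Oracle x)
  have "p_eval q Oracle [x] (p x)" if "\<forall>n<Suc x. q n = p n" for q
    using that p_eval.Oracle[of q x] by simp
  then show ?case by blast
next
  case (Comp xs gs ys f z)
  from Comp.IH(1) have "\<forall>i\<in>{..<length gs}. \<exists>N. \<forall>q. (\<forall>n<N. q n = p n) \<longrightarrow> p_eval q (gs ! i) xs (ys ! i)"
    by (simp add: list_all2_conv_all_nth)
  then obtain N where N: "\<forall>i\<in>{..<length gs}. \<forall>q. (\<forall>n<N i. q n = p n) \<longrightarrow> p_eval q (gs ! i) xs (ys ! i)"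
    by (rule bchoice[THEN exE])
  from Comp.IH(2) obtain M where M: "\<forall>q. (\<forall>n<M. q n = p n) \<longrightarrow> p_eval q f ys z" by auto
  have "p_eval q (prog.Comp f gs) xs z" if q: "\<forall>n<M + (\<Sum>i<length gs. N i). q n = p n" for q
  proof (rule p_eval.Comp)
    show "p_eval q f ys z" using M q by simp
    have "\<forall>n<N i. q n = p n" if "i < length gs" for i
      using q member_le_sum[of i "{..<length gs}" N] that by auto
    then show "list_all2 (\<lambda>g y. p_eval q g xs y) gs ys"
      using N Comp.IH(1) by (auto simp: list_all2_conv_all_nth)
  qed
  then show ?case by blast
next
  case (PrimRec_Suc f g n xs y z)
  then obtain N M where "\<forall>q. (\<forall>n<N. q n = p n) \<longrightarrow> p_eval q (PrimRec f g) (n # xs) y"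
    "\<forall>q. (\<forall>n<M. q n = p n) \<longrightarrow> p_eval q g (n # y # xs) z" by auto
  then have "\<forall>q. (\<forall>n<N + M. q n = p n) \<longrightarrow> p_eval q (PrimRec f g) (Suc n # xs) z"
    by (intro allI impI p_eval.PrimRec_Suc[where y = y]) simp_all
  then show ?case by blast
next
  case (Minim f n xs)
  then obtain M where M: "\<forall>q. (\<forall>n<M. q n = p n) \<longrightarrow> p_eval q f (n # xs) 0" by auto
  from Minim.IH(2) have "\<forall>k\<in>{..<n}. \<exists>N. \<forall>q. (\<forall>n<N. q n = p n) \<longrightarrow> (\<exists>y>0. p_eval q f (k # xs) y)"
    by (metis lessThan_iff)
  then obtain N where N: "\<forall>k\<in>{..<n}. \<forall>q. (\<forall>n<N k. q n = p n) \<longrightarrow> (\<exists>y>0. p_eval q f (k # xs) y)"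
    by (rule bchoice[THEN exE])
  have "p_eval q (prog.Minim f) xs n" if q: "\<forall>i<M + (\<Sum>k<n. N k). q i = p i" for q
  proof (rule p_eval.Minim)
    show "p_eval q f (n # xs) 0" using M q by simp
    have "\<forall>i<N k. q i = p i" if "k < n" for k
      using q member_le_sum[of k "{..<n}" N] that by auto
    then show "\<forall>k<n. \<exists>y>0. p_eval q f (k # xs) y" using N by simp
  qed
  then show ?case by blast
qed (auto intro: p_eval.intros)

section \<open>Names of copies and their finite parts\<close>

definition order_name :: "nat set \<times> nat rel \<Rightarrow> baire" where
  "order_name = (\<lambda>(A, R). (\<lambda>n. if n \<in> A then 1 else 0) \<oplus>\<^sub>B (\<lambda>n. if prod_decode n \<in> R then 1 else 0))"

lemma copy_rep_order_name: "strict_well_order C \<Longrightarrow> copy_rep (order_name C) = Some C"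
  by (cases C) (auto simp: order_name_def copy_rep_def set_rep_def rel_rep_def)

lemma join_left_right: "left_part g \<oplus>\<^sub>B right_part g = g"
  by (rule ext) (simp add: left_part_def right_part_def join_def)

lemma set_rep_SomeD:
  assumes "set_rep g = Some A" shows "g = (\<lambda>n. if n \<in> A then 1 else 0)"
proof (rule ext)
  fix n
  have "range g \<subseteq> {0, 1}" "A = {n. g n = 1}" using assms by (simp_all add: set_rep_def split: if_splits)
  moreover have "g n \<in> range g" by (rule rangeI)
  ultimately show "g n = (if n \<in> A then 1 else 0)" by auto
qed

lemma rel_rep_SomeD:
  assumes "rel_rep g = Some R" shows "g = (\<lambda>n. if prod_decode n \<in> R then 1 else 0)"
proof (rule ext)
  fix n
  have "range g \<subseteq> {0, 1}" "R = {(x, y). g (prod_encode (x, y)) = 1}"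
    using assms by (simp_all add: rel_rep_def split: if_splits)
  moreover have "g n \<in> range g" by (rule rangeI)
  moreover have "prod_encode (prod_decode n) = n" by simp
  ultimately show "g n = (if prod_decode n \<in> R then 1 else 0)"
    by (cases "prod_decode n") auto
qed

lemma copy_rep_SomeD:
  assumes "copy_rep g = Some C" shows "strict_well_order C" "g = order_name C"
proof -
  obtain A R where C: "C = (A, R)" "strict_well_order C"
    and A: "set_rep (left_part g) = Some A" and R: "rel_rep (right_part g) = Some R"
    using assms by (auto simp: copy_rep_def split: option.splits if_splits)
  show "strict_well_order C" by (rule C)
  show "g = order_name C"
    using join_left_right[of g] unfolding set_rep_SomeD[OF A] rel_rep_SomeD[OF R]
    by (simp add: C order_name_def)
qed

definition agree_below :: "nat \<Rightarrow> nat set \<times> nat rel \<Rightarrow> nat set \<times> nat rel \<Rightarrow> bool" where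
  "agree_below N C D \<longleftrightarrow> (\<forall>x<N. x \<in> fst C \<longleftrightarrow> x \<in> fst D)
     \<and> (\<forall>x<N. \<forall>y<N. (x, y) \<in> snd C \<longleftrightarrow> (x, y) \<in> snd D)"

text \<open>The components of a pair do not exceed its code, so the first \<open>N\<close> entries
  of a name speak only of numbers below \<open>N\<close>.\<close>

lemma order_name_agree:
  assumes "agree_below N C D" "n < N" shows "order_name C n = order_name D n"
proof -
  obtain x y where xy: "prod_decode (n div 2) = (x, y)" by force
  then have "n div 2 = prod_encode (x, y)" by (metis prod_decode_inverse)
  then have "x < N" "y < N"
    using assms(2) le_prod_encode_1[of x y] le_prod_encode_2[of y x] by linarith+
  with assms xy show ?thesis
    by (cases C, cases D) (auto simp: order_name_def join_def agree_below_def)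
qed

lemma p_eval_order_name_agree:
  assumes "p_eval (f \<oplus>\<^sub>B order_name C) e xs y"
  obtains N where "\<And>D. agree_below N D C \<Longrightarrow> p_eval (f \<oplus>\<^sub>B order_name D) e xs y"
proof -
  obtain N where N: "\<forall>q. (\<forall>n<N. q n = (f \<oplus>\<^sub>B order_name C) n) \<longrightarrow> p_eval q e xs y"
    using p_eval_use[OF assms] by auto
  have "p_eval (f \<oplus>\<^sub>B order_name D) e xs y" if "agree_below N D C" for D
    using N order_name_agree[OF that] by (auto simp: join_def)
  then show thesis by (rule that)
qed

section \<open>Finite linear orders as approximations of copies\<close>

definition list_order :: "nat list \<Rightarrow> nat set \<times> nat rel" where
  "list_order xs = (set xs, {(xs ! i, xs ! j) |i j. i < j \<and> j < length xs})"

text \<open>A minimal element of \<open>S\<close> is below all the others by comparability; it is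
  put in front of a sorted list of the rest.\<close>

lemma sorted_list_exists:
  assumes "wf R" "finite S" "\<And>x y. x \<in> S \<Longrightarrow> y \<in> S \<Longrightarrow> x \<noteq> y \<Longrightarrow> (x, y) \<in> R \<or> (y, x) \<in> R"
  shows "\<exists>xs. distinct xs \<and> set xs = S \<and> sorted_wrt (\<lambda>x y. (x, y) \<in> R) xs"
  using assms(2,3)
proof (induction "card S" arbitrary: S)
  case 0
  then show ?case by (intro exI[of _ "[]"]) simp
next
  case (Suc k)
  then obtain z where z: "z \<in> S" "\<And>y. (y, z) \<in> R \<Longrightarrow> y \<notin> S"
    using assms(1) unfolding wf_eq_minimal by (metis card_0_eq equals0I nat.distinct(1))
  have "k = card (S - {z})" using Suc.hyps(2) Suc.prems(1) z(1) by simp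
  then obtain xs where "distinct xs" "set xs = S - {z}" "sorted_wrt (\<lambda>x y. (x, y) \<in> R) xs"
    using Suc.hyps(1)[of "S - {z}"] Suc.prems by auto
  then show ?case
    using z Suc.prems(2) by (intro exI[of _ "z # xs"]) auto
qed

lemma refl_order_minus_Id:
  assumes "strict_well_order (A, R)" shows "refl_order (A, R) - Id = R"
  using assms by (auto simp: strict_well_order_def refl_order_def irrefl_def)

text \<open>The list is the part of \<open>A\<close> below \<open>N\<close> in increasing order; all
  else in the copy is invisible below \<open>N\<close>.\<close>

lemma list_order_approximates:
  assumes "strict_well_order (A, R)"
  obtains xs where "distinct xs" "set xs \<subseteq> A" "agree_below N (list_order xs) (A, R)"
proof -
  have R: "R \<subseteq> A \<times> A" "well_order_on A (refl_order (A, R))"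
    using assms by (auto simp: strict_well_order_def)
  then have wf: "wf R" and total: "total_on A (refl_order (A, R))"
    using refl_order_minus_Id[OF assms] by (simp_all add: well_order_on_def linear_order_on_def)
  have "(x, y) \<in> R \<or> (y, x) \<in> R" if "x \<in> A" "y \<in> A" "x \<noteq> y" for x y
    using total that by (auto simp: total_on_def refl_order_def)
  then obtain xs where xs: "distinct xs" "set xs = A \<inter> {..<N}" "sorted_wrt (\<lambda>x y. (x, y) \<in> R) xs"
    using sorted_list_exists[OF wf, of "A \<inter> {..<N}"] by (metis IntD1 finite_Int finite_lessThan)
  have "(\<exists>i j. (x, y) = (xs ! i, xs ! j) \<and> i < j \<and> j < length xs) \<longleftrightarrow> (x, y) \<in> R" if "x < N" "y < N" for x y
  proof
    assume "(x, y) \<in> R"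
    then have "x \<in> set xs" "y \<in> set xs" using R(1) that xs(2) by auto
    then obtain i j where ij: "i < length xs" "x = xs ! i" "j < length xs" "y = xs ! j"
      by (auto simp: in_set_conv_nth)
    have "\<not> j < i"
    proof
      assume "j < i"
      then have "(y, x) \<in> R" using xs(3) ij by (auto simp: sorted_wrt_iff_nth_less)
      with wf_asym[OF wf \<open>(x, y) \<in> R\<close>] show False by simp
    qed
    moreover have "i \<noteq> j"
    proof
      assume "i = j"
      with \<open>(x, y) \<in> R\<close> ij have "(x, x) \<in> R" by simp
      with wf_irrefl[OF wf] show False by blast
    qed
    ultimately show "\<exists>i j. (x, y) = (xs ! i, xs ! j) \<and> i < j \<and> j < length xs"
      using ij by (intro exI[of _ i] exI[of _ j]) simp
  qed (use xs(3) in \<open>auto simp: sorted_wrt_iff_nth_less\<close>)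
  then have "agree_below N (list_order xs) (A, R)"
    using xs(2) by (auto simp: agree_below_def list_order_def)
  with xs show thesis using that by blast
qed

text \<open>Any \<open>S\<close> of the right size serves, because a finite linear order is
  determined by its size. The increasing enumeration \<open>zs\<close> of \<open>S\<close> is
  renamed to \<open>xs\<close>, and the rest of \<alpha> is shifted to numbers from \<open>M\<close>
  on.\<close>

lemma list_order_extends:
  fixes \<alpha> :: "nat rel"
  assumes \<alpha>: "Well_order \<alpha>" and xs: "distinct xs"
    and card: "finite (Field \<alpha>) \<Longrightarrow> length xs \<le> card (Field \<alpha>)"
  obtains C where "copy_of C \<alpha>" "agree_below N C (list_order xs)"
proof -
  obtain S where S: "S \<subseteq> Field \<alpha>" "finite S" "card S = length xs"
  proof (cases "finite (Field \<alpha>)")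
    case True
    show ?thesis
      by (rule obtain_subset_with_card_n[OF card[OF True]]) (rule that)
  next
    case False
    from infinite_arbitrarily_large[OF this, of "length xs"]
    obtain B where "finite B" "card B = length xs" "B \<subseteq> Field \<alpha>" by (elim exE conjE)
    then show ?thesis using that[of B] by simp
  qed
  have wf: "wf (\<alpha> - Id)" and total: "total_on (Field \<alpha>) \<alpha>" and refl: "refl_on (Field \<alpha>) \<alpha>"
    using \<alpha> by (simp_all add: well_order_on_def linear_order_on_def partial_order_on_def preorder_on_def)
  have "(x, y) \<in> \<alpha> - Id \<or> (y, x) \<in> \<alpha> - Id" if "x \<in> S" "y \<in> S" "x \<noteq> y" for x y
    using total that S(1) by (auto simp: total_on_def)
  then obtain zs where zs: "distinct zs" "set zs = S" "sorted_wrt (\<lambda>x y. (x, y) \<in> \<alpha> - Id) zs"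
    using sorted_list_exists[OF wf S(2)] by blast
  have len: "length zs = length xs" using zs S(3) by (metis distinct_card)
  \<comment> \<open>Larger than \<open>N\<close> and than every entry of \<open>xs\<close>, for
    which the sum is a crude bound: shifted elements are invisible below \<open>N\<close> and do not
    collide with the list.\<close>
  define M where "M = Suc (N + (\<Sum>x\<in>set xs. x))"
  have M: "x < M" if "x \<in> set xs" for x
    using member_le_sum[OF that, of "\<lambda>x. x"] by (simp add: M_def)
  define h where "h z = (if z \<in> S then xs ! (THE i. i < length zs \<and> zs ! i = z) else M + z)" for z
  have h_nth: "h (zs ! i) = xs ! i" if "i < length zs" for i
  proof -
    have "(THE k. k < length zs \<and> zs ! k = zs ! i) = i"
      using that nth_eq_iff_index_eq[OF zs(1) _ that] by (intro the_equality) auto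
    moreover have "zs ! i \<in> S" using that zs(2) nth_mem by blast
    ultimately show ?thesis by (simp add: h_def)
  qed
  have h_out: "h z = M + z" if "z \<notin> S" for z using that by (simp add: h_def)
  have S_nth: "\<exists>i<length xs. z = zs ! i" if "z \<in> S" for z
    using that unfolding zs(2)[symmetric] in_set_conv_nth len by metis
  have h_lt: "h z < M" and h_in: "h z \<in> set xs" if z: "z \<in> S" for z
  proof -
    obtain i where i: "i < length xs" "z = zs ! i" using S_nth[OF z] by metis
    then have "h z = xs ! i" using h_nth[of i] len by simp
    with i show "h z \<in> set xs" by simp
    then show "h z < M" by (rule M)
  qed
  have inj: "inj_on h (Field \<alpha>)"
  proof (rule inj_onI)
    fix a b assume ab: "h a = h b"
    show "a = b"
    proof (cases "a \<in> S"; cases "b \<in> S")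
      assume "a \<in> S" "b \<in> S"
      then obtain i j where "i < length zs" "a = zs ! i" "j < length zs" "b = zs ! j"
        using S_nth len by metis
      then show ?thesis using ab h_nth xs len by (simp add: nth_eq_iff_index_eq)
    next
      assume "a \<in> S" "b \<notin> S"
      with h_lt[of a] h_out[of b] ab show ?thesis by simp
    next
      assume "a \<notin> S" "b \<in> S"
      with h_lt[of b] h_out[of a] ab show ?thesis by simp
    next
      assume "a \<notin> S" "b \<notin> S"
      then show ?thesis using ab by (simp add: h_out)
    qed
  qed
  define R where "R = dir_image \<alpha> h - Id"
  have Field: "Field (dir_image \<alpha> h) = h ` Field \<alpha>" by (rule dir_image_Field)
  have wo: "Well_order (dir_image \<alpha> h)" using Well_order_dir_image[OF \<alpha> inj] .
  then have "refl_on (Field (dir_image \<alpha> h)) (dir_image \<alpha> h)"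
    by (simp add: well_order_on_def linear_order_on_def partial_order_on_def preorder_on_def)
  then have ro: "refl_order (h ` Field \<alpha>, R) = dir_image \<alpha> h"
    by (auto simp: refl_order_def R_def Field[symmetric] refl_on_def intro: FieldI1)
  have wo': "well_order_on (h ` Field \<alpha>) (refl_order (h ` Field \<alpha>, R))"
    using wo unfolding ro Field .
  have "R \<subseteq> h ` Field \<alpha> \<times> h ` Field \<alpha>"
  proof (rule subrelI)
    fix a b assume "(a, b) \<in> R"
    then have "(a, b) \<in> dir_image \<alpha> h" by (simp add: R_def)
    from FieldI1[OF this] FieldI2[OF this] show "(a, b) \<in> h ` Field \<alpha> \<times> h ` Field \<alpha>"
      by (simp add: Field)
  qed
  moreover have "irrefl R" by (simp add: R_def irrefl_def)
  ultimately have swo: "strict_well_order (h ` Field \<alpha>, R)"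
    using wo' by (simp only: strict_well_order_def prod.case simp_thms)
  have "(dir_image \<alpha> h, \<alpha>) \<in> ordIso"
    using ordIso_symmetric[OF dir_image_ordIso[OF \<alpha> inj]] .
  with swo have "copy_of (h ` Field \<alpha>, R) \<alpha>" by (simp only: copy_of_def ro simp_thms)
  moreover have "agree_below N (h ` Field \<alpha>, R) (list_order xs)"
  proof -
    have small: "z \<in> S" if "h z < N" for z
    proof (rule ccontr)
      assume "z \<notin> S"
      with that show False by (simp add: h_out M_def)
    qed
    have mem: "x \<in> h ` Field \<alpha> \<longleftrightarrow> x \<in> set xs" if "x < N" for x
    proof
      assume "x \<in> set xs"
      then obtain i where i: "i < length xs" "x = xs ! i" by (auto simp: in_set_conv_nth)
      then have "zs ! i \<in> S" using nth_mem[of i zs] by (simp add: len zs(2))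
      moreover have "x = h (zs ! i)" using h_nth[of i] i by (simp add: len)
      ultimately show "x \<in> h ` Field \<alpha>" using S(1) by blast
    next
      assume "x \<in> h ` Field \<alpha>"
      then obtain z where z: "x = h z" by blast
      with that small[of z] h_in[of z] show "x \<in> set xs" by simp
    qed
    have rel: "(x, y) \<in> R \<longleftrightarrow> (\<exists>i j. (x, y) = (xs ! i, xs ! j) \<and> i < j \<and> j < length xs)"
      if xy: "x < N" "y < N" for x y
    proof
      assume "(x, y) \<in> R"
      then obtain a b where ab: "x = h a" "y = h b" "(a, b) \<in> \<alpha>" "h a \<noteq> h b"
        by (auto simp: R_def dir_image_def)
      then have "a \<in> S" "b \<in> S" using small[of a] small[of b] xy by simp_all
      then obtain i j where ij: "i < length xs" "a = zs ! i" "j < length xs" "b = zs ! j"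
        using S_nth[OF \<open>a \<in> S\<close>] S_nth[OF \<open>b \<in> S\<close>] by blast
      have "\<not> j < i"
      proof
        assume "j < i"
        then have "(b, a) \<in> \<alpha> - Id" using zs(3) ij len by (simp add: sorted_wrt_iff_nth_less)
        moreover have "(a, b) \<in> \<alpha> - Id" using ab by auto
        ultimately show False using wf_asym[OF wf] by blast
      qed
      moreover have "i \<noteq> j" using ab ij by blast
      ultimately have "i < j" by simp
      moreover have "x = xs ! i" "y = xs ! j" using h_nth[of i] h_nth[of j] ij ab(1,2) len by simp_all
      ultimately show "\<exists>i j. (x, y) = (xs ! i, xs ! j) \<and> i < j \<and> j < length xs"
        using ij(3) by blast
    next
      assume "\<exists>i j. (x, y) = (xs ! i, xs ! j) \<and> i < j \<and> j < length xs"
      then obtain i j where ij: "x = xs ! i" "y = xs ! j" "i < j" "j < length xs" by blast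
      then have "(zs ! i, zs ! j) \<in> \<alpha>" using zs(3) len by (simp add: sorted_wrt_iff_nth_less)
      moreover have "h (zs ! i) = x" "h (zs ! j) = y" using h_nth[of i] h_nth[of j] ij len by simp_all
      moreover have "x \<noteq> y" using ij xs by (simp add: nth_eq_iff_index_eq)
      ultimately show "(x, y) \<in> R" unfolding R_def dir_image_def by blast
    qed
    show ?thesis
      unfolding agree_below_def list_order_def fst_conv snd_conv mem_Collect_eq
      by (intro conjI allI impI mem) (insert rel, blast)
  qed
  ultimately show thesis by (rule that)
qed

lemma copy_of_card:
  assumes "copy_of (A, R) \<alpha>" "finite (Field \<alpha>)"
  shows "finite A" "card A = card (Field \<alpha>)"
proof -
  have "Field (refl_order (A, R)) = A"
    using assms(1) by (auto simp: copy_of_def strict_well_order_def dest: well_order_on_Field)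
  then obtain h where "bij_betw h A (Field \<alpha>)"
    using assms(1) by (auto simp: copy_of_def ordIso_def BNF_Wellorder_Embedding.iso_def)
  then show "finite A" "card A = card (Field \<alpha>)"
    using assms(2) bij_betw_finite bij_betw_same_card by blast+
qed

section \<open>Search for finite orders on which a program halts\<close>

definition list_name :: "nat \<Rightarrow> baire" where
  "list_name L n =
     (if even n then if \<exists>i<llen L. n div 2 = lnth L i then 1 else 0
      else if \<exists>j<llen L. \<exists>i<j. n div 2 = prod_encode (lnth L i, lnth L j) then 1 else 0)"

text \<open>\<open>list_name\<close> reads the order off the list code with bounded quantifiers, so
  the name of a finite order can be simulated as an oracle.\<close>

lemma list_name_encode: "list_name (list_encode xs) = order_name (list_order xs)"
proof (rule ext)
  fix n
  obtain x y where n: "n div 2 = prod_encode (x, y)" by (metis prod.collapse prod_decode_inverse)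
  have "(\<exists>i<length xs. z = lnth (list_encode xs) i) \<longleftrightarrow> z \<in> set xs" for z
    by (auto simp: in_set_conv_nth)
  moreover have "(\<exists>j<length xs. \<exists>i<j. x = lnth (list_encode xs) i \<and> y = lnth (list_encode xs) j) \<longleftrightarrow>
      (\<exists>i j. (x, y) = (xs ! i, xs ! j) \<and> i < j \<and> j < length xs)"
    by force
  ultimately show "list_name (list_encode xs) n = order_name (list_order xs) n"
    by (simp add: list_name_def order_name_def list_order_def join_def n)
qed

text \<open>
  \<open>p\<close> is the name of a triple, so that \<open>p 1\<close> is the index of \<open>\<Psi>\<close>.
\<close>

definition halting_list :: "baire \<Rightarrow> nat \<Rightarrow> bool" where
  "halting_list p c \<longleftrightarrow>
     (\<forall>j<llen (pi1 c). \<forall>i<j. lnth (pi1 c) i \<noteq> lnth (pi1 c) j) \<and>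
     halts_with (\<lambda>n. if even n then p (n div 2 + 2) else list_name (pi1 c) (n div 2))
       (p 1) (lcons 0 0) (pi2 c)"

lemma computable_list_name: "computable_fun L \<Longrightarrow> computable_fun N \<Longrightarrow> computable_fun (\<lambda>p x. list_name (L p x) (N p x))"
proof -
  have "computable_fun (\<lambda>p z. list_name (pi1 z) (pi2 z))"
    unfolding list_name_def by (intro computable_intros)
  then show "computable_fun L \<Longrightarrow> computable_fun N \<Longrightarrow> computable_fun (\<lambda>p x. list_name (L p x) (N p x))" by (rule computable_compose_pair)
qed

lemma decidable_halting_list: "computable_fun C \<Longrightarrow> decidable (\<lambda>p x. halting_list p (C p x))"
proof -
  have "decidable (\<lambda>p c. halting_list p c)"
    unfolding halting_list_def by (intro computable_intros decidable_halts_with computable_list_name)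
  then show "computable_fun C \<Longrightarrow> decidable (\<lambda>p x. halting_list p (C p x))" by (rule decidable_compose)
qed

lemma distinct_list_code:
  "(\<forall>j<llen (list_encode xs). \<forall>i<j. lnth (list_encode xs) i \<noteq> lnth (list_encode xs) j) \<longleftrightarrow> distinct xs"
  by (auto simp: distinct_conv_nth) (metis linorder_neqE_nat order.strict_trans)

lemma halting_listD:
  assumes "halting_list p c" "p 1 = index \<Psi>"
  shows "\<exists>xs. distinct xs \<and> length xs = llen (pi1 c) \<and>
    p_eval ((\<lambda>n. p (n + 2)) \<oplus>\<^sub>B order_name (list_order xs)) \<Psi> [0] (pi2 (pi2 c))"
proof -
  obtain xs where xs: "pi1 c = list_encode xs" by (metis list_decode_inverse)
  have "distinct xs" using assms(1) by (simp add: halting_list_def xs flip: distinct_list_code)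
  moreover have "(\<lambda>n. if even n then p (n div 2 + 2) else list_name (pi1 c) (n div 2))
    = (\<lambda>n. p (n + 2)) \<oplus>\<^sub>B order_name (list_order xs)"
    by (rule ext) (simp add: join_def xs list_name_encode)
  then have "halts_with ((\<lambda>n. p (n + 2)) \<oplus>\<^sub>B order_name (list_order xs)) (index \<Psi>) (list_encode [0]) (pi2 c)"
    using assms by (simp add: halting_list_def)
  then have "p_eval ((\<lambda>n. p (n + 2)) \<oplus>\<^sub>B order_name (list_order xs)) \<Psi> [0] (pi2 (pi2 c))"
    using halts_with_iff by blast
  ultimately show ?thesis by (intro exI[of _ xs]) (simp add: xs)
qed

lemma halting_listI:
  assumes "distinct xs" "p 1 = index \<Psi>"
    and "p_eval ((\<lambda>n. p (n + 2)) \<oplus>\<^sub>B order_name (list_order xs)) \<Psi> [0] y"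
  shows "\<exists>c. halting_list p c \<and> llen (pi1 c) = length xs"
proof -
  obtain n where n: "halts_with ((\<lambda>n. p (n + 2)) \<oplus>\<^sub>B order_name (list_order xs)) (index \<Psi>) (list_encode [0]) n"
    using halts_with_search(1)[OF assms(3)] by blast
  have "(\<lambda>n. if even n then p (n div 2 + 2) else list_name (list_encode xs) (n div 2))
    = (\<lambda>n. p (n + 2)) \<oplus>\<^sub>B order_name (list_order xs)"
    by (rule ext) (simp add: join_def list_name_encode)
  with n have "halts_with (\<lambda>n. if even n then p (n div 2 + 2) else list_name (list_encode xs) (n div 2))
      (p 1) (lcons 0 0) n"
    by (simp only: assms(2) list_encode.simps)
  then have "halting_list p (prod_encode (list_encode xs, n))"
    using assms(1) unfolding halting_list_def prod_encode_inverse fst_conv snd_conv distinct_list_code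
    by blast
  then show ?thesis by (intro exI[of _ "prod_encode (list_encode xs, n)"]) simp
qed

lemma first_order_part_OG_le_Min: "first_order_part OG_alpha0 \<le>\<^sub>W Min_problem"
proof -
  \<comment> \<open>The value at \<open>x\<close> is the length of a halting list found from
    \<open>x\<close> on. The second component of \<open>n\<close> is a dummy that makes each
    candidate recur arbitrarily late, so no search fails; at the code of \<open>(c, 0)\<close> the
    search stops at \<open>c\<close> itself, so no length is missed.\<close>
  have "\<exists>a. \<forall>p. (\<forall>x. \<exists>n. x \<le> n \<and> halting_list p (pi1 n)) \<longrightarrow>
      functional a p = Some (\<lambda>x. llen (pi1 (pi1 (LEAST n. x \<le> n \<and> halting_list p (pi1 n)))))"
    by (rule functional_search[where G = "\<lambda>p n x. llen (pi1 (pi1 n))"])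
      (intro computable_intros decidable_halting_list)+
  then obtain a where a: "\<And>p. \<forall>x. \<exists>n. x \<le> n \<and> halting_list p (pi1 n) \<Longrightarrow>
      functional a p = Some (\<lambda>x. llen (pi1 (pi1 (LEAST n. x \<le> n \<and> halting_list p (pi1 n)))))"
    by auto
  \<comment> \<open>In the join of the triple name with an answer of \<open>Min\<close>, position 1
    holds the minimal length.\<close>
  define H where "H s c \<longleftrightarrow> halting_list (left_part s) c \<and> llen (pi1 c) = s 1" for s c
  have "decidable (\<lambda>s c. halting_list (\<lambda>n. s (n + n)) c)"
    unfolding halting_list_def by (intro computable_intros decidable_halts_with computable_list_name)
  then have "decidable (\<lambda>s c. H s c)"
    unfolding H_def left_part_def by (intro computable_intros) (simp_all add: mult_2)
  then have "\<exists>b. \<forall>s. (\<forall>x :: nat. \<exists>c. H s c) \<longrightarrow> functional b s = Some (\<lambda>x. pi2 (pi2 (LEAST c. H s c)))"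
    by (intro functional_search[where G = "\<lambda>s c x. pi2 (pi2 c)"] computable_intros)
      (rule decidable_compose, assumption, intro computable_intros)
  then obtain b where b: "\<And>s. \<exists>c. H s c \<Longrightarrow> functional b s = Some (\<lambda>x. pi2 (pi2 (LEAST c. H s c)))"
    by auto
  show ?thesis
  proof (rule weihrauch_leI)
    fix p x assume "inputs (first_order_part OG_alpha0) p = Some x"
      and x: "x \<in> instances (first_order_part OG_alpha0)"
    then obtain f \<Phi> \<Psi> where x_def: "x = (f, \<Phi>, \<Psi>)" and p: "p 0 = index \<Phi>" "p 1 = index \<Psi>"
      and f: "f = (\<lambda>n. p (n + 2))"
      by (cases x) (auto simp: first_order_part_def triple_rep_eq_Some)
    from first_order_instanceI[OF x] obtain r G where r: "functional \<Phi> f = Some r"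
      "inputs OG_alpha0 r = Some G" "G \<in> instances OG_alpha0"
      and halts: "\<And>g. g \<in> names_of_solutions OG_alpha0 r \<Longrightarrow> \<exists>y. p_eval (f \<oplus>\<^sub>B g) \<Psi> [0] y"
      by (auto simp: x_def first_order_instance_def)
    from r(3) obtain C where "C \<in> solutions OG_alpha0 G" by (auto simp: instances_def)
    moreover obtain A R where "C = (A, R)" by (cases C)
    ultimately obtain \<alpha> :: "nat rel" where C: "G \<in> ran ogroup_rep" "Well_order \<alpha>"
      "has_order_type G (Zpow \<alpha>)" "copy_of (A, R) \<alpha>"
      by (auto simp only: OG_alpha0_def problem.simps mem_Collect_eq)
    have names: "order_name C' \<in> names_of_solutions OG_alpha0 r" if "copy_of C' \<alpha>" for C'
      using that C r(2) copy_rep_order_name[of C']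
      by (cases C') (auto simp: names_of_solutions_def OG_alpha0_def copy_of_def)
    have swo: "strict_well_order (A, R)" using C(4) by (simp add: copy_of_def)
    obtain y where "p_eval (f \<oplus>\<^sub>B order_name (A, R)) \<Psi> [0] y" using halts names C(4) by blast
    then obtain N where N: "\<And>D. agree_below N D (A, R) \<Longrightarrow> p_eval (f \<oplus>\<^sub>B order_name D) \<Psi> [0] y"
      by (rule p_eval_order_name_agree) blast
    obtain xs where xs: "distinct xs" "set xs \<subseteq> A" "agree_below N (list_order xs) (A, R)"
      using swo by (rule list_order_approximates)
    have "p_eval ((\<lambda>n. p (n + 2)) \<oplus>\<^sub>B order_name (list_order xs)) \<Psi> [0] y"
      using N[OF xs(3)] by (simp only: f)
    from halting_listI[where p = p, OF xs(1) p(2) this]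
    obtain c where c: "halting_list p c" "llen (pi1 c) = length xs" by blast
    have search: "\<exists>n. i \<le> n \<and> halting_list p (pi1 n)" for i
      using c(1) le_prod_encode_2[of i c] by (intro exI[of _ "prod_encode (c, i)"]) simp
    define m where "m i = llen (pi1 (pi1 (LEAST n. i \<le> n \<and> halting_list p (pi1 n))))" for i
    have m_good: "\<exists>c. halting_list p c \<and> llen (pi1 c) = m i" for i
      using LeastI_ex[OF search[of i]] unfolding m_def by blast
    have good_m: "llen (pi1 c) \<in> range m" if "halting_list p c" for c
    proof -
      have "(LEAST n. prod_encode (c, 0) \<le> n \<and> halting_list p (pi1 n)) = prod_encode (c, 0)"
        by (rule Least_equality) (use that in simp_all)
      then have "m (prod_encode (c, 0)) = llen (pi1 c)" by (simp add: m_def)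
      then show ?thesis by (metis rangeI)
    qed
    define k where "k = (LEAST k. k \<in> range m)"
    have "k \<in> range m" unfolding k_def by (rule LeastI[of _ "m 0"]) simp
    then obtain c' where c': "halting_list p c'" "llen (pi1 c') = k" using m_good by auto
    have "k \<le> length xs" unfolding k_def c(2)[symmetric] by (rule Least_le) (rule good_m[OF c(1)])
    moreover have "length xs \<le> card (Field \<alpha>)" if "finite (Field \<alpha>)"
      using copy_of_card[OF C(4) that] card_mono[OF _ xs(2)] distinct_card[OF xs(1)] by simp
    ultimately have small: "finite (Field \<alpha>) \<Longrightarrow> k \<le> card (Field \<alpha>)" by linarith
    have "\<exists>s w. functional b (p \<oplus>\<^sub>B q) = Some s \<and> outputs (first_order_part OG_alpha0) s = Some w
        \<and> w \<in> solutions (first_order_part OG_alpha0) x"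
      if q: "outputs Min_problem q = Some y" "y \<in> solutions Min_problem m" for q y
    proof -
      have H: "H (p \<oplus>\<^sub>B q) c \<longleftrightarrow> halting_list p c \<and> llen (pi1 c) = k" for c
        using q by (simp add: H_def Min_problem_def nat_rep_def k_def) (simp add: join_def)
      then have ex: "\<exists>c. H (p \<oplus>\<^sub>B q) c" using c' by blast
      define c'' where "c'' = (LEAST c. H (p \<oplus>\<^sub>B q) c)"
      have "H (p \<oplus>\<^sub>B q) c''" unfolding c''_def using ex by (rule LeastI_ex)
      then have "halting_list p c''" and k: "llen (pi1 c'') = k" by (simp_all add: H)
      from halting_listD[OF this(1) p(2)] obtain ys where ys: "distinct ys" "length ys = k"
        "p_eval (f \<oplus>\<^sub>B order_name (list_order ys)) \<Psi> [0] (pi2 (pi2 c''))"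
        unfolding f k by blast
      obtain M where M: "\<And>D. agree_below M D (list_order ys) \<Longrightarrow>
          p_eval (f \<oplus>\<^sub>B order_name D) \<Psi> [0] (pi2 (pi2 c''))"
        using ys(3) by (rule p_eval_order_name_agree) blast
      \<comment> \<open>A genuine solution that agrees with \<open>ys\<close> as far as \<Psi>
        looks. So the value computed from \<open>ys\<close> is a correct answer, although
        \<open>ys\<close> was found without reference to \<alpha>.\<close>
      obtain C' where "copy_of C' \<alpha>" "agree_below M C' (list_order ys)"
        by (rule list_order_extends[OF C(2) ys(1), of M]) (use small ys(2) in simp)
      from names[OF this(1)] M[OF this(2)]
      have "\<exists>g\<in>names_of_solutions OG_alpha0 r. p_eval (f \<oplus>\<^sub>B g) \<Psi> [0] (pi2 (pi2 c''))" by blast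
      then have "pi2 (pi2 c'') \<in> solutions (first_order_part OG_alpha0) x"
        using first_order_instanceI[OF x] r(1) by (simp add: first_order_part_def x_def)
      then show ?thesis
        using b[OF ex] by (simp add: first_order_part_def nat_rep_def flip: c''_def)
    qed
    moreover have "functional a p = Some m" using a[of p] search by (simp add: m_def[abs_def])
    moreover have "inputs Min_problem m = Some m" "m \<in> instances Min_problem"
      by (auto simp: Min_problem_def instances_def ran_def)
    ultimately show "\<exists>r z. functional a p = Some r \<and> inputs Min_problem r = Some z
        \<and> z \<in> instances Min_problem \<and>
      (\<forall>q y. outputs Min_problem q = Some y \<and> y \<in> solutions Min_problem z \<longrightarrow>
         (\<exists>s w. functional b (p \<oplus>\<^sub>B q) = Some s \<and> outputs (first_order_part OG_alpha0) s = Some w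
            \<and> w \<in> solutions (first_order_part OG_alpha0) x))"
      by blast
  qed
qed


section \<open>The order type determines a finite exponent\<close>

definition lexless :: "(nat \<Rightarrow> int) \<Rightarrow> (nat \<Rightarrow> int) \<Rightarrow> bool" where
  "lexless f g \<longleftrightarrow> (\<exists>x. f x < g x \<and> (\<forall>y>x. f y = g y))"

definition Zvec :: "nat \<Rightarrow> (nat \<Rightarrow> int) set" where
  "Zvec n = {f. \<forall>i\<ge>n. f i = 0}"

text \<open>Ordered lexicographically, this is the ordinal \<omega> to the power \<open>n\<close>.
  Translation by a nonzero element is strictly increasing, unlike for general integer
  vectors.\<close>

definition Nvec :: "nat \<Rightarrow> (nat \<Rightarrow> int) set" where
  "Nvec n = {f \<in> Zvec n. \<forall>i. 0 \<le> f i}"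

lemma lexless_add_Nvec:
  assumes "f \<in> Nvec n" "f \<noteq> (\<lambda>_. 0)" shows "lexless v (\<lambda>i. v i + f i)"
proof -
  let ?S = "{i. f i \<noteq> 0}"
  have sub: "?S \<subseteq> {..<n}"
  proof
    fix i assume "i \<in> ?S"
    then show "i \<in> {..<n}" using assms(1) by (cases "n \<le> i") (simp_all add: Nvec_def Zvec_def)
  qed
  then have fin: "finite ?S" by (rule finite_subset) simp
  have ne: "?S \<noteq> {}" using assms(2) by (auto simp: fun_eq_iff)
  define k where "k = Max ?S"
  have "k \<in> ?S" unfolding k_def by (rule Max_in[OF fin ne])
  then have "0 < f k" using assms(1) by (simp add: Nvec_def order_less_le)
  moreover have "f y = 0" if "y > k" for y
  proof (rule ccontr)
    assume "f y \<noteq> 0"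
    then have "y \<le> k" unfolding k_def by (intro Max_ge[OF fin]) simp
    with that show False by simp
  qed
  ultimately show ?thesis unfolding lexless_def by (intro exI[of _ k]) simp
qed

text \<open>
  Induction on \<open>m\<close>: the elements of \<open>\<nat>\<^sup>n\<^sup>-\<^sup>1\<close> are bounded in \<open>\<nat>\<^sup>n\<close>, so the top coordinates of
  their images take finitely many values, and are constant beyond some \<open>v\<close>. Translating by \<open>v\<close>
  and deleting the top coordinate gives a map from \<open>\<nat>\<^sup>n\<^sup>-\<^sup>1\<close> to \<open>\<int>\<^sup>m\<^sup>-\<^sup>1\<close>.
\<close>

lemma no_strict_mono_Nvec_Zvec:
  assumes "m < n" "\<And>f. f \<in> Nvec n \<Longrightarrow> h f \<in> Zvec m"
    and "\<And>f g. f \<in> Nvec n \<Longrightarrow> g \<in> Nvec n \<Longrightarrow> lexless f g \<Longrightarrow> lexless (h f) (h g)"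
  shows False
  using assms
proof (induction m arbitrary: n h)
  case 0
  let ?f = "\<lambda>_ :: nat. 0 :: int" and ?g = "(\<lambda>_ :: nat. 0 :: int)(0 := 1)"
  have "?f \<in> Nvec n" "?g \<in> Nvec n" using 0(1) by (auto simp: Nvec_def Zvec_def)
  moreover have "lexless ?f ?g" unfolding lexless_def by (intro exI[of _ 0]) simp
  ultimately have "lexless (h ?f) (h ?g)" "h ?f \<in> Zvec 0" "h ?g \<in> Zvec 0"
    using 0(2,3) by simp_all
  then show False by (simp add: lexless_def Zvec_def)
next
  case (Suc m)
  obtain n' where n: "n = Suc n'" and mn: "m < n'" using Suc.prems(1) by (cases n) auto
  have sub: "f \<in> Nvec n" if "f \<in> Nvec n'" for f using that by (simp add: Nvec_def Zvec_def n)
  have mono: "h f m \<le> h g m" if "f \<in> Nvec n" "g \<in> Nvec n" "lexless f g" for f g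
  proof -
    have Z: "h f \<in> Zvec (Suc m)" "h g \<in> Zvec (Suc m)" using Suc.prems(2) that by blast+
    from Suc.prems(3)[OF that] obtain x where x: "h f x < h g x" "\<forall>y>x. h f y = h g y"
      unfolding lexless_def by blast
    have "x \<le> m"
    proof (rule ccontr)
      assume "\<not> x \<le> m"
      then have "h f x = 0" "h g x = 0" using Z by (simp_all add: Zvec_def)
      with x(1) show False by simp
    qed
    with x show ?thesis by (cases "x = m") simp_all
  qed
  \<comment> \<open>The unit vector at the top coordinate lies above all of \<open>Nvec n'\<close>,
    so its image bounds the coordinate \<open>m\<close> of theirs.\<close>
  let ?e = "(\<lambda>_ :: nat. 0 :: int)(n' := 1)"
  have e: "?e \<in> Nvec n" by (simp add: Nvec_def Zvec_def n)
  have below: "h f m \<le> h ?e m" if "f \<in> Nvec n'" for f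
  proof (rule mono[OF sub[OF that] e])
    show "lexless f ?e" unfolding lexless_def
      using that by (intro exI[of _ n']) (simp add: Nvec_def Zvec_def)
  qed
  have "(\<lambda>_. 0) \<in> Nvec n'" by (simp add: Nvec_def Zvec_def)
  \<comment> \<open>The largest coordinate \<open>m\<close> over \<open>Nvec n'\<close>, obtained as
    the least distance to that bound.\<close>
  from ex_has_least_nat[of "\<lambda>f. f \<in> Nvec n'", OF this, of "\<lambda>f. nat (h ?e m - h f m)"]
  obtain v where v: "v \<in> Nvec n'"
    and v_least: "\<forall>f. f \<in> Nvec n' \<longrightarrow> nat (h ?e m - h v m) \<le> nat (h ?e m - h f m)"
    by blast
  have v_max: "h f m \<le> h v m" if "f \<in> Nvec n'" for f
    using v_least[rule_format, OF that] below[OF that] below[OF v] by linarith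
  have add: "(\<lambda>i. v i + f i) \<in> Nvec n'" if "f \<in> Nvec n'" for f
    using that v by (simp add: Nvec_def Zvec_def)
  have const: "h (\<lambda>i. v i + f i) m = h v m" if f: "f \<in> Nvec n'" for f
  proof (cases "f = (\<lambda>_. 0)")
    case False
    have "h v m \<le> h (\<lambda>i. v i + f i) m"
      by (rule mono[OF sub[OF v] sub[OF add[OF f]] lexless_add_Nvec[OF f False]])
    with v_max[OF add[OF f]] show ?thesis by simp
  qed simp
  let ?h = "\<lambda>f. (h (\<lambda>i. v i + f i))(m := 0)"
  show False
  proof (rule Suc.IH[of n' ?h])
    fix f assume f: "f \<in> Nvec n'"
    show "?h f \<in> Zvec m"
      using Suc.prems(2)[OF sub[OF add[OF f]]] by (auto simp: Zvec_def)
    fix g assume g: "g \<in> Nvec n'" and "lexless f g"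
    then have "lexless (\<lambda>i. v i + f i) (\<lambda>i. v i + g i)" by (simp add: lexless_def)
    from Suc.prems(3)[OF sub[OF add[OF f]] sub[OF add[OF g]] this]
    obtain x where x: "h (\<lambda>i. v i + f i) x < h (\<lambda>i. v i + g i) x"
      "\<forall>y>x. h (\<lambda>i. v i + f i) y = h (\<lambda>i. v i + g i) y"
      unfolding lexless_def by blast
    have "x \<noteq> m" using x(1) const[OF f] const[OF g] by auto
    with x show "lexless (?h f) (?h g)" unfolding lexless_def by (intro exI[of _ x]) simp
  qed (rule mn)
qed

lemma Zpow_strict:
  "(F, G) \<in> Zpow X \<and> F \<noteq> G \<longleftrightarrow> F \<in> Zpow_carrier X \<and> G \<in> Zpow_carrier X \<and>
     (\<exists>x. F x < G x \<and> (\<forall>y. F y \<noteq> G y \<longrightarrow> (y, x) \<in> X))"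
  by (auto simp: Zpow_def)

lemma well_order_sorted_list:
  assumes "Well_order r" "S \<subseteq> Field r" "finite S"
  shows "\<exists>zs. distinct zs \<and> set zs = S \<and> sorted_wrt (\<lambda>x y. (x, y) \<in> r - Id) zs"
proof (rule sorted_list_exists)
  show "wf (r - Id)" using assms(1) by (simp add: well_order_on_def)
  have "total_on (Field r) r" using assms(1) by (simp add: well_order_on_def linear_order_on_def)
  then show "(x, y) \<in> r - Id \<or> (y, x) \<in> r - Id" if "x \<in> S" "y \<in> S" "x \<noteq> y" for x y
    using that assms(2) by (auto simp: total_on_def)
qed (rule assms(3))

text \<open>Increasing enumerations of \<open>S\<close> and \<open>Field \<beta>\<close> turn \<phi>
  into a map of vectors as in \<open>no_strict_mono_Nvec_Zvec\<close>. Stating it for finite parts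
  \<open>S\<close> also covers an infinite \<alpha>.\<close>

lemma Zpow_strict_mono_card:
  fixes \<alpha> :: "'a rel" and \<beta> :: "'b rel"
  assumes \<alpha>: "Well_order \<alpha>" and \<beta>: "Well_order \<beta>" "finite (Field \<beta>)"
    and S: "S \<subseteq> Field \<alpha>" "finite S"
    and \<phi>: "\<And>F G. (F, G) \<in> Zpow \<alpha> \<Longrightarrow> F \<noteq> G \<Longrightarrow> (\<phi> F, \<phi> G) \<in> Zpow \<beta> \<and> \<phi> F \<noteq> \<phi> G"
  shows "card S \<le> card (Field \<beta>)"
proof (rule ccontr)
  assume "\<not> ?thesis"
  then have less: "card (Field \<beta>) < card S" by simp
  obtain zs where zs: "distinct zs" "set zs = S" "sorted_wrt (\<lambda>x y. (x, y) \<in> \<alpha> - Id) zs"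
    using well_order_sorted_list[OF \<alpha> S] by blast
  obtain ys where ys: "distinct ys" "set ys = Field \<beta>" "sorted_wrt (\<lambda>x y. (x, y) \<in> \<beta> - Id) ys"
    using well_order_sorted_list[OF \<beta>(1) subset_refl \<beta>(2)] by blast
  have refl: "refl_on (Field \<alpha>) \<alpha>" and anti: "antisym \<beta>"
    using \<alpha> \<beta>(1) by (simp_all add: well_order_on_def linear_order_on_def partial_order_on_def preorder_on_def)
  have len: "length zs = card S" "length ys = card (Field \<beta>)"
    using distinct_card[OF zs(1)] distinct_card[OF ys(1)] zs(2) ys(2) by simp_all
  define emb :: "(nat \<Rightarrow> int) \<Rightarrow> 'a \<Rightarrow> int" where
    "emb f x = (\<Sum>i<length zs. if zs ! i = x then f i else 0)" for f x
  have emb_nth: "emb f (zs ! i) = f i" if "i < length zs" for f i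
  proof -
    have "emb f (zs ! i) = (\<Sum>k<length zs. if k = i then f k else 0)"
      unfolding emb_def using that zs(1) by (intro sum.cong) (auto simp: nth_eq_iff_index_eq)
    then show ?thesis using that by simp
  qed
  have emb_out: "emb f x = 0" if "x \<notin> S" for f x
    unfolding emb_def using that zs(2) by (intro sum.neutral) auto
  have emb_carrier: "emb f \<in> Zpow_carrier \<alpha>" for f
  proof -
    have "{x. emb f x \<noteq> 0} \<subseteq> S" using emb_out by blast
    then show ?thesis using S finite_subset[of "{x. emb f x \<noteq> 0}" S] by (auto simp: Zpow_carrier_def)
  qed
  have emb_mono: "(emb f, emb g) \<in> Zpow \<alpha> \<and> emb f \<noteq> emb g"
    if fg: "f \<in> Nvec (card S)" "g \<in> Nvec (card S)" "lexless f g" for f g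
  proof -
    obtain i where i: "f i < g i" "\<forall>k>i. f k = g k" using fg(3) unfolding lexless_def by blast
    have il: "i < length zs"
    proof (rule ccontr)
      assume "\<not> i < length zs"
      then have "f i = 0" "g i = 0" using fg(1,2) len by (simp_all add: Nvec_def Zvec_def)
      with i(1) show False by simp
    qed
    have "(y, zs ! i) \<in> \<alpha>" if y: "emb f y \<noteq> emb g y" for y
    proof -
      have "y \<in> S" using y emb_out by metis
      then obtain k where k: "k < length zs" "y = zs ! k" using zs(2) by (auto simp: in_set_conv_nth)
      have "f k \<noteq> g k" using y k emb_nth by simp
      then have "k \<le> i" using i(2) by (metis not_le)
      moreover have "(zs ! i, zs ! i) \<in> \<alpha>"
        using refl S(1) zs(2) il nth_mem[of i zs] by (auto simp: refl_on_def)
      ultimately show ?thesis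
        using zs(3) k il by (cases "k = i") (auto simp: sorted_wrt_iff_nth_less)
    qed
    moreover have "emb f (zs ! i) < emb g (zs ! i)" using i(1) emb_nth[OF il] by simp
    ultimately show ?thesis unfolding Zpow_strict using emb_carrier by blast
  qed
  define prj :: "('b \<Rightarrow> int) \<Rightarrow> nat \<Rightarrow> int" where
    "prj F i = (if i < length ys then F (ys ! i) else 0)" for F i
  have prj_mono: "lexless (prj F) (prj G)" if FG: "(F, G) \<in> Zpow \<beta>" "F \<noteq> G" for F G
  proof -
    obtain x where x: "F x < G x" "\<And>y. F y \<noteq> G y \<Longrightarrow> (y, x) \<in> \<beta>"
      using FG Zpow_strict[of F G \<beta>] by blast
    have "x \<in> Field \<beta>" using x(2)[of x] x(1) by (auto intro: FieldI1)
    then obtain i where i: "i < length ys" "x = ys ! i" using ys(2) by (metis in_set_conv_nth)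
    have "F (ys ! k) = G (ys ! k)" if "k > i" "k < length ys" for k
    proof (rule ccontr)
      assume "F (ys ! k) \<noteq> G (ys ! k)"
      then have "(ys ! k, ys ! i) \<in> \<beta>" using x(2) i by blast
      moreover have "(ys ! i, ys ! k) \<in> \<beta> - Id" using ys(3) that i by (auto simp: sorted_wrt_iff_nth_less)
      ultimately show False using anti by (auto dest: antisymD)
    qed
    then show ?thesis using x(1) i unfolding lexless_def prj_def by (intro exI[of _ i]) simp
  qed
  show False
  proof (rule no_strict_mono_Nvec_Zvec[OF less, of "\<lambda>f. prj (\<phi> (emb f))"])
    show "prj (\<phi> (emb f)) \<in> Zvec (card (Field \<beta>))" for f by (simp add: Zvec_def prj_def len)
    show "lexless (prj (\<phi> (emb f))) (prj (\<phi> (emb g)))"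
      if "f \<in> Nvec (card S)" "g \<in> Nvec (card S)" "lexless f g" for f g
      using emb_mono[OF that] \<phi> prj_mono by blast
  qed
qed

lemma order_type_transfer:
  assumes "has_order_type G L" "has_order_type G K"
  shows "\<exists>\<phi>. \<forall>F H. (F, H) \<in> L \<and> F \<noteq> H \<longrightarrow> (\<phi> F, \<phi> H) \<in> K \<and> \<phi> F \<noteq> \<phi> H"
proof -
  obtain h where h: "bij_betw h (carrier G) (Field L)"
    "\<forall>a \<in> carrier G. \<forall>b \<in> carrier G. (a, b) \<in> le_rel G \<longleftrightarrow> (h a, h b) \<in> L"
    using assms(1) unfolding has_order_type_def by blast
  obtain k where k: "bij_betw k (carrier G) (Field K)"
    "\<forall>a \<in> carrier G. \<forall>b \<in> carrier G. (a, b) \<in> le_rel G \<longleftrightarrow> (k a, k b) \<in> K"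
    using assms(2) unfolding has_order_type_def by blast
  define \<phi> where "\<phi> F = k (inv_into (carrier G) h F)" for F
  have "(\<phi> F, \<phi> H) \<in> K \<and> \<phi> F \<noteq> \<phi> H" if FH: "(F, H) \<in> L" "F \<noteq> H" for F H
  proof -
    have "F \<in> h ` carrier G" "H \<in> h ` carrier G"
      using FieldI1[OF FH(1)] FieldI2[OF FH(1)] bij_betw_imp_surj_on[OF h(1)] by simp_all
    then obtain a b where ab: "a \<in> carrier G" "b \<in> carrier G" "F = h a" "H = h b" by blast
    then have "\<phi> F = k a" "\<phi> H = k b"
      using inv_into_f_f[OF bij_betw_imp_inj_on[OF h(1)]] by (simp_all add: \<phi>_def)
    moreover have "a \<noteq> b" using ab FH by blast
    then have "k a \<noteq> k b"
      using ab(1,2) inj_on_eq_iff[OF bij_betw_imp_inj_on[OF k(1)]] by simp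
    moreover have "(k a, k b) \<in> K" using ab FH h(2) k(2) by blast
    ultimately show ?thesis by simp
  qed
  then show ?thesis by (intro exI[of _ \<phi>]) simp
qed

text \<open>A solution of \<open>OG_alpha0\<close> may belong to any \<alpha> that fits the group.
  For a group of finite exponent this leaves only one size.\<close>

lemma order_type_Zpow_card:
  fixes \<alpha> :: "'a rel" and \<beta> :: "'b rel"
  assumes \<alpha>: "Well_order \<alpha>" "has_order_type G (Zpow \<alpha>)"
    and \<beta>: "Well_order \<beta>" "has_order_type G (Zpow \<beta>)" "finite (Field \<beta>)"
  shows "finite (Field \<alpha>) \<and> card (Field \<alpha>) = card (Field \<beta>)"
proof -
  obtain \<phi> where "\<forall>F H. (F, H) \<in> Zpow \<alpha> \<and> F \<noteq> H \<longrightarrow> (\<phi> F, \<phi> H) \<in> Zpow \<beta> \<and> \<phi> F \<noteq> \<phi> H"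
    using order_type_transfer[OF \<alpha>(2) \<beta>(2)] by (elim exE)
  note \<phi> = this[rule_format, OF conjI]
  obtain \<psi> where "\<forall>F H. (F, H) \<in> Zpow \<beta> \<and> F \<noteq> H \<longrightarrow> (\<psi> F, \<psi> H) \<in> Zpow \<alpha> \<and> \<psi> F \<noteq> \<psi> H"
    using order_type_transfer[OF \<beta>(2) \<alpha>(2)] by (elim exE)
  note \<psi> = this[rule_format, OF conjI]
  have le: "card S \<le> card (Field \<beta>)" if "S \<subseteq> Field \<alpha>" "finite S" for S
    by (rule Zpow_strict_mono_card[OF \<alpha>(1) \<beta>(1,3) that \<phi>])
  have fin: "finite (Field \<alpha>)"
  proof (rule ccontr)
    assume "infinite (Field \<alpha>)"
    from infinite_arbitrarily_large[OF this, of "Suc (card (Field \<beta>))"]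
    obtain S where "finite S" "card S = Suc (card (Field \<beta>))" "S \<subseteq> Field \<alpha>" by blast
    with le[of S] show False by simp
  qed
  have "card (Field \<beta>) \<le> card (Field \<alpha>)"
    by (rule Zpow_strict_mono_card[OF \<beta>(1) \<alpha>(1) fin subset_refl \<beta>(3) \<psi>])
  with le[OF subset_refl fin] fin show ?thesis by simp
qed


section \<open>Ordered groups coded by integer vectors\<close>

lemma lexless_irrefl: "\<not> lexless f f"
  by (simp add: lexless_def)

lemma lexless_trans:
  assumes "lexless f g" "lexless g h" shows "lexless f h"
proof -
  obtain x where x: "f x < g x" "\<forall>y>x. f y = g y" using assms(1) unfolding lexless_def by blast
  obtain z where z: "g z < h z" "\<forall>y>z. g y = h y" using assms(2) unfolding lexless_def by blast
  have above: "f y = h y" if "x < y" "z < y" for y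
    using x(2)[rule_format, OF that(1)] z(2)[rule_format, OF that(2)] by (rule trans)
  consider "x < z" | "x = z" | "z < x" by (rule linorder_cases)
  then show ?thesis
  proof cases
    assume xz: "x < z"
    have "f z < h z" using z(1) unfolding x(2)[rule_format, OF xz] .
    then show ?thesis using above xz unfolding lexless_def by (intro exI[of _ z]) simp
  next
    assume xz: "x = z"
    have "f z < h z" using x(1) z(1) unfolding xz by (rule less_trans)
    then show ?thesis using above xz unfolding lexless_def by (intro exI[of _ z]) simp
  next
    assume zx: "z < x"
    have "f x < h x" using x(1) unfolding z(2)[rule_format, OF zx] .
    then show ?thesis using above zx unfolding lexless_def by (intro exI[of _ x]) simp
  qed
qed

lemma lexless_linear:
  assumes "f \<in> Zvec n" "g \<in> Zvec n" "f \<noteq> g" shows "lexless f g \<or> lexless g f"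
proof -
  define S where "S = {i. f i \<noteq> g i}"
  have "S \<subseteq> {..<n}"
  proof
    fix i assume "i \<in> S"
    then show "i \<in> {..<n}" using assms(1,2) by (cases "n \<le> i") (simp_all add: S_def Zvec_def)
  qed
  then have fin: "finite S" by (rule finite_subset) simp
  have ne: "S \<noteq> {}" using assms(3) by (auto simp: S_def)
  define k where "k = Max S"
  have "k \<in> S" unfolding k_def by (rule Max_in[OF fin ne])
  then have "f k < g k \<or> g k < f k" by (simp add: S_def neq_iff)
  moreover have above: "\<forall>y>k. f y = g y"
  proof (intro allI impI)
    fix y assume "y > k"
    show "f y = g y"
    proof (rule ccontr)
      assume "f y \<noteq> g y"
      then have "y \<le> k" unfolding k_def by (intro Max_ge[OF fin]) (simp add: S_def)
      with \<open>y > k\<close> show False by simp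
    qed
  qed
  moreover have "\<forall>y>k. g y = f y" using above by simp
  ultimately show ?thesis unfolding lexless_def by blast
qed

lemma lexless_add: "lexless f g \<Longrightarrow> lexless (\<lambda>i. f i + v i) (\<lambda>i. g i + v i)"
  by (simp add: lexless_def)

section \<open>Powers with a finite exponent as integer vectors\<close>

lemma Zpow_carrier_natLeq_on: "Zpow_carrier (natLeq_on n) = Zvec n"
proof -
  have "{x. f x \<noteq> 0} \<subseteq> {x. x < n} \<longleftrightarrow> f \<in> Zvec n" for f :: "nat \<Rightarrow> int"
  proof
    assume f: "{x. f x \<noteq> 0} \<subseteq> {x. x < n}"
    have "f i = 0" if "n \<le> i" for i using f that by (cases "f i = 0") auto
    then show "f \<in> Zvec n" by (simp add: Zvec_def)
  next
    assume f: "f \<in> Zvec n"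
    have "i < n" if "f i \<noteq> 0" for i using f that by (cases "n \<le> i") (simp_all add: Zvec_def)
    then show "{x. f x \<noteq> 0} \<subseteq> {x. x < n}" by blast
  qed
  moreover have "finite {x. f x \<noteq> 0}" if "{x. f x \<noteq> 0} \<subseteq> {x. x < n}" for f :: "nat \<Rightarrow> int"
    using that by (rule finite_subset) simp
  ultimately show ?thesis unfolding Zpow_carrier_def Field_natLeq_on by blast
qed

lemma Zpow_natLeq_on:
  "(f, g) \<in> Zpow (natLeq_on n) \<longleftrightarrow> f \<in> Zvec n \<and> g \<in> Zvec n \<and> (f = g \<or> lexless f g)"
proof -
  have "(\<exists>x. f x < g x \<and> (\<forall>y. f y \<noteq> g y \<longrightarrow> (y, x) \<in> natLeq_on n)) \<longleftrightarrow> lexless f g"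
    if fg: "f \<in> Zvec n" "g \<in> Zvec n"
  proof
    assume "\<exists>x. f x < g x \<and> (\<forall>y. f y \<noteq> g y \<longrightarrow> (y, x) \<in> natLeq_on n)"
    then obtain x where x: "f x < g x" "\<forall>y. f y \<noteq> g y \<longrightarrow> (y, x) \<in> natLeq_on n" by blast
    have "f y = g y" if "y > x" for y
    proof (rule ccontr)
      assume "f y \<noteq> g y"
      with x(2) have "(y, x) \<in> natLeq_on n" by blast
      with that show False by simp
    qed
    with x(1) show "lexless f g" unfolding lexless_def by blast
  next
    assume "lexless f g"
    then obtain x where x: "f x < g x" "\<forall>y>x. f y = g y" unfolding lexless_def by blast
    have small: "y < n" if "f y \<noteq> g y" for y
      using fg that by (cases "n \<le> y") (simp_all add: Zvec_def)
    have "(y, x) \<in> natLeq_on n" if "f y \<noteq> g y" for y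
    proof -
      have "y \<le> x" using x(2) that by (metis not_le)
      then show ?thesis using small[OF that] small[of x] x(1) by simp
    qed
    with x(1) show "\<exists>x. f x < g x \<and> (\<forall>y. f y \<noteq> g y \<longrightarrow> (y, x) \<in> natLeq_on n)" by blast
  qed
  then show ?thesis unfolding Zpow_def Zpow_carrier_natLeq_on by blast
qed

text \<open>Transport of structure: \<phi> carries the coded operation and order to pointwise
  addition and the lexicographic order, so the axioms are checked on images.\<close>

lemma coded_ogroup_Zvec:
  fixes A :: "nat set" and u :: baire and \<phi> :: "nat \<Rightarrow> nat \<Rightarrow> int"
  assumes bij: "bij_betw \<phi> A (Zvec n)"
    and op: "\<And>a b. a \<in> A \<Longrightarrow> b \<in> A \<Longrightarrow>
      u (prod_encode (a, b)) \<in> A \<and> \<phi> (u (prod_encode (a, b))) = (\<lambda>i. \<phi> a i + \<phi> b i)"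
    and R: "R = {(a, b). a \<in> A \<and> b \<in> A \<and> (a = b \<or> lexless (\<phi> a) (\<phi> b))}"
  shows "ordered_group (coded_ogroup A u R)"
    and "has_order_type (coded_ogroup A u R) (Zpow (natLeq_on n))"
proof -
  let ?G = "coded_ogroup A u R"
  have inj: "a = b" if "a \<in> A" "b \<in> A" "\<phi> a = \<phi> b" for a b
    using inj_onD[OF bij_betw_imp_inj_on[OF bij] that(3,1,2)] .
  have Z: "\<phi> a \<in> Zvec n" if "a \<in> A" for a using bij that by (rule bij_betw_apply)
  have surj: "\<exists>a\<in>A. \<phi> a = v" if "v \<in> Zvec n" for v
    using bij_betw_imp_surj_on[OF bij] that by (metis imageE)
  have "(\<lambda>_. 0) \<in> Zvec n" by (simp add: Zvec_def)
  then obtain e where e: "e \<in> A" "\<phi> e = (\<lambda>_. 0)" using surj by blast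
  have one: "one ?G = e"
    unfolding coded_ogroup_def monoid.simps partial_object.simps
  proof (rule the_equality)
    have "u (prod_encode (e, x)) = x \<and> u (prod_encode (x, e)) = x" if "x \<in> A" for x
      using inj[of "u (prod_encode (e, x))" x] inj[of "u (prod_encode (x, e))" x]
        op[OF e(1) that] op[OF that e(1)] that by (simp add: e(2))
    then show "e \<in> A \<and> (\<forall>x\<in>A. u (prod_encode (e, x)) = x \<and> u (prod_encode (x, e)) = x)"
      using e(1) by blast
    then show "e' = e"
      if "e' \<in> A \<and> (\<forall>x\<in>A. u (prod_encode (e', x)) = x \<and> u (prod_encode (x, e')) = x)" for e'
      using that by metis
  qed
  have carrier: "carrier ?G = A" and le: "le_rel ?G = R" by (simp_all add: coded_ogroup_def)
  have mult: "a \<otimes>\<^bsub>?G\<^esub> b \<in> A" "\<phi> (a \<otimes>\<^bsub>?G\<^esub> b) = (\<lambda>i. \<phi> a i + \<phi> b i)" if "a \<in> A" "b \<in> A" for a b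
    using op[OF that] that by (simp_all add: coded_ogroup_def)
  have group: "group ?G"
  proof (rule groupI; unfold carrier one)
    show "a \<otimes>\<^bsub>?G\<^esub> b \<in> A" if "a \<in> A" "b \<in> A" for a b by (rule mult(1)[OF that])
    show "e \<in> A" by (rule e(1))
    show "a \<otimes>\<^bsub>?G\<^esub> b \<otimes>\<^bsub>?G\<^esub> c = a \<otimes>\<^bsub>?G\<^esub> (b \<otimes>\<^bsub>?G\<^esub> c)" if "a \<in> A" "b \<in> A" "c \<in> A" for a b c
      by (rule inj) (simp_all add: mult that add.assoc)
    show "e \<otimes>\<^bsub>?G\<^esub> a = a" if "a \<in> A" for a
      by (rule inj) (simp_all add: mult that e)
    show "\<exists>b\<in>A. b \<otimes>\<^bsub>?G\<^esub> a = e" if a: "a \<in> A" for a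
    proof -
      have "(\<lambda>i. - \<phi> a i) \<in> Zvec n" using Z[OF a] by (simp add: Zvec_def)
      then obtain b where b: "b \<in> A" "\<phi> b = (\<lambda>i. - \<phi> a i)" using surj by blast
      have "b \<otimes>\<^bsub>?G\<^esub> a = e" by (rule inj) (simp_all add: mult a b e)
      with b(1) show ?thesis by blast
    qed
  qed
  have lin: "linear_order_on A R"
    unfolding linear_order_on_def partial_order_on_def preorder_on_def
  proof (intro conjI)
    show "R \<subseteq> A \<times> A" unfolding R by blast
    show "refl_on A R" unfolding R refl_on_def by blast
    show "trans R" unfolding R by (rule transI) (use lexless_trans in blast)
    show "antisym R"
    proof (rule antisymI, rule ccontr)
      fix a b assume "(a, b) \<in> R" "(b, a) \<in> R" "a \<noteq> b"
      then have "lexless (\<phi> a) (\<phi> b)" "lexless (\<phi> b) (\<phi> a)" unfolding R by blast+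
      from lexless_trans[OF this] show False using lexless_irrefl by blast
    qed
    show "total_on A R"
      unfolding total_on_def R using lexless_linear[OF Z Z] inj by blast
  qed
  have R_iff: "(x, y) \<in> R \<longleftrightarrow> x \<in> A \<and> y \<in> A \<and> (x = y \<or> lexless (\<phi> x) (\<phi> y))" for x y
    by (simp add: R)
  have compat: "(a \<otimes>\<^bsub>?G\<^esub> g, b \<otimes>\<^bsub>?G\<^esub> g) \<in> R \<and> (g \<otimes>\<^bsub>?G\<^esub> a, g \<otimes>\<^bsub>?G\<^esub> b) \<in> R"
    if abg: "a \<in> A" "b \<in> A" "g \<in> A" and "(a, b) \<in> R" for a b g
  proof (cases "a = b")
    case True
    then show ?thesis using mult(1) abg by (simp add: R_iff)
  next
    case False
    then have "lexless (\<phi> a) (\<phi> b)" using that(4) by (simp add: R_iff)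
    from lexless_add[OF this, of "\<phi> g"] show ?thesis
      using abg by (simp add: R_iff mult add.commute[of "\<phi> g _"])
  qed
  show "ordered_group ?G"
    unfolding ordered_group_def carrier le using group lin compat by blast
  show "has_order_type ?G (Zpow (natLeq_on n))"
    unfolding has_order_type_def carrier le Field_Zpow Zpow_carrier_natLeq_on
  proof (intro exI conjI ballI)
    show "bij_betw \<phi> A (Zvec n)" by (rule bij)
    fix a b assume ab: "a \<in> A" "b \<in> A"
    have "a = b \<longleftrightarrow> \<phi> a = \<phi> b" using inj ab by blast
    then show "(a, b) \<in> R \<longleftrightarrow> (\<phi> a, \<phi> b) \<in> Zpow (natLeq_on n)"
      unfolding Zpow_natLeq_on R using ab Z by blast
  qed
qed


section \<open>Mixed-radix digit sequences\<close>

text \<open>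
  The value is meaningful only for \<open>j\<close> not below the minimum of \<open>p\<close>.
\<close>

definition threshold :: "baire \<Rightarrow> nat \<Rightarrow> nat" where
  "threshold p j = (LEAST t. p t \<le> j)"

definition radix :: "baire \<Rightarrow> nat \<Rightarrow> int" where
  "radix p j = 2 * int (threshold p j) + 1"

text \<open>The leading position \<open>p 0\<close> is exempt from the bound, because the value of
  the upper digits has to range over all integers. Below the minimum the bound holds for every
  integer, as \<open>j < p t\<close> for all \<open>t\<close>.\<close>

definition digits :: "baire \<Rightarrow> (nat \<Rightarrow> int) set" where
  "digits p = {c \<in> Zvec (Suc (p 0)). \<forall>j<p 0. \<forall>t. int t < \<bar>c j\<bar> \<longrightarrow> j < p t}"

text \<open>
  The recursion counts positions from the top: \<open>upper_value p c (p 0 - j)\<close> is the value of the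
  digits at the positions \<open>j, \<dots>, p 0\<close>.
\<close>

primrec upper_value :: "baire \<Rightarrow> (nat \<Rightarrow> int) \<Rightarrow> nat \<Rightarrow> int" where
  "upper_value p c 0 = c (p 0)"
| "upper_value p c (Suc k) =
     c (p 0 - Suc k) + radix p (p 0 - Suc k) * upper_value p c k"

definition min_val :: "baire \<Rightarrow> nat" where
  "min_val p = (LEAST m. m \<in> range p)"

definition digits_value :: "baire \<Rightarrow> (nat \<Rightarrow> int) \<Rightarrow> nat \<Rightarrow> int" where
  "digits_value p c i =
     (if i < min_val p then c i
      else if i = min_val p then upper_value p c (p 0 - min_val p) else 0)"

lemma min_val_le: "min_val p \<le> p t"
  unfolding min_val_def by (rule Least_le) simp

lemma min_val_attained: "\<exists>t. p t = min_val p"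
proof -
  have "min_val p \<in> range p" unfolding min_val_def by (rule LeastI[of _ "p 0"]) simp
  then show ?thesis by auto
qed

lemma threshold_props:
  assumes "min_val p \<le> j"
  shows "p (threshold p j) \<le> j" and "t < threshold p j \<Longrightarrow> j < p t"
proof -
  obtain t0 where "p t0 = min_val p" using min_val_attained by blast
  with assms have "p t0 \<le> j" by simp
  then show "p (threshold p j) \<le> j" unfolding threshold_def by (rule LeastI)
  show "t < threshold p j \<Longrightarrow> j < p t"
    unfolding threshold_def using not_less_Least[of t "\<lambda>t. p t \<le> j"] by simp
qed

lemma digits_bound:
  assumes "c \<in> digits p" "min_val p \<le> j" "j < p 0"
  shows "\<bar>c j\<bar> \<le> int (threshold p j)"
proof (rule ccontr)
  assume "\<not> ?thesis"
  then have "j < p (threshold p j)" using assms by (simp add: digits_def)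
  with threshold_props(1)[OF assms(2)] show False by simp
qed

lemma upper_value_step:
  assumes "j < p 0"
  shows "upper_value p c (p 0 - j) = c j + radix p j * upper_value p c (p 0 - Suc j)"
proof -
  have "p 0 - j = Suc (p 0 - Suc j)" "p 0 - Suc (p 0 - Suc j) = j" using assms by simp_all
  then show ?thesis by (metis upper_value.simps(2))
qed

lemma upper_value_cong:
  assumes "\<And>i. j \<le> i \<Longrightarrow> i \<le> p 0 \<Longrightarrow> c i = d i" "k \<le> p 0 - j" "j \<le> p 0"
  shows "upper_value p c k = upper_value p d k"
  using assms(2)
proof (induction k)
  case 0
  show ?case using assms(1)[OF assms(3)] by simp
next
  case (Suc k)
  then have "c (p 0 - Suc k) = d (p 0 - Suc k)" by (intro assms(1)) simp_all
  with Suc show ?case by simp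
qed

text \<open>Two digits differ by at most \<open>2 * t\<close>, one less than the base, so the larger
  upper part decides.\<close>

lemma balanced_less:
  fixes x y u v :: int
  assumes "\<bar>x\<bar> \<le> t" "\<bar>y\<bar> \<le> t" "u < v"
  shows "x + (2 * t + 1) * u < y + (2 * t + 1) * v"
proof -
  have "(2 * t + 1) * (u + 1) \<le> (2 * t + 1) * v"
    using assms by (intro mult_left_mono) simp_all
  then show ?thesis using assms(1,2) by (simp add: algebra_simps)
qed

text \<open>Downward induction from the highest differing digit: \<open>balanced_less\<close> takes
  the strict inequality past each lower position.\<close>

lemma upper_value_less:
  assumes cd: "c \<in> digits p" "d \<in> digits p" and x: "c x < d x" "\<forall>y>x. c y = d y" "x \<le> p 0"
    and "min_val p \<le> j" "j \<le> x"
  shows "upper_value p c (p 0 - j) < upper_value p d (p 0 - j)"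
  using assms(7,6)
proof (induction j rule: inc_induct)
  case base
  show ?case
  proof (cases "x = p 0")
    case True
    with x(1) show ?thesis by simp
  next
    case False
    with x(3) have less: "x < p 0" by simp
    have "upper_value p c (p 0 - Suc x) = upper_value p d (p 0 - Suc x)"
      by (rule upper_value_cong[of "Suc x"]) (use x(2) less in simp_all)
    then show ?thesis using x(1) by (simp add: upper_value_step[of x p, OF less])
  qed
next
  case (step j)
  then have j: "j < p 0" "min_val p \<le> j" "min_val p \<le> Suc j" using x(3) by simp_all
  show ?case
    unfolding upper_value_step[of j p, OF j(1)] radix_def
    by (intro balanced_less digits_bound[OF cd(1) j(2,1)] digits_bound[OF cd(2) j(2,1)] step.IH j(3))
qed

lemma digits_value_mono:
  assumes cd: "c \<in> digits p" "d \<in> digits p" and "lexless c d"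
  shows "lexless (digits_value p c) (digits_value p d)"
proof -
  let ?m = "min_val p"
  have m: "?m \<le> p 0" by (rule min_val_le)
  obtain x where x: "c x < d x" "\<forall>y>x. c y = d y" using assms(3) unfolding lexless_def by blast
  have xle: "x \<le> p 0"
  proof (rule ccontr)
    assume "\<not> x \<le> p 0"
    then have "c x = 0" "d x = 0" using cd by (simp_all add: digits_def Zvec_def)
    with x(1) show False by simp
  qed
  show ?thesis
  proof (cases "x < ?m")
    case True
    have "upper_value p c (p 0 - ?m) = upper_value p d (p 0 - ?m)"
      by (rule upper_value_cong[of ?m]) (use x(2) True m in simp_all)
    then show ?thesis unfolding lexless_def digits_value_def
      using True x by (intro exI[of _ x]) simp
  next
    case False
    then have "upper_value p c (p 0 - ?m) < upper_value p d (p 0 - ?m)"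
      by (intro upper_value_less[OF cd x xle]) simp_all
    then show ?thesis unfolding lexless_def digits_value_def by (intro exI[of _ ?m]) simp
  qed
qed

lemma digits_value_Zvec: "digits_value p c \<in> Zvec (Suc (min_val p))"
  by (simp add: Zvec_def digits_value_def)

lemma lexless_digits_value_iff:
  assumes "c \<in> digits p" "d \<in> digits p"
  shows "lexless (digits_value p c) (digits_value p d) \<longleftrightarrow> lexless c d"
proof
  assume l: "lexless (digits_value p c) (digits_value p d)"
  have "c \<noteq> d" using l lexless_irrefl by blast
  then have "lexless c d \<or> lexless d c"
    using assms by (intro lexless_linear[of _ "Suc (p 0)"]) (simp_all add: digits_def)
  moreover have "\<not> lexless d c"
    using digits_value_mono[OF assms(2,1)] lexless_trans[OF l] lexless_irrefl by blast
  ultimately show "lexless c d" by blast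
qed (rule digits_value_mono[OF assms])

lemma digits_value_inj:
  assumes "c \<in> digits p" "d \<in> digits p" "digits_value p c = digits_value p d"
  shows "c = d"
proof (rule ccontr)
  assume "c \<noteq> d"
  then have "lexless c d \<or> lexless d c"
    using assms by (intro lexless_linear[of _ "Suc (p 0)"]) (simp_all add: digits_def)
  then have "lexless (digits_value p c) (digits_value p d) \<or> lexless (digits_value p d) (digits_value p c)"
    using digits_value_mono assms(1,2) by blast
  then show False using assms(3) lexless_irrefl by simp
qed

text \<open>Division of \<open>z + t\<close> with remainder, the remainder then shifted back by
  \<open>t\<close>.\<close>

lemma balanced_division:
  fixes z :: int
  assumes "0 \<le> t" obtains q r where "z = r + (2 * t + 1) * q" "\<bar>r\<bar> \<le> t"
proof
  let ?F = "2 * t + 1"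
  show "z = ((z + t) mod ?F - t) + ?F * ((z + t) div ?F)"
    using mult_div_mod_eq[of ?F "z + t"] by linarith
  have "0 \<le> (z + t) mod ?F" "(z + t) mod ?F < ?F"
    using assms by (intro pos_mod_sign pos_mod_bound; simp)+
  then show "\<bar>(z + t) mod ?F - t\<bar> \<le> t" by linarith
qed

text \<open>Repeated balanced division; the last quotient becomes the unrestricted leading
  digit.\<close>

lemma upper_value_surj:
  assumes "k \<le> p 0 - min_val p"
  shows "\<exists>c. (\<forall>j<p 0. p 0 - k \<le> j \<longrightarrow> \<bar>c j\<bar> \<le> int (threshold p j)) \<and> upper_value p c k = z"
  using assms
proof (induction k arbitrary: z)
  case 0
  show ?case by (rule exI[of _ "\<lambda>_. z"]) simp
next
  case (Suc k)
  define j where "j = p 0 - Suc k"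
  have j: "j < p 0" "p 0 - k = Suc j" using Suc.prems by (simp_all add: j_def)
  obtain q r where qr: "z = r + (2 * int (threshold p j) + 1) * q" "\<bar>r\<bar> \<le> int (threshold p j)"
    by (rule balanced_division[of "int (threshold p j)" z]) simp_all
  obtain c where c: "\<forall>i<p 0. p 0 - k \<le> i \<longrightarrow> \<bar>c i\<bar> \<le> int (threshold p i)" "upper_value p c k = q"
    using Suc.IH[of q] Suc.prems by auto
  have "upper_value p (c(j := r)) k = upper_value p c k"
    by (rule upper_value_cong[of "Suc j"]) (use j in simp_all)
  then have "upper_value p (c(j := r)) (Suc k) = z"
    by (simp add: c(2) qr(1) radix_def flip: j_def)
  moreover have "\<bar>(c(j := r)) i\<bar> \<le> int (threshold p i)" if "i < p 0" "j \<le> i" for i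
    using that c(1) qr(2) j(2) by (cases "i = j") simp_all
  ultimately show ?case unfolding j_def[symmetric] by blast
qed

lemma digits_value_bij: "bij_betw (digits_value p) (digits p) (Zvec (Suc (min_val p)))"
proof (rule bij_betw_imageI)
  show "inj_on (digits_value p) (digits p)" by (rule inj_onI) (rule digits_value_inj)
  show "digits_value p ` digits p = Zvec (Suc (min_val p))"
  proof (intro equalityI subsetI)
    fix v assume "v \<in> digits_value p ` digits p"
    then show "v \<in> Zvec (Suc (min_val p))" using digits_value_Zvec by blast
  next
    fix v assume v: "v \<in> Zvec (Suc (min_val p))"
    let ?m = "min_val p"
    have m: "?m \<le> p 0" by (rule min_val_le)
    obtain c where c: "\<forall>j<p 0. p 0 - (p 0 - ?m) \<le> j \<longrightarrow> \<bar>c j\<bar> \<le> int (threshold p j)"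
      "upper_value p c (p 0 - ?m) = v ?m"
      using upper_value_surj[of "p 0 - ?m" p "v ?m"] by auto
    define d where "d = (\<lambda>i. if i < ?m then v i else if i \<le> p 0 then c i else 0)"
    have "d \<in> digits p"
      unfolding digits_def
    proof (intro CollectI conjI allI impI)
      show "d \<in> Zvec (Suc (p 0))" using m by (simp add: d_def Zvec_def)
      fix j t assume jt: "j < p 0" "int t < \<bar>d j\<bar>"
      show "j < p t"
      proof (cases "j < ?m")
        case True
        then show ?thesis using min_val_le[of p t] by simp
      next
        case False
        then have "\<bar>d j\<bar> \<le> int (threshold p j)" using c(1) m jt(1) by (simp add: d_def)
        with jt(2) have "t < threshold p j" by simp
        then show ?thesis using threshold_props(2)[of p j t] False by simp
      qed
    qed
    moreover have "upper_value p d (p 0 - ?m) = upper_value p c (p 0 - ?m)"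
      by (rule upper_value_cong[of ?m]) (use m in \<open>simp_all add: d_def\<close>)
    then have "digits_value p d = v"
      using v c(2) by (intro ext) (simp add: digits_value_def d_def Zvec_def)
    ultimately show "v \<in> digits_value p ` digits p" by blast
  qed
qed

section \<open>Addition with carries\<close>

text \<open>
  \<open>k j\<close> is the carry into position \<open>j\<close>, and \<open>t j\<close> is the threshold at \<open>j\<close> if there is a carry
  out of position \<open>j\<close>; the thresholds are arguments because not all of them exist.
\<close>

definition carry_sum ::
    "baire \<Rightarrow> (nat \<Rightarrow> int) \<Rightarrow> (nat \<Rightarrow> int) \<Rightarrow> (nat \<Rightarrow> int) \<Rightarrow>
      (nat \<Rightarrow> int) \<Rightarrow> (nat \<Rightarrow> nat) \<Rightarrow> bool" where
  "carry_sum p a b c k t \<longleftrightarrow> k 0 = 0 \<and> a (p 0) + b (p 0) + k (p 0) = c (p 0) \<and>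
     (\<forall>j<p 0. k (Suc j) = 0 \<and> a j + b j + k j = c j \<or>
        p (t j) \<le> j \<and> (\<forall>s<t j. j < p s) \<and> a j + b j + k j = c j + (2 * int (t j) + 1) * k (Suc j))"

text \<open>Below the minimum no \<open>t j\<close> satisfies \<open>p (t j) \<le> j\<close>, so no
  carry leaves these positions. From the minimum on, a witness \<open>t j\<close> is the true
  threshold, and in the other alternative the outgoing carry is 0, which is consistent with any
  radix.\<close>

lemma carry_sum_sound:
  assumes sum: "carry_sum p a b c k t"
  shows "digits_value p c = (\<lambda>i. digits_value p a i + digits_value p b i)"
proof -
  let ?m = "min_val p"
  have m: "?m \<le> p 0" by (rule min_val_le)
  have low: "k (Suc j) = 0 \<and> a j + b j + k j = c j" if "j < ?m" for j
  proof -
    have "\<not> p (t j) \<le> j" using min_val_le[of p "t j"] that by simp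
    then show ?thesis using sum that m unfolding carry_sum_def by (metis less_le_trans)
  qed
  have k0: "k j = 0" if "j \<le> ?m" for j
    using that low sum unfolding carry_sum_def by (cases j) auto
  have high: "a j + b j + k j = c j + radix p j * k (Suc j)" if "j < p 0" "?m \<le> j" for j
  proof -
    have "k (Suc j) = 0 \<and> a j + b j + k j = c j \<or>
        p (t j) \<le> j \<and> (\<forall>s<t j. j < p s) \<and> a j + b j + k j = c j + (2 * int (t j) + 1) * k (Suc j)"
      using sum that(1) unfolding carry_sum_def by simp
    then consider "k (Suc j) = 0" "a j + b j + k j = c j"
      | "p (t j) \<le> j" "\<forall>s<t j. j < p s" "a j + b j + k j = c j + (2 * int (t j) + 1) * k (Suc j)"
      by blast
    then show ?thesis
    proof cases
      case 2
      have "threshold p j = t j"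
        unfolding threshold_def
      proof (rule Least_equality)
        show "p (t j) \<le> j" by (rule 2)
        show "t j \<le> s" if "p s \<le> j" for s using 2(2) that by (metis not_le)
      qed
      with 2(3) show ?thesis by (simp add: radix_def)
    qed simp
  qed
  have upper: "upper_value p c (p 0 - j) = upper_value p a (p 0 - j) + upper_value p b (p 0 - j) + k j"
    if "j \<le> p 0" "?m \<le> j" for j
    using that
  proof (induction j rule: inc_induct)
    case base
    show ?case using sum by (simp add: carry_sum_def)
  next
    case (step j)
    then have IH: "upper_value p c (p 0 - Suc j)
      = upper_value p a (p 0 - Suc j) + upper_value p b (p 0 - Suc j) + k (Suc j)" by simp
    show ?case
      unfolding upper_value_step[of j p, OF step.hyps(2)] IH
      using high[OF step.hyps(2) step.prems] by (simp add: distrib_left)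
  qed
  show ?thesis
    using upper[OF m order_refl] k0[of ?m] low k0
    by (intro ext) (simp add: digits_value_def)
qed

text \<open>The carry into \<open>j\<close> is forced: it is the excess of the value of
  \<open>c\<close> from \<open>j\<close> on over the values of \<open>a\<close> and \<open>b\<close>
  from \<open>j\<close> on.\<close>

lemma carry_sum_exists:
  assumes val: "digits_value p c = (\<lambda>i. digits_value p a i + digits_value p b i)"
  shows "carry_sum p a b c
    (\<lambda>j. if j \<le> min_val p then 0
      else upper_value p c (p 0 - j) - upper_value p a (p 0 - j) - upper_value p b (p 0 - j))
    (threshold p)"
    (is "carry_sum p a b c ?k _")
proof -
  let ?m = "min_val p"
  have m: "?m \<le> p 0" by (rule min_val_le)
  have low: "c j = a j + b j" if "j < ?m" for j
    using fun_cong[OF val, of j] that by (simp add: digits_value_def)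
  have mid: "upper_value p c (p 0 - ?m) = upper_value p a (p 0 - ?m) + upper_value p b (p 0 - ?m)"
    using fun_cong[OF val, of ?m] by (simp add: digits_value_def)
  define k where "k = ?k"
  have k: "k j = upper_value p c (p 0 - j) - upper_value p a (p 0 - j) - upper_value p b (p 0 - j)"
    if "?m \<le> j" for j
    using that mid by (cases "j = ?m") (simp_all add: k_def)
  have last: "a (p 0) + b (p 0) + k (p 0) = c (p 0)" using k[OF m] by simp
  have "k (Suc j) = 0 \<and> a j + b j + k j = c j \<or>
        p (threshold p j) \<le> j \<and> (\<forall>s<threshold p j. j < p s) \<and>
        a j + b j + k j = c j + (2 * int (threshold p j) + 1) * k (Suc j)" if j: "j < p 0" for j
  proof (cases "j < ?m")
    case True
    then show ?thesis using low by (simp add: k_def)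
  next
    case False
    then have mj: "?m \<le> j" "?m \<le> Suc j" by simp_all
    have "a j + b j + k j = c j + radix p j * k (Suc j)"
      unfolding k[OF mj(1)] k[OF mj(2)] upper_value_step[of j p, OF j] by (simp add: algebra_simps)
    then show ?thesis using threshold_props[OF mj(1)] unfolding radix_def by blast
  qed
  moreover have "k 0 = 0" by (simp add: k_def)
  ultimately have "carry_sum p a b c k (threshold p)" using last unfolding carry_sum_def by blast
  then show ?thesis by (simp only: k_def)
qed


section \<open>The coded group of digit sequences\<close>

abbreviation dpos :: "nat \<Rightarrow> nat \<Rightarrow> nat" where "dpos c j \<equiv> pi1 (lnth c j)"
abbreviation dneg :: "nat \<Rightarrow> nat \<Rightarrow> nat" where "dneg c j \<equiv> pi2 (lnth c j)"

text \<open>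
  Digits are coded as differences of natural numbers, which keeps the conditions below free of
  subtraction. A digit of a group element has one of the two parts zero, so its code is unique.
\<close>

definition digit :: "nat \<Rightarrow> nat \<Rightarrow> int" where
  "digit c j = int (dpos c j) - int (dneg c j)"

definition digit_code :: "nat \<Rightarrow> (nat \<Rightarrow> int) \<Rightarrow> nat" where
  "digit_code n c = list_encode (map (\<lambda>j. prod_encode (nat (c j), nat (- c j))) [0..<n])"

definition group_code :: "baire \<Rightarrow> nat \<Rightarrow> bool" where
  "group_code p c \<longleftrightarrow> llen c = Suc (p 0) \<and> (\<forall>j<Suc (p 0). dpos c j = 0 \<or> dneg c j = 0) \<and>
     (\<forall>j<p 0. \<forall>t<dpos c j + dneg c j. j < p t)"

definition le_code :: "baire \<Rightarrow> nat \<Rightarrow> nat \<Rightarrow> bool" where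
  "le_code p a b \<longleftrightarrow> group_code p a \<and> group_code p b \<and> (a = b \<or>
     (\<exists>j<Suc (p 0). dpos a j + dneg b j < dpos b j + dneg a j \<and>
       (\<forall>k<Suc (p 0). j < k \<longrightarrow> lnth a k = lnth b k)))"

text \<open>\<open>carry_sum\<close> with the negative parts moved to the other side. The codes of
  carries need not have a zero part, so a vanishing carry is expressed by equal parts.\<close>

definition sum_code :: "baire \<Rightarrow> nat \<Rightarrow> nat \<Rightarrow> nat \<Rightarrow> nat \<Rightarrow> nat \<Rightarrow> bool" where
  "sum_code p a b c k t \<longleftrightarrow> dpos k 0 = dneg k 0 \<and>
     dpos a (p 0) + dpos b (p 0) + dpos k (p 0) + dneg c (p 0)
       = dneg a (p 0) + dneg b (p 0) + dneg k (p 0) + dpos c (p 0) \<and>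
     (\<forall>j<p 0.
        dpos k (Suc j) = dneg k (Suc j) \<and>
        dpos a j + dpos b j + dpos k j + dneg c j = dneg a j + dneg b j + dneg k j + dpos c j
      \<or> p (lnth t j) \<le> j \<and> (\<forall>s<lnth t j. j < p s) \<and>
        dpos a j + dpos b j + dpos k j + dneg c j + (2 * lnth t j + 1) * dneg k (Suc j)
          = dneg a j + dneg b j + dneg k j + dpos c j + (2 * lnth t j + 1) * dpos k (Suc j))"

lemma digit_code_digit [simp]: "j < n \<Longrightarrow> digit (digit_code n c) j = c j"
  by (simp add: digit_def digit_code_def)

lemma sum_code_iff:
  "sum_code p a b c k t \<longleftrightarrow> carry_sum p (digit a) (digit b) (digit c) (digit k) (lnth t)"
proof -
  have eq: "x = y \<longleftrightarrow> int x = int y" for x y by simp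
  have "digit k 0 = 0 \<longleftrightarrow> dpos k 0 = dneg k 0" by (simp add: digit_def)
  moreover have "digit k (Suc j) = 0 \<longleftrightarrow> dpos k (Suc j) = dneg k (Suc j)" for j by (simp add: digit_def)
  moreover have "digit a j + digit b j + digit k j = digit c j \<longleftrightarrow>
      dpos a j + dpos b j + dpos k j + dneg c j = dneg a j + dneg b j + dneg k j + dpos c j" for j
    unfolding digit_def eq of_nat_add by linarith
  moreover have "digit a j + digit b j + digit k j = digit c j + (2 * int (lnth t j) + 1) * digit k (Suc j)
    \<longleftrightarrow> dpos a j + dpos b j + dpos k j + dneg c j + (2 * lnth t j + 1) * dneg k (Suc j)
          = dneg a j + dneg b j + dneg k j + dpos c j + (2 * lnth t j + 1) * dpos k (Suc j)" for j
    unfolding digit_def eq of_nat_add of_nat_mult of_nat_numeral of_nat_1 right_diff_distrib by linarith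
  ultimately show ?thesis unfolding sum_code_def carry_sum_def by simp
qed

definition code_digits :: "baire \<Rightarrow> nat \<Rightarrow> nat \<Rightarrow> int" where
  "code_digits p c j = (if j \<le> p 0 then digit c j else 0)"

lemma carry_sum_cong:
  assumes "\<And>j. j \<le> p 0 \<Longrightarrow> a j = a' j \<and> b j = b' j \<and> c j = c' j \<and> k j = k' j \<and> t j = t' j"
  shows "carry_sum p a b c k t \<longleftrightarrow> carry_sum p a' b' c' k' t'"
proof -
  have "a j = a' j" "b j = b' j" "c j = c' j" "k j = k' j" "t j = t' j" if "j \<le> p 0" for j
    using assms[OF that] by blast+
  then show ?thesis unfolding carry_sum_def by (simp cong: conj_cong)
qed

lemma group_code_abs:
  assumes "group_code p c" "j \<le> p 0"
  shows "\<bar>digit c j\<bar> = int (dpos c j + dneg c j)"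
proof -
  have "dpos c j = 0 \<or> dneg c j = 0" using assms by (simp add: group_code_def)
  then show ?thesis unfolding digit_def by auto
qed

lemma group_code_digits:
  assumes "group_code p c" shows "code_digits p c \<in> digits p"
  unfolding digits_def
proof (intro CollectI conjI allI impI)
  show "code_digits p c \<in> Zvec (Suc (p 0))" by (simp add: Zvec_def code_digits_def)
  fix j t assume jt: "j < p 0" "int t < \<bar>code_digits p c j\<bar>"
  then have "t < dpos c j + dneg c j" using group_code_abs[OF assms, of j] by (simp add: code_digits_def)
  then show "j < p t" using assms jt(1) by (simp add: group_code_def)
qed

lemma group_code_nth_eq:
  assumes "group_code p a" "group_code p b" "j \<le> p 0"
  shows "lnth a j = lnth b j \<longleftrightarrow> digit a j = digit b j"
proof
  assume d: "digit a j = digit b j"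
  have "dpos a j = 0 \<or> dneg a j = 0" "dpos b j = 0 \<or> dneg b j = 0" using assms by (simp_all add: group_code_def)
  then have "dpos a j = dpos b j \<and> dneg a j = dneg b j" using d unfolding digit_def by linarith
  then have "prod_decode (lnth a j) = prod_decode (lnth b j)" by (simp add: prod_eq_iff)
  then show "lnth a j = lnth b j" by (simp add: prod_decode_eq)
qed (simp add: digit_def)

lemma group_code_inj:
  assumes "group_code p a" "group_code p b" "code_digits p a = code_digits p b"
  shows "a = b"
proof -
  obtain xs ys where xs: "a = list_encode xs" and ys: "b = list_encode ys" by (metis list_decode_inverse)
  have len: "length xs = Suc (p 0)" "length ys = Suc (p 0)"
    using assms(1,2) by (simp_all add: group_code_def xs ys)
  have "xs = ys"
  proof (rule nth_equalityI)
    fix j assume j: "j < length xs"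
    then have jp: "j \<le> p 0" using len by simp
    have "digit a j = digit b j" using fun_cong[OF assms(3), of j] jp by (simp add: code_digits_def)
    then have "lnth a j = lnth b j" using group_code_nth_eq[OF assms(1,2) jp] by blast
    then show "xs ! j = ys ! j" using j len by (simp add: xs ys)
  qed (simp add: len)
  then show ?thesis by (simp add: xs ys)
qed

lemma group_code_digit_code:
  assumes "c \<in> digits p"
  shows "group_code p (digit_code (Suc (p 0)) c)" and "code_digits p (digit_code (Suc (p 0)) c) = c"
proof -
  have code: "lnth (digit_code (Suc (p 0)) c) j = prod_encode (nat (c j), nat (- c j))" if "j < Suc (p 0)" for j
    using that unfolding digit_code_def by (subst lnth_encode) (simp_all del: upt_Suc)
  have "j < p t" if "j < p 0" "t < nat (c j) + nat (- c j)" for j t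
  proof -
    have "int t < \<bar>c j\<bar>" using that(2) by linarith
    then show ?thesis using assms that(1) by (simp add: digits_def)
  qed
  then show "group_code p (digit_code (Suc (p 0)) c)"
    unfolding group_code_def using code by (simp add: digit_code_def linear del: upt_Suc)
  show "code_digits p (digit_code (Suc (p 0)) c) = c"
  proof (rule ext)
    fix j
    show "code_digits p (digit_code (Suc (p 0)) c) j = c j"
      using assms by (cases "j \<le> p 0") (simp_all add: code_digits_def digits_def Zvec_def)
  qed
qed

lemma code_digits_bij: "bij_betw (code_digits p) {c. group_code p c} (digits p)"
proof (rule bij_betw_imageI)
  show "inj_on (code_digits p) {c. group_code p c}" by (rule inj_onI) (simp add: group_code_inj)
  show "code_digits p ` {c. group_code p c} = digits p"
  proof (intro equalityI subsetI)
    fix c assume "c \<in> digits p"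
    from group_code_digit_code[OF this] show "c \<in> code_digits p ` {c. group_code p c}"
      by (intro image_eqI[of _ _ "digit_code (Suc (p 0)) c"]) simp_all
  qed (use group_code_digits in blast)
qed

definition code_value :: "baire \<Rightarrow> nat \<Rightarrow> nat \<Rightarrow> int" where
  "code_value p c = digits_value p (code_digits p c)"

lemma code_value_bij: "bij_betw (code_value p) {c. group_code p c} (Zvec (Suc (min_val p)))"
  unfolding code_value_def using bij_betw_trans[OF code_digits_bij digits_value_bij]
  by (simp add: comp_def)

lemma le_code_iff:
  "le_code p a b \<longleftrightarrow> group_code p a \<and> group_code p b \<and> (a = b \<or> lexless (code_value p a) (code_value p b))"
proof (cases "group_code p a \<and> group_code p b")
  case True
  then have ab: "group_code p a" "group_code p b" by simp_all
  have less: "dpos a j + dneg b j < dpos b j + dneg a j \<longleftrightarrow> digit a j < digit b j" for j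
    unfolding digit_def by linarith
  have "lexless (code_value p a) (code_value p b) \<longleftrightarrow> lexless (code_digits p a) (code_digits p b)"
    unfolding code_value_def by (rule lexless_digits_value_iff[OF group_code_digits[OF ab(1)] group_code_digits[OF ab(2)]])
  also have "\<dots> \<longleftrightarrow> (\<exists>j<Suc (p 0). dpos a j + dneg b j < dpos b j + dneg a j \<and>
       (\<forall>k<Suc (p 0). j < k \<longrightarrow> lnth a k = lnth b k))"
  proof
    assume "lexless (code_digits p a) (code_digits p b)"
    then obtain j where j: "code_digits p a j < code_digits p b j"
      "\<forall>k>j. code_digits p a k = code_digits p b k" unfolding lexless_def by blast
    have jp: "j \<le> p 0" using j(1) by (cases "j \<le> p 0") (simp_all add: code_digits_def)
    have "lnth a k = lnth b k" if "k < Suc (p 0)" "j < k" for k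
      using group_code_nth_eq[OF ab, of k] j(2)[rule_format, OF that(2)] that(1)
      by (simp add: code_digits_def less_Suc_eq_le)
    moreover have "digit a j < digit b j" using j(1) jp by (simp add: code_digits_def)
    ultimately show "\<exists>j<Suc (p 0). dpos a j + dneg b j < dpos b j + dneg a j \<and>
       (\<forall>k<Suc (p 0). j < k \<longrightarrow> lnth a k = lnth b k)"
      using jp unfolding less by (intro exI[of _ j]) simp
  next
    assume "\<exists>j<Suc (p 0). dpos a j + dneg b j < dpos b j + dneg a j \<and>
       (\<forall>k<Suc (p 0). j < k \<longrightarrow> lnth a k = lnth b k)"
    then obtain j where j: "j < Suc (p 0)" "digit a j < digit b j"
      "\<forall>k<Suc (p 0). j < k \<longrightarrow> lnth a k = lnth b k" unfolding less by blast
    have "code_digits p a k = code_digits p b k" if "j < k" for k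
      using j(3) that by (simp add: code_digits_def digit_def)
    moreover have "code_digits p a j < code_digits p b j" using j(1,2) by (simp add: code_digits_def)
    ultimately show "lexless (code_digits p a) (code_digits p b)" unfolding lexless_def by blast
  qed
  finally show ?thesis unfolding le_code_def by blast
qed (simp add: le_code_def, blast)

text \<open>\<open>w\<close> is a certificate: the sum, the carries and the thresholds. The
  implication lets the search end at once if \<open>z\<close> does not code two group elements, so
  that it always succeeds.\<close>

definition sum_search :: "baire \<Rightarrow> nat \<Rightarrow> nat \<Rightarrow> bool" where
  "sum_search p w z \<longleftrightarrow> (group_code p (pi1 z) \<and> group_code p (pi2 z) \<longrightarrow>
     group_code p (pi1 w) \<and> sum_code p (pi1 z) (pi2 z) (pi1 w) (pi1 (pi2 w)) (pi2 (pi2 w)))"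

lemma sum_search_exists: "\<exists>w. sum_search p w z"
proof (cases "group_code p (pi1 z) \<and> group_code p (pi2 z)")
  case True
  let ?v = "\<lambda>i. code_value p (pi1 z) i + code_value p (pi2 z) i"
  have "?v \<in> Zvec (Suc (min_val p))"
    using digits_value_Zvec[of p] unfolding Zvec_def code_value_def by simp
  then obtain c where c: "group_code p c" "code_value p c = ?v"
    using bij_betw_imp_surj_on[OF code_value_bij[of p]] by (metis (mono_tags, lifting) imageE mem_Collect_eq)
  from carry_sum_exists[OF c(2)[unfolded code_value_def]]
  obtain k t where sum: "carry_sum p (code_digits p (pi1 z)) (code_digits p (pi2 z)) (code_digits p c) k t"
    by blast
  let ?k = "digit_code (Suc (p 0)) k" and ?t = "list_encode (map t [0..<Suc (p 0)])"
  have "carry_sum p (digit (pi1 z)) (digit (pi2 z)) (digit c) (digit ?k) (lnth ?t) \<longleftrightarrow>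
      carry_sum p (code_digits p (pi1 z)) (code_digits p (pi2 z)) (code_digits p c) k t"
  proof (rule carry_sum_cong, intro conjI)
    fix j assume j: "j \<le> p 0"
    show "digit (pi1 z) j = code_digits p (pi1 z) j" "digit (pi2 z) j = code_digits p (pi2 z) j"
      "digit c j = code_digits p c j" using j by (simp_all add: code_digits_def)
    show "digit ?k j = k j" using j by simp
    show "lnth ?t j = t j" using j by (subst lnth_encode) (simp_all del: upt_Suc)
  qed
  with sum have "sum_code p (pi1 z) (pi2 z) c ?k ?t" unfolding sum_code_iff by blast
  then show ?thesis
    unfolding sum_search_def
    using c(1) by (intro exI[of _ "prod_encode (c, prod_encode (?k, ?t))"])
      (simp only: prod_encode_inverse fst_conv snd_conv simp_thms)
next
  case False
  then show ?thesis unfolding sum_search_def by blast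
qed

definition sum_op :: "baire \<Rightarrow> baire" where
  "sum_op p z = pi1 (LEAST w. sum_search p w z)"

lemma sum_op_value:
  assumes "group_code p a" "group_code p b"
  shows "group_code p (sum_op p (prod_encode (a, b))) \<and>
    code_value p (sum_op p (prod_encode (a, b))) = (\<lambda>i. code_value p a i + code_value p b i)"
proof -
  define w where "w = (LEAST w. sum_search p w (prod_encode (a, b)))"
  have "sum_search p w (prod_encode (a, b))"
    unfolding w_def by (rule LeastI_ex[OF sum_search_exists])
  then have w: "group_code p (pi1 w)" "carry_sum p (digit a) (digit b) (digit (pi1 w)) (digit (pi1 (pi2 w)))
      (lnth (pi2 (pi2 w)))"
    using assms by (simp_all add: sum_search_def sum_code_iff)
  have "carry_sum p (digit a) (digit b) (digit (pi1 w)) (digit (pi1 (pi2 w))) (lnth (pi2 (pi2 w))) \<longleftrightarrow>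
    carry_sum p (code_digits p a) (code_digits p b) (code_digits p (pi1 w)) (digit (pi1 (pi2 w)))
      (lnth (pi2 (pi2 w)))"
    by (rule carry_sum_cong) (simp add: code_digits_def)
  with w(2) have "digits_value p (code_digits p (pi1 w))
      = (\<lambda>i. digits_value p (code_digits p a) i + digits_value p (code_digits p b) i)"
    by (intro carry_sum_sound) blast
  then show ?thesis using w(1) by (simp add: sum_op_def code_value_def flip: w_def)
qed

section \<open>A computable name of the group\<close>

definition group_name :: "baire \<Rightarrow> baire" where
  "group_name p = (\<lambda>n. if group_code p n then 1 else 0) \<oplus>\<^sub>B
     (sum_op p \<oplus>\<^sub>B (\<lambda>n. if le_code p (pi1 n) (pi2 n) then 1 else 0))"

lemma decidable_group_code: "computable_fun C \<Longrightarrow> decidable (\<lambda>p x. group_code p (C p x))"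
proof -
  have "decidable (\<lambda>p c. group_code p c)" unfolding group_code_def by (intro computable_intros)
  then show "computable_fun C \<Longrightarrow> decidable (\<lambda>p x. group_code p (C p x))" by (rule decidable_compose)
qed

lemma decidable_le_code: "computable_fun A \<Longrightarrow> computable_fun B \<Longrightarrow> decidable (\<lambda>p x. le_code p (A p x) (B p x))"
proof -
  have "decidable (\<lambda>p z. le_code p (pi1 z) (pi2 z))"
    unfolding le_code_def by (intro computable_intros decidable_group_code)
  then show "computable_fun A \<Longrightarrow> computable_fun B \<Longrightarrow> decidable (\<lambda>p x. le_code p (A p x) (B p x))" by (rule decidable_compose_pair)
qed

lemma decidable_sum_search: "computable_fun W \<Longrightarrow> computable_fun Z \<Longrightarrow> decidable (\<lambda>p x. sum_search p (W p x) (Z p x))"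
proof -
  have "decidable (\<lambda>p z. sum_search p (pi1 z) (pi2 z))"
    unfolding sum_search_def sum_code_def by (intro computable_intros decidable_group_code)
  then show "computable_fun W \<Longrightarrow> computable_fun Z \<Longrightarrow> decidable (\<lambda>p x. sum_search p (W p x) (Z p x))" by (rule decidable_compose_pair)
qed

lemma functional_group_name: "\<exists>a. \<forall>p. functional a p = Some (group_name p)"
proof -
  \<comment> \<open>The operation occupies the odd positions with even half. Only these need a
    search; elsewhere \<open>Q\<close> holds for every \<open>w\<close>.\<close>
  define Q where "Q p w x \<longleftrightarrow> even x \<or> odd (x div 2) \<or> sum_search p w (x div 2 div 2)" for p w x
  define V where "V p w x = (if even x then if group_code p (x div 2) then 1 else 0
    else if even (x div 2) then pi1 w
    else if le_code p (pi1 (x div 2 div 2)) (pi2 (x div 2 div 2)) then 1 else 0)" for p w x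
  have "\<exists>a. \<forall>p. (\<forall>x. \<exists>w. Q p w x) \<longrightarrow> functional a p = Some (\<lambda>x. V p (LEAST w. Q p w x) x)"
  proof (rule functional_search)
    show "decidable (\<lambda>p z. Q p (pi1 z) (pi2 z))"
      unfolding Q_def by (intro computable_intros decidable_sum_search)
    show "computable_fun (\<lambda>p z. V p (pi1 z) (pi2 z))"
      unfolding V_def by (intro computable_intros decidable_group_code decidable_le_code)
  qed
  moreover have "\<exists>w. Q p w x" for p x using sum_search_exists unfolding Q_def by blast
  moreover have "(\<lambda>x. V p (LEAST w. Q p w x) x) = group_name p" for p
  proof (rule ext)
    fix x
    show "V p (LEAST w. Q p w x) x = group_name p x"
    proof (cases "even x \<or> odd (x div 2)")
      case False
      then have "Q p w x = sum_search p w (x div 2 div 2)" for w by (simp add: Q_def)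
      with False show ?thesis by (simp add: V_def group_name_def join_def sum_op_def)
    qed (auto simp: V_def group_name_def join_def)
  qed
  ultimately show ?thesis by simp
qed

lemma set_rep_char: "set_rep (\<lambda>n. if P n then 1 else 0) = Some {n. P n}"
  by (auto simp: set_rep_def)

lemma rel_rep_char: "rel_rep (\<lambda>n. if P (pi1 n) (pi2 n) then 1 else 0) = Some {(x, y). P x y}"
  by (auto simp: rel_rep_def)

lemma ogroup_rep_group_name:
  defines "G \<equiv> \<lambda>p. coded_ogroup {c. group_code p c} (sum_op p) {(a, b). le_code p a b}"
  shows "ogroup_rep (group_name p) = Some (G p)"
    and "has_order_type (G p) (Zpow (natLeq_on (Suc (min_val p))))"
proof -
  have R: "{(a, b). le_code p a b} = {(a, b). a \<in> {c. group_code p c} \<and> b \<in> {c. group_code p c} \<and>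
      (a = b \<or> lexless (code_value p a) (code_value p b))}"
    by (simp add: le_code_iff)
  have op: "sum_op p (prod_encode (a, b)) \<in> {c. group_code p c} \<and>
      code_value p (sum_op p (prod_encode (a, b))) = (\<lambda>i. code_value p a i + code_value p b i)"
    if "a \<in> {c. group_code p c}" "b \<in> {c. group_code p c}" for a b
    using sum_op_value[of p a b] that by simp
  note coded = coded_ogroup_Zvec[OF code_value_bij op R]
  show "has_order_type (G p) (Zpow (natLeq_on (Suc (min_val p))))"
    unfolding G_def by (rule coded(2))
  show "ogroup_rep (group_name p) = Some (G p)"
    unfolding ogroup_rep_def group_name_def join_parts set_rep_char rel_rep_char G_def
    using coded(1) by simp
qed

section \<open>Recovering the minimum from a copy\<close>

text \<open>
  \<open>s\<close> is the join of \<open>p\<close> and a name of a copy \<open>(A, R)\<close>, and \<open>w\<close> is a pair of some \<open>n\<close> and a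
  list of \<open>p n + 1\<close> elements of \<open>A\<close>.
\<close>

definition long_list :: "baire \<Rightarrow> nat \<Rightarrow> bool" where
  "long_list s w \<longleftrightarrow> llen (pi2 w) = Suc (s (pi1 w + pi1 w)) \<and>
     (\<forall>j<llen (pi2 w). \<forall>i<j. lnth (pi2 w) i \<noteq> lnth (pi2 w) j) \<and>
     (\<forall>i<llen (pi2 w). s (Suc (4 * lnth (pi2 w) i)) = 1)"

text \<open>Membership of \<open>x\<close> in \<open>A\<close> is entry \<open>2 * x\<close> of the
  name of the copy, hence position \<open>4 * x + 1\<close> of the join.\<close>

lemma long_list_iff:
  "long_list (p \<oplus>\<^sub>B order_name (A, R)) (prod_encode (n, list_encode xs)) \<longleftrightarrow>
     length xs = Suc (p n) \<and> distinct xs \<and> set xs \<subseteq> A"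
proof -
  have "(p \<oplus>\<^sub>B order_name (A, R)) (n + n) = p n" by (simp add: join_def flip: mult_2)
  moreover have "(p \<oplus>\<^sub>B order_name (A, R)) (Suc (4 * x)) = (if x \<in> A then 1 else 0)" for x
  proof -
    have "Suc (4 * x) div 2 = 2 * x" by presburger
    then show ?thesis by (simp add: join_def order_name_def)
  qed
  moreover have "(\<forall>i<length xs. lnth (list_encode xs) i \<in> A) \<longleftrightarrow> set xs \<subseteq> A"
    by (auto simp: in_set_conv_nth subset_iff)
  ultimately show ?thesis
    unfolding long_list_def prod_encode_inverse fst_conv snd_conv distinct_list_code
    by (simp add: if_distrib cong: if_cong) auto
qed

lemma Min_le_OG: "Min_problem \<le>\<^sub>W OG_alpha0"
proof -
  obtain a where a: "\<And>p. functional a p = Some (group_name p)" using functional_group_name by blast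
  have "\<exists>b. \<forall>s. (\<forall>x :: nat. \<exists>w. long_list s w) \<longrightarrow>
      functional b s = Some (\<lambda>x. s (pi1 (LEAST w. long_list s w) + pi1 (LEAST w. long_list s w)))"
    unfolding long_list_def
    by (rule functional_search[where G = "\<lambda>s w x. s (pi1 w + pi1 w)"]) (intro computable_intros)+
  then obtain b where b: "\<And>s. \<exists>w. long_list s w \<Longrightarrow>
      functional b s = Some (\<lambda>x. s (pi1 (LEAST w. long_list s w) + pi1 (LEAST w. long_list s w)))"
    by auto
  show ?thesis
  proof (rule weihrauch_leI)
    fix p x assume "inputs Min_problem p = Some x"
    then have x: "x = p" by (simp add: Min_problem_def)
    define G where "G = coded_ogroup {c. group_code p c} (sum_op p) {(a, b). le_code p a b}"
    let ?\<beta> = "natLeq_on (Suc (min_val p))"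
    have G: "ogroup_rep (group_name p) = Some G" "has_order_type G (Zpow ?\<beta>)"
      unfolding G_def by (rule ogroup_rep_group_name)+
    have \<beta>: "Well_order ?\<beta>" "Field ?\<beta> = {..<Suc (min_val p)}"
      using natLeq_on_Well_order Field_natLeq_on by (simp_all add: lessThan_def)
    \<comment> \<open>Only the existence of a copy is wanted, so extending the empty list is
      enough.\<close>
    obtain C where "copy_of C ?\<beta>"
      by (rule list_order_extends[OF \<beta>(1), of "[]"]) simp_all
    then have "C \<in> solutions OG_alpha0 G"
      using G \<beta>(1) unfolding OG_alpha0_def problem.simps by (blast intro: ranI)
    then have "solutions OG_alpha0 G \<noteq> {}" by blast
    moreover have "G \<in> ran (inputs OG_alpha0)" using G(1) by (auto simp: OG_alpha0_def intro: ranI)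
    ultimately have inst: "G \<in> instances OG_alpha0" unfolding instances_def by blast
    have "\<exists>s w. functional b (p \<oplus>\<^sub>B q) = Some s \<and> outputs Min_problem s = Some w \<and> w \<in> solutions Min_problem x"
      if q: "outputs OG_alpha0 q = Some C" "C \<in> solutions OG_alpha0 G" for q C
    proof -
      obtain A R where C: "C = (A, R)" by (cases C)
      have "copy_rep q = Some (A, R)" using q(1) by (simp add: OG_alpha0_def C)
      note qn = copy_rep_SomeD[OF this]
      from q(2) obtain \<alpha> :: "nat rel" where \<alpha>: "Well_order \<alpha>" "has_order_type G (Zpow \<alpha>)" "copy_of (A, R) \<alpha>"
        unfolding C OG_alpha0_def problem.simps by blast
      have card: "finite (Field \<alpha>)" "card (Field \<alpha>) = Suc (min_val p)"
        using order_type_Zpow_card[OF \<alpha>(1,2) \<beta>(1) G(2)] by (simp_all add: \<beta>(2))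
      have A: "finite A" "card A = Suc (min_val p)"
        using copy_of_card[OF \<alpha>(3) card(1)] card(2) by simp_all
      obtain t where t: "p t = min_val p" using min_val_attained by blast
      obtain xs where xs: "set xs = A" "distinct xs" using finite_distinct_list[OF A(1)] by blast
      have "length xs = Suc (p t)" using distinct_card[OF xs(2)] by (simp add: xs(1) A(2) t)
      then have ex: "\<exists>w. long_list (p \<oplus>\<^sub>B q) w"
        unfolding qn(2) using long_list_iff[of p A R t xs] xs by blast
      define w where "w = (LEAST w. long_list (p \<oplus>\<^sub>B q) w)"
      have "long_list (p \<oplus>\<^sub>B q) w" unfolding w_def by (rule LeastI_ex[OF ex])
      moreover obtain n ys where w: "w = prod_encode (n, list_encode ys)"
        by (metis list_decode_inverse prod.collapse prod_decode_inverse)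
      ultimately have ys: "length ys = Suc (p n)" "distinct ys" "set ys \<subseteq> A"
        unfolding qn(2) w long_list_iff by blast+
      have "Suc (p n) \<le> card A" using card_mono[OF A(1) ys(3)] distinct_card[OF ys(2)] ys(1) by simp
      with A(2) min_val_le[of p n] have "p n = min_val p" by simp
      moreover have "(p \<oplus>\<^sub>B q) (pi1 w + pi1 w) = p n" by (simp add: w join_def flip: mult_2)
      ultimately have "functional b (p \<oplus>\<^sub>B q) = Some (\<lambda>x. min_val p)"
        using b[OF ex] unfolding w_def[symmetric] by simp
      then show ?thesis by (simp add: Min_problem_def nat_rep_def x min_val_def)
    qed
    with a inst G(1) show "\<exists>r z. functional a p = Some r \<and> inputs OG_alpha0 r = Some z \<and> z \<in> instances OG_alpha0 \<and>
      (\<forall>q y. outputs OG_alpha0 q = Some y \<and> y \<in> solutions OG_alpha0 z \<longrightarrow>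
         (\<exists>s w. functional b (p \<oplus>\<^sub>B q) = Some s \<and> outputs Min_problem s = Some w \<and> w \<in> solutions Min_problem x))"
      by (intro exI[of _ "group_name p"] exI[of _ G]) (simp add: OG_alpha0_def)
  qed
qed

theorem proposition2p28:
  shows "is_first_order_part TYPE('a) (first_order_part OG_alpha0) OG_alpha0 \<and>
         first_order_part OG_alpha0 \<equiv>\<^sub>W Min_problem"
proof
  show "is_first_order_part TYPE('a) (first_order_part OG_alpha0) OG_alpha0"
    by (rule is_first_order_part_first_order_part[OF problem_OG_alpha0])
  \<comment> \<open>Since \<open>Min\<close> is first-order, its reduction to the whole problem
    factors through the first-order part by maximality.\<close>
  have "first_order Min_problem"
    using problem_Min by (simp add: first_order_def Min_problem_def)
  then have "Min_problem \<le>\<^sub>W first_order_part OG_alpha0"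
    by (rule le_first_order_part[OF problem_OG_alpha0 _ Min_le_OG])
  with first_order_part_OG_le_Min show "first_order_part OG_alpha0 \<equiv>\<^sub>W Min_problem"
    unfolding weihrauch_equiv_def by blast
qed

end
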